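(* Assume that there is a constant $K_\rho$ with $w*\rho(x)\le K_\rho\,\rho(x)$ for all $x\in\mathbb{R}$, that for all $v\in L^2(\rho)$ one has $\partial_x (w*v)=w_x*v$, and that $$M:=\sup_{x\in\mathbb{R}}\int_{x-\mathcal{S}}\Big(\frac{w_x(x-y)}{w(x-y)}\Big)^2p_0(x,y)\,dy<\infty .$$ Assume furthermore that (i) there exist $\delta_1,\delta_2,\delta_1^*,\delta_2^*>0$ such that $\delta_1\hat u_x\le P\hat u_x\le\delta_2\hat u_x$ and $\delta_1^*\psi\le P^*\psi\le\delta_2^*\psi$ on $\mathbb{R}$; (ii) there exists $\kappa_0>0$ such that for all $h\in H^1(\mu)$, $\operatorname{Var}_\mu(h)\le\kappa_0\int h_x^2(x)\,\mu(dx)$. Then for all $v\in H^2(\rho)$, $$\langle L^{\#}v,v\rangle_\rho\le-\kappa\Big(\|v\|_\rho^2-\langle v,\hat u_x\rangle_\rho^2\Big),\qquad\text{where}\qquad \kappa=\frac{\delta_1^*}{2}\Big(1-\frac{\kappa_0M}{1+\kappa_0M}\Big).$$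
   Context: Notation. For a continuous density $\mu:\mathbb{R}\to(0,\infty)$, $H^k(\mu)$ is the weighted Sobolev space of $k$-times weakly differentiable functions with inner product $\langle u,v\rangle_{H^k(\mu)}=\sum_{i=0}^k\int u^{(i)}v^{(i)}\mu\,dx$; $L^2(\mu)=H^0(\mu)$, with inner product $\langle\cdot,\cdot\rangle_\mu$ and norm $\|\cdot\|_\mu$; $H^k$, $L^2$, $\langle\cdot,\cdot\rangle$ are the unweighted ($\mu\equiv1$) versions. $w*h(x)=\int w(x-y)h(y)\,dy$. $\operatorname{Var}_\mu(h)=\int h^2d\mu-(\int h\,d\mu)^2$ for a probability measure $\mu$; a probability density and the corresponding measure are denoted by the same symbol. Standing assumptions. $c\in\mathbb{R}$, $d\ge0$; $f,r,q\in C(\mathbb{R})$ are bounded, with $\inf_{\mathbb R} r>0$ and $\inf_{\mathbb R} q>0$; $w\ge0$ is differentiable almost everywhere (derivative $w_x$), $\int w\,dx=1$ and $\int|w_x|\,dx<\infty$. $\mathcal{S}=\{x\in\mathbb{R}:w(x)>0\}$ and $x-\mathcal{S}=\{x-s:s\in\mathcal{S}\}$. Operators. $L^{\#}v=Av+Pv$, where $Av=-fv+c\,\partial_xv+d\,\partial_{xx}v$ and $Pv(x)=\int p(x,y)v(y)\,dy$ with $p(x,y)=r(x)w(x-y)q(y)$, i.e. $Pv=r\,w*(qv)$; its domain in $L^2$ is $H^2$ ($H^1$ if $d=0$). The adjoint is $L^{\#,*}v=A^*v+P^*v$, where $A^*v=-fv-c\,\partial_xv+d\,\partial_{xx}v$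 and $P^*v(x)=\int p(y,x)v(y)\,dy$. It is assumed that there exist a unique (up to constant multiples) $0\not\equiv\hat u_x\in H^2$ with $L^{\#}\hat u_x=0$ and a unique (up to constant multiples) $0\not\equiv\psi\in H^2$ with $L^{\#,*}\psi=0$, and that $\hat u_x>0$ and $\psi>0$ ($\hat u_x$ is just the name of this function). $\psi$ is normalized so that $\langle\hat u_x,\psi\rangle=1$. Set $\rho(x)=\psi(x)/\hat u_x(x)$. Further definitions: $$p_0(x,y)=\frac{p(x,y)\hat u_x(y)}{P\hat u_x(x)}=\frac{w(x-y)q(y)\hat u_x(y)}{w*(q\hat u_x)(x)},\qquad \mu(x)=\frac1{Z_\mu}P\hat u_x(x)\,\psi(x),\qquad Z_\mu=\int P\hat u_x(x)\,\psi(x)\,dx .$$ *)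

theory Defs
  imports "HOL-Analysis.Analysis"
begin

subsection \<open>Weak derivatives and weighted Sobolev spaces on the real line\<close>

text \<open>Elements of function spaces are represented by Borel functions; equality in the spaces is
  equality almost everywhere with respect to \<^term>\<open>lborel\<close>.\<close>

definition locally_integrable :: "(real \<Rightarrow> real) \<Rightarrow> bool" where
  "locally_integrable v \<longleftrightarrow> (\<forall>a b. set_integrable lborel {a..b} v)"

definition test_function :: "(real \<Rightarrow> real) \<Rightarrow> bool" where
  "test_function \<phi> \<longleftrightarrow>
     (\<forall>n x. ((deriv ^^ n) \<phi>) field_differentiable (at x)) \<and>
     (\<exists>a b. \<forall>x. x \<notin> {a..b} \<longrightarrow> \<phi> x = 0)"

definition has_weak_derivative :: "nat \<Rightarrow> (real \<Rightarrow> real) \<Rightarrow> (real \<Rightarrow> real) \<Rightarrow> bool" where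
  "has_weak_derivative k v g \<longleftrightarrow>
     locally_integrable v \<and> locally_integrable g \<and>
     (\<forall>\<phi>. test_function \<phi> \<longrightarrow>
        (LINT x|lborel. v x * (deriv ^^ k) \<phi> x) = (-1) ^ k * (LINT x|lborel. g x * \<phi> x))"

text \<open>A representative of the k-th weak derivative; if one exists, it is unique up to null sets.\<close>

definition weak_deriv :: "nat \<Rightarrow> (real \<Rightarrow> real) \<Rightarrow> real \<Rightarrow> real" where
  "weak_deriv k v = (SOME g. has_weak_derivative k v g)"

definition weighted_L2 :: "(real \<Rightarrow> real) \<Rightarrow> (real \<Rightarrow> real) set" where
  "weighted_L2 \<mu> = {v. v \<in> borel_measurable lborel \<and> integrable lborel (\<lambda>x. (v x)\<^sup>2 * \<mu> x)}"

definition weighted_H :: "nat \<Rightarrow> (real \<Rightarrow> real) \<Rightarrow> (real \<Rightarrow> real) set" where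
  "weighted_H k \<mu> =
     {v \<in> weighted_L2 \<mu>. \<forall>i\<in>{1..k}. \<exists>g\<in>weighted_L2 \<mu>. has_weak_derivative i v g}"

definition weighted_inner :: "(real \<Rightarrow> real) \<Rightarrow> (real \<Rightarrow> real) \<Rightarrow> (real \<Rightarrow> real) \<Rightarrow> real" where
  "weighted_inner \<mu> u v = (LINT x|lborel. u x * v x * \<mu> x)"

definition weighted_norm :: "(real \<Rightarrow> real) \<Rightarrow> (real \<Rightarrow> real) \<Rightarrow> real" where
  "weighted_norm \<mu> v = sqrt (weighted_inner \<mu> v v)"

definition weighted_Var :: "(real \<Rightarrow> real) \<Rightarrow> (real \<Rightarrow> real) \<Rightarrow> real" where
  "weighted_Var \<mu> h = (LINT x|lborel. (h x)\<^sup>2 * \<mu> x) - (LINT x|lborel. h x * \<mu> x)\<^sup>2"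

lemma weighted_H_0: "weighted_H 0 \<mu> = weighted_L2 \<mu>"
  by (simp add: weighted_H_def)

subsection \<open>The operators\<close>

definition conv :: "(real \<Rightarrow> real) \<Rightarrow> (real \<Rightarrow> real) \<Rightarrow> real \<Rightarrow> real" where
  "conv w h x = (LINT y|lborel. w (x - y) * h y)"

definition kern :: "(real \<Rightarrow> real) \<Rightarrow> (real \<Rightarrow> real) \<Rightarrow> (real \<Rightarrow> real) \<Rightarrow> real \<Rightarrow> real \<Rightarrow> real" where
  "kern r w q x y = r x * w (x - y) * q y"

definition op_P :: "(real \<Rightarrow> real \<Rightarrow> real) \<Rightarrow> (real \<Rightarrow> real) \<Rightarrow> real \<Rightarrow> real" where
  "op_P p v x = (LINT y|lborel. p x y * v y)"

definition op_P_adj :: "(real \<Rightarrow> real \<Rightarrow> real) \<Rightarrow> (real \<Rightarrow> real) \<Rightarrow> real \<Rightarrow> real" where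
  "op_P_adj p v x = (LINT y|lborel. p y x * v y)"

definition op_A :: "(real \<Rightarrow> real) \<Rightarrow> real \<Rightarrow> real \<Rightarrow> (real \<Rightarrow> real) \<Rightarrow> real \<Rightarrow> real" where
  "op_A f c d v x = - f x * v x + c * weak_deriv 1 v x + d * weak_deriv 2 v x"

definition op_A_adj :: "(real \<Rightarrow> real) \<Rightarrow> real \<Rightarrow> real \<Rightarrow> (real \<Rightarrow> real) \<Rightarrow> real \<Rightarrow> real" where
  "op_A_adj f c d v x = - f x * v x - c * weak_deriv 1 v x + d * weak_deriv 2 v x"

definition op_L :: "(real \<Rightarrow> real) \<Rightarrow> real \<Rightarrow> real \<Rightarrow> (real \<Rightarrow> real \<Rightarrow> real) \<Rightarrow>
    (real \<Rightarrow> real) \<Rightarrow> real \<Rightarrow> real" where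
  "op_L f c d p v x = op_A f c d v x + op_P p v x"

definition op_L_adj :: "(real \<Rightarrow> real) \<Rightarrow> real \<Rightarrow> real \<Rightarrow> (real \<Rightarrow> real \<Rightarrow> real) \<Rightarrow>
    (real \<Rightarrow> real) \<Rightarrow> real \<Rightarrow> real" where
  "op_L_adj f c d p v x = op_A_adj f c d v x + op_P_adj p v x"

lemma op_P_kern: "op_P (kern r w q) v x = r x * conv w (\<lambda>y. q y * v y) x"
  unfolding op_P_def kern_def conv_def by (simp add: mult.assoc)

subsection \<open>The objects derived from the two null functions\<close>

definition rho :: "(real \<Rightarrow> real) \<Rightarrow> (real \<Rightarrow> real) \<Rightarrow> real \<Rightarrow> real" where
  "rho u \<psi> x = \<psi> x / u x"

definition p0 :: "(real \<Rightarrow> real \<Rightarrow> real) \<Rightarrow> (real \<Rightarrow> real) \<Rightarrow> real \<Rightarrow> real \<Rightarrow> real" where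
  "p0 p u x y = p x y * u y / op_P p u x"

definition Z_mu :: "(real \<Rightarrow> real \<Rightarrow> real) \<Rightarrow> (real \<Rightarrow> real) \<Rightarrow> (real \<Rightarrow> real) \<Rightarrow> real" where
  "Z_mu p u \<psi> = (LINT x|lborel. op_P p u x * \<psi> x)"

definition mu :: "(real \<Rightarrow> real \<Rightarrow> real) \<Rightarrow> (real \<Rightarrow> real) \<Rightarrow> (real \<Rightarrow> real) \<Rightarrow> real \<Rightarrow> real" where
  "mu p u \<psi> x = 1 / Z_mu p u \<psi> * (op_P p u x * \<psi> x)"

definition pos_set :: "(real \<Rightarrow> real) \<Rightarrow> real set" where
  "pos_set w = {x. w x > 0}"

text \<open>The supremum is taken in \<^typ>\<open>ennreal\<close>, so that its finiteness can be stated as a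
  hypothesis without the default values of divergent Bochner integrals or unbounded suprema.\<close>

definition M_const :: "(real \<Rightarrow> real) \<Rightarrow> (real \<Rightarrow> real) \<Rightarrow> (real \<Rightarrow> real \<Rightarrow> real) \<Rightarrow>
    (real \<Rightarrow> real) \<Rightarrow> ennreal" where
  "M_const w w\<^sub>x p u =
     (SUP x. \<integral>\<^sup>+y\<in>(\<lambda>s. x - s) ` pos_set w.
        ennreal ((w\<^sub>x (x - y) / w (x - y))\<^sup>2 * p0 p u x y) \<partial>lborel)"

lemma p0_kern:
  assumes "r x \<noteq> 0"
  shows "p0 (kern r w q) u x y = w (x - y) * q y * u y / conv w (\<lambda>y. q y * u y) x"
  using assms by (simp add: p0_def op_P_kern) (simp add: kern_def)

end

theory Submission
  imports Defs
begin

text \<open>Write \<open>v = u h\<close>, so that \<open>\<rho> v\<^sup>2 = u \<psi> h\<^sup>2\<close>. For the local operator \<open>A\<close> the product rule gives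
  \<open>2 h A(u h) = A(u h\<^sup>2) + h\<^sup>2 A u - 2 d u h'\<^sup>2\<close>. Multiplying by \<open>\<psi>\<close>, integrating, moving \<open>A\<close> onto \<open>\<psi>\<close>
  and inserting \<open>A u = - P u\<close> and \<open>A\<^sup>* \<psi> = - P\<^sup>* \<psi>\<close> leaves, with the kernel
  \<open>k(x, y) = \<psi>(x) p(x, y) u(y)\<close> and its marginals \<open>m = \<psi> P u\<close> and \<open>n = u P\<^sup>* \<psi>\<close>,

  \<open>2 \<langle>L v, v\<rangle> \<le> 2 \<integral>\<integral> k(x, y) h(x) h(y) - \<integral> h\<^sup>2 m - \<integral> h\<^sup>2 n = - \<integral>\<integral> k(x, y) (h(x) - h(y))\<^sup>2\<close>.

  Up to the factor \<open>Z = \<integral> m\<close>, the kernel \<open>k\<close> is the law of a pair \<open>(X, Y)\<close>, and \<open>X\<close> has the law \<open>\<mu>\<close>. The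
  best approximation of \<open>h(Y)\<close> by a function of \<open>X\<close> is \<open>Q h(x) = E[h(Y) | X = x]\<close>, so the double integral is
  at least \<open>Z E Var(h(Y) | X)\<close>. This quantity controls the full variance of \<open>h(Y)\<close>: by the law of total
  variance it remains to bound \<open>Var (Q h(X))\<close>, and the Poincare inequality for \<open>\<mu>\<close> bounds it by
  \<open>\<kappa>\<^sub>0 E[(Q h)'(X)\<^sup>2]\<close>. Differentiating the kernel shows that \<open>(Q h)'(x)\<close> is the
  conditional covariance of \<open>h(Y)\<close> and \<open>(w\<^sub>x / w)(x - Y)\<close>, whence \<open>(Q h)'(x)\<^sup>2 \<le> M Var(h(Y) | X = x)\<close> by
  Cauchy--Schwarz. Altogether \<open>Var h(Y) \<le> (1 + \<kappa>\<^sub>0 M) E Var(h(Y) | X)\<close>, and since \<open>Y\<close> has the density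
  \<open>n / Z\<close> with \<open>n \<ge> \<delta>\<^sub>1\<^sup>* u \<psi>\<close>, \<open>Z Var h(Y)\<close> is at least \<open>\<delta>\<^sub>1\<^sup>*\<close> times the variance of \<open>h\<close> with
  respect to the probability density \<open>u \<psi>\<close>, which is \<open>\<parallel>v\<parallel>\<^sup>2 - \<langle>v, u\<rangle>\<^sup>2\<close>. The probabilistic half is carried by
  \<open>Dirichlet_form_ge_cond_var\<close>, \<open>cond_weak_derivative\<close> and \<open>variance_le_cond_var\<close>.

  The delicate point of the local half, \<open>local_energy_inequality\<close>, is the integration by parts on the
  whole line: the boundary terms contain \<open>u'/u\<close> and \<open>\<psi>'/\<psi>\<close>. For \<open>d > 0\<close> both are bounded, because \<open>u\<close>
  and \<open>\<psi>\<close> are positive and satisfy \<open>d u'' \<plusminus> c u' \<le> K u\<close>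
  (\<open>positive_supersolution_log_derivative_bounded\<close>). The boundary terms are then dominated by the integrable
  function \<open>(v\<^sup>2 + v'\<^sup>2) \<rho>\<close> and vanish along suitable sequences.

  All this uses calculus for weakly differentiable functions. In one dimension these are the
  locally absolutely continuous ones up to null sets (\<open>weak_derivative_imp_ac\<close>), for which the product
  and quotient rules hold (\<open>has_ac_derivative_combine\<close>).\<close>

section \<open>Smooth functions with compact support\<close>

definition smooth :: "(real \<Rightarrow> real) \<Rightarrow> bool" where
  "smooth f \<longleftrightarrow> (\<forall>n x. ((deriv ^^ n) f) field_differentiable (at x))"

text \<open>Differentiability of all orders is a coinductive notion: it suffices to exhibit a class of
  differentiable functions that contains \<open>f\<close> and is closed under differentiation. This avoids explicit
  formulas for higher derivatives.\<close>

lemma smooth_coinduct: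
  assumes "f \<in> S"
    and step: "\<And>g. g \<in> S \<Longrightarrow> \<exists>g'\<in>S. \<forall>x. (g has_real_derivative g' x) (at x)"
  shows "smooth f"
proof -
  have "(deriv ^^ n) f \<in> S" for n
  proof (induction n)
    case 0
    then show ?case using assms(1) by simp
  next
    case (Suc n)
    then obtain g' where g': "g' \<in> S" "\<And>x. ((deriv ^^ n) f has_real_derivative g' x) (at x)"
      using step by blast
    then have "deriv ((deriv ^^ n) f) = g'" by (intro ext DERIV_imp_deriv)
    then show ?case using g' by simp
  qed
  then show ?thesis
    using step unfolding smooth_def field_differentiable_def by meson
qed

lemma smooth_has_deriv: "smooth f \<Longrightarrow> (f has_real_derivative deriv f x) (at x)"
  unfolding smooth_def using field_differentiable_derivI funpow_0 by metis

lemma smooth_deriv: "smooth f \<Longrightarrow> smooth (deriv f)"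
  unfolding smooth_def by (metis comp_apply funpow_Suc_right)

lemma smooth_continuous_on: "smooth f \<Longrightarrow> continuous_on A f"
  by (meson DERIV_isCont continuous_at_imp_continuous_on smooth_has_deriv)

lemma smooth_mult:
  assumes "smooth f" "smooth g"
  shows "smooth (\<lambda>x. f x * g x)"
proof -
  \<comment> \<open>Products alone are not closed under differentiation, but finite sums of products are.\<close>
  define P where "P = {(\<lambda>x. \<Sum>(f, g)\<leftarrow>l. f x * g x) | l. \<forall>(f, g)\<in>set l. smooth f \<and> smooth g}"
  have "(\<lambda>x. \<Sum>(f, g)\<leftarrow>[(f, g)]. f x * g x) \<in> P"
    unfolding P_def using assms by (intro CollectI exI[of _ "[(f, g)]"]) auto
  then have "(\<lambda>x. f x * g x) \<in> P" by simp
  then show ?thesis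
  proof (rule smooth_coinduct)
    fix F assume "F \<in> P"
    then obtain l where l: "\<forall>(f, g)\<in>set l. smooth f \<and> smooth g"
      and F: "F = (\<lambda>x. \<Sum>(f, g)\<leftarrow>l. f x * g x)" unfolding P_def by blast
    define l' where "l' = concat (map (\<lambda>(f, g). [(deriv f, g), (f, deriv g)]) l)"
    have l': "\<forall>(f, g)\<in>set l'. smooth f \<and> smooth g"
      using l unfolding l'_def by (fastforce dest: smooth_deriv)
    have "((\<lambda>x. \<Sum>(f, g)\<leftarrow>l. f x * g x) has_real_derivative (\<Sum>(f, g)\<leftarrow>l'. f x * g x)) (at x)" for x
      using l unfolding l'_def
    proof (induction l)
      case (Cons a l)
      obtain f g where [simp]: "a = (f, g)" by (cases a)
      have "((\<lambda>x. f x * g x) has_real_derivative (deriv f x * g x + f x * deriv g x)) (at x)"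
        using Cons.prems by (auto intro!: derivative_eq_intros smooth_has_deriv)
      from DERIV_add[OF this Cons.IH] Cons.prems show ?case by (simp add: add.assoc)
    qed simp
    then show "\<exists>g'\<in>P. \<forall>x. (F has_real_derivative g' x) (at x)"
      unfolding F P_def using l'
      by (intro bexI[of _ "\<lambda>x. \<Sum>(f, g)\<leftarrow>l'. f x * g x"]) auto
  qed
qed

lemma smooth_affine:
  assumes "smooth f"
  shows "smooth (\<lambda>x. f (a * x + b))"
proof -
  define S where "S = {(\<lambda>x. c * f (a * x + b)) | c f. smooth f}"
  have "(\<lambda>x. 1 * f (a * x + b)) \<in> S" unfolding S_def using assms by blast
  then have "(\<lambda>x. f (a * x + b)) \<in> S" by simp
  then show ?thesis
  proof (rule smooth_coinduct)
    fix F assume "F \<in> S"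
    then obtain c f where f: "smooth f" and F: "F = (\<lambda>x. c * f (a * x + b))" unfolding S_def by blast
    have "(F has_real_derivative (c * a) * deriv f (a * x + b)) (at x)" for x
      unfolding F by (rule derivative_eq_intros DERIV_chain2[OF smooth_has_deriv[OF f]] refl | simp)+
    moreover have "(\<lambda>x. (c * a) * deriv f (a * x + b)) \<in> S"
      unfolding S_def using smooth_deriv[OF f] by blast
    ultimately show "\<exists>g'\<in>S. \<forall>x. (F has_real_derivative g' x) (at x)" by (intro bexI allI)
  qed
qed

lemma smooth_const: "smooth (\<lambda>_. c)"
  by (rule smooth_coinduct[of _ "range (\<lambda>c _. c)"]) (auto intro!: exI[of _ 0])

lemma smooth_add:
  assumes "smooth f" "smooth g"
  shows "smooth (\<lambda>x. f x + g x)"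
proof -
  define S where "S = {(\<lambda>x. f x + g x) | f g. smooth f \<and> smooth g}"
  have "(\<lambda>x. f x + g x) \<in> S" unfolding S_def using assms by blast
  then show ?thesis
  proof (rule smooth_coinduct)
    fix F assume "F \<in> S"
    then obtain f g where f: "smooth f" "smooth g" and F: "F = (\<lambda>x. f x + g x)" unfolding S_def by blast
    have "(F has_real_derivative deriv f x + deriv g x) (at x)" for x
      unfolding F by (intro derivative_intros smooth_has_deriv f)
    moreover have "(\<lambda>x. deriv f x + deriv g x) \<in> S"
      unfolding S_def using smooth_deriv f by blast
    ultimately show "\<exists>g'\<in>S. \<forall>x. (F has_real_derivative g' x) (at x)" by (intro bexI allI)
  qed
qed

lemma smooth_antiderivative:
  assumes "\<And>x. (F has_real_derivative f x) (at x)" "smooth f"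
  shows "smooth F"
proof (rule smooth_coinduct[of _ "insert F (Collect smooth)"])
  fix g assume "g \<in> insert F (Collect smooth)"
  then show "\<exists>g'\<in>insert F (Collect smooth). \<forall>x. (g has_real_derivative g' x) (at x)"
    using assms smooth_has_deriv smooth_deriv by blast
qed simp

text \<open>The classical example of a smooth function that vanishes to infinite order at a point.\<close>

definition flat :: "real \<Rightarrow> real" where
  "flat x = (if x > 0 then exp (- 1 / x) else 0)"

lemma tendsto_poly_times_exp_minus: "((\<lambda>t::real. poly p t * exp (- t)) \<longlongrightarrow> 0) at_top"
proof -
  have "((\<lambda>t. \<Sum>i\<le>degree p. coeff p i * (t ^ i / exp t)) \<longlongrightarrow> (\<Sum>i\<le>degree p. coeff p i * 0)) at_top"
    by (intro tendsto_intros tendsto_power_div_exp_0)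
  then show ?thesis
    by (simp add: poly_altdef sum_distrib_right exp_minus divide_inverse mult.assoc)
qed

text \<open>All derivatives have the form \<open>p(1/x) exp(-1/x)\<close> on the positive half-line, with a polynomial \<open>p\<close>,
  and every such function tends to zero at the origin faster than linearly.\<close>

lemma smooth_flat: "smooth flat"
proof -
  define g where "g = (\<lambda>(p::real poly) x. if x > 0 then poly p (1 / x) * exp (- 1 / x) else 0)"
  have "flat = g 1" unfolding flat_def g_def by auto
  then have "flat \<in> range g" by simp
  then show ?thesis
  proof (rule smooth_coinduct)
    fix F assume "F \<in> range g"
    then obtain p where F: "F = g p" by blast
    define p' where "p' = [:0, 0, 1:] * (p - pderiv p)"
    have "(g p has_real_derivative g p' x) (at x)" for x
    proof (cases x "0 :: real" rule: linorder_cases)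
      case less
      have "((\<lambda>_. 0) has_real_derivative g p' x) (at x)" using less by (simp add: g_def)
      then show ?thesis
        by (rule has_field_derivative_transform_within_open[of _ _ _ "{..<0}"])
           (use less in \<open>auto simp: g_def\<close>)
    next
      case greater
      have "((\<lambda>x. poly p (1 / x) * exp (- 1 / x)) has_real_derivative g p' x) (at x)"
        using greater
        by (auto intro!: derivative_eq_intros DERIV_chain2[OF poly_DERIV]
              simp: g_def p'_def field_simps power2_eq_square)
      then show ?thesis
        by (rule has_field_derivative_transform_within_open[of _ _ _ "{0<..}"])
           (use greater in \<open>auto simp: g_def\<close>)
    next
      case equal
      have r: "((\<lambda>x. g p x / x) \<longlongrightarrow> 0) (at_right 0)"
      proof (rule Lim_transform_eventually)
        have "filterlim (\<lambda>x::real. 1 / x) at_top (at_right 0)"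
          using filterlim_inverse_at_top_right by (simp add: inverse_eq_divide)
        from filterlim_compose[OF tendsto_poly_times_exp_minus[of "pCons 0 p"] this]
        show "((\<lambda>x. poly (pCons 0 p) (1 / x) * exp (- (1 / x))) \<longlongrightarrow> 0) (at_right 0)" .
        show "\<forall>\<^sub>F x in at_right 0. poly (pCons 0 p) (1 / x) * exp (- (1 / x)) = g p x / x"
          unfolding eventually_at_right_field by (rule exI[of _ 1]) (auto simp: g_def)
      qed
      have l: "((\<lambda>x. g p x / x) \<longlongrightarrow> 0) (at_left 0)"
        by (rule Lim_transform_eventually[of "\<lambda>_. 0"])
           (auto simp: eventually_at_left_field g_def intro!: exI[of _ "-1"])
      have "((\<lambda>x. g p x / x) \<longlongrightarrow> 0) (at 0)"
        using l r by (simp add: filterlim_at_split)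
      then have "(g p has_real_derivative 0) (at 0)"
        unfolding DERIV_def by (simp add: g_def)
      then show ?thesis using equal by (simp add: g_def)
    qed
    then show "\<exists>g'\<in>range g. \<forall>x. (F has_real_derivative g' x) (at x)"
      unfolding F by blast
  qed
qed

text \<open>As \<open>n\<close> grows, these functions tend to the indicator of the open interval while staying between
  zero and one, which is what dominated convergence asks for.\<close>

definition bump :: "real \<Rightarrow> real \<Rightarrow> nat \<Rightarrow> real \<Rightarrow> real" where
  "bump a b n x = flat (real n * (x - a)) * flat (real n * (b - x))"

lemma flat_bounds: "0 \<le> flat x" "flat x \<le> 1"
  by (auto simp: flat_def)

lemma bump_bounds: "0 \<le> bump a b n x" "bump a b n x \<le> 1"
  using flat_bounds by (auto simp: bump_def intro!: mult_le_one)

lemma bump_outside: "x \<notin> {a<..<b} \<Longrightarrow> bump a b n x = 0"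
  by (auto simp: bump_def flat_def zero_less_mult_iff)

lemma test_function_iff:
  "test_function \<phi> \<longleftrightarrow> smooth \<phi> \<and> (\<exists>a b. \<forall>x. x \<notin> {a..b} \<longrightarrow> \<phi> x = 0)"
  by (simp add: test_function_def smooth_def)

lemma test_function_bump: "test_function (bump a b n)"
  unfolding test_function_iff
proof
  have "smooth (\<lambda>x. flat (real n * x + (- real n * a)) * flat ((- real n) * x + real n * b))"
    by (intro smooth_mult smooth_affine smooth_flat)
  then show "smooth (bump a b n)"
    by (rule back_subst[of smooth]) (auto simp: bump_def algebra_simps fun_eq_iff)
  show "\<exists>a' b'. \<forall>x. x \<notin> {a'..b'} \<longrightarrow> bump a b n x = 0"
    using bump_outside by (intro exI[of _ a] exI[of _ b]) auto
qed

lemma bump_tendsto: "(\<lambda>n. bump a b n x) \<longlonglongrightarrow> indicator {a<..<b} x"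
proof (cases "x \<in> {a<..<b}")
  case True
  have "(\<lambda>n. flat (real n * t)) \<longlonglongrightarrow> 1" if "t > 0" for t
  proof (rule Lim_transform_eventually)
    have "(\<lambda>n. exp (- ((1 / t) / real n))) \<longlonglongrightarrow> exp (- 0)"
      by (intro tendsto_intros lim_const_over_n)
    then show "(\<lambda>n. exp (- ((1 / t) / real n))) \<longlonglongrightarrow> 1" by simp
    show "\<forall>\<^sub>F n in sequentially. exp (- ((1 / t) / real n)) = flat (real n * t)"
      using eventually_gt_at_top[of 0] by eventually_elim (use that in \<open>simp add: flat_def field_simps\<close>)
  qed
  from tendsto_mult[OF this this, of "x - a" "b - x"] True show ?thesis
    by (simp add: bump_def)
next
  case False
  then show ?thesis by (simp add: bump_outside)
qed

section \<open>Locally absolutely continuous functions\<close>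

text \<open>Local absolute continuity, expressed as being a primitive of a locally Lebesgue integrable function.
  The derivative is only relevant up to null sets, so that the calculus below never differentiates
  such a function at a point.\<close>

definition has_ac_derivative :: "(real \<Rightarrow> real) \<Rightarrow> (real \<Rightarrow> real) \<Rightarrow> bool" where
  "has_ac_derivative F f \<longleftrightarrow>
     locally_integrable f \<and> (\<forall>a b. a \<le> b \<longrightarrow> F b - F a = (LBINT x:{a..b}. f x))"

lemma locally_integrableD: "locally_integrable f \<Longrightarrow> set_integrable lborel {a..b} f"
  by (simp add: locally_integrable_def)

lemma locally_integrable_measurable [measurable_dest]:
  assumes "locally_integrable f"
  shows "f \<in> borel_measurable borel"
proof (rule borel_measurable_LIMSEQ_real)
  fix n :: nat
  show "(\<lambda>x. indicator {- real n..real n} x * f x) \<in> borel_measurable borel"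
    using locally_integrableD[OF assms, of "- real n" "real n"]
    unfolding set_integrable_def by (auto dest: borel_measurable_integrable)
next
  fix x :: real
  obtain N where N: "real N \<ge> \<bar>x\<bar>" using real_arch_simple by blast
  show "(\<lambda>n. indicator {- real n..real n} x * f x) \<longlonglongrightarrow> f x"
  proof (rule tendsto_eventually)
    show "\<forall>\<^sub>F n in sequentially. indicator {- real n..real n} x * f x = f x"
      using eventually_ge_at_top[of N] by eventually_elim (use N in \<open>auto simp: indicator_def\<close>)
  qed
qed

lemma locally_integrable_integrable: "integrable lborel f \<Longrightarrow> locally_integrable f"
  unfolding locally_integrable_def set_integrable_def
  by (intro allI integrable_mult_indicator) auto

lemma locally_integrable_add:
  "locally_integrable f \<Longrightarrow> locally_integrable g \<Longrightarrow> locally_integrable (\<lambda>x. f x + g x)"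
  by (auto simp: locally_integrable_def)

lemma locally_integrable_diff:
  "locally_integrable f \<Longrightarrow> locally_integrable g \<Longrightarrow> locally_integrable (\<lambda>x. f x - g x)"
  by (auto simp: locally_integrable_def)

lemma locally_integrable_abs: "locally_integrable f \<Longrightarrow> locally_integrable (\<lambda>x. \<bar>f x\<bar>)"
  by (auto simp: locally_integrable_def intro: set_integrable_abs)

lemma locally_integrable_continuous: "continuous_on UNIV f \<Longrightarrow> locally_integrable f"
  unfolding locally_integrable_def
  by (auto intro!: borel_integrable_atLeastAtMost' elim: continuous_on_subset)

lemma locally_integrable_continuous_mult:
  assumes g: "continuous_on UNIV g" and f: "locally_integrable f"
  shows "locally_integrable (\<lambda>x. g x * f x)"
  unfolding locally_integrable_def
proof (intro allI)
  fix a b :: real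
  have [measurable]: "g \<in> borel_measurable borel" "f \<in> borel_measurable borel"
    using g f borel_measurable_continuous_onI locally_integrable_measurable by auto
  have "bounded (g ` {a..b})"
    by (intro compact_imp_bounded compact_continuous_image continuous_on_subset[OF g]) auto
  then obtain B where B: "\<And>x. x \<in> {a..b} \<Longrightarrow> \<bar>g x\<bar> \<le> B" unfolding bounded_iff by force
  show "set_integrable lborel {a..b} (\<lambda>x. g x * f x)"
  proof (rule set_integrable_bound)
    show "set_integrable lborel {a..b} (\<lambda>x. \<bar>B\<bar> * f x)"
      using locally_integrableD[OF f] by (intro set_integrable_mult_right)
    show "set_borel_measurable lborel {a..b} (\<lambda>x. g x * f x)"
      unfolding set_borel_measurable_def by measurable
    show "AE x in lborel. x \<in> {a..b} \<longrightarrow> norm (g x * f x) \<le> norm (\<bar>B\<bar> * f x)"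
      using B by (intro AE_I2 impI) (force simp: abs_mult intro!: mult_right_mono)
  qed
qed

lemma set_integral_split_Icc:
  fixes f :: "real \<Rightarrow> real"
  assumes "locally_integrable f" "a \<le> b" "b \<le> c"
  shows "(LBINT x:{a..c}. f x) = (LBINT x:{a..b}. f x) + (LBINT x:{b..c}. f x)"
proof -
  have "{a..c} = {a..b} \<union> {b..c}" using assms by auto
  moreover have "(LBINT x:{a..b} \<union> {b..c}. f x) = (LBINT x:{a..b}. f x) + (LBINT x:{b..c}. f x)"
  proof (rule set_integral_Un_AE)
    show "AE x in lborel. \<not> (x \<in> {a..b} \<and> x \<in> {b..c})"
      using AE_lborel_singleton[of b] by eventually_elim auto
  qed (use assms in \<open>auto intro: locally_integrableD\<close>)
  ultimately show ?thesis by simp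
qed

lemma ac_locally_integrable: "has_ac_derivative F f \<Longrightarrow> locally_integrable f"
  by (simp add: has_ac_derivative_def)

lemma ac_diff_eq: "has_ac_derivative F f \<Longrightarrow> a \<le> b \<Longrightarrow> F b - F a = (LBINT x:{a..b}. f x)"
  by (simp add: has_ac_derivative_def)

lemma locally_integrable_integral_small:
  assumes "locally_integrable f" "\<epsilon> > 0"
  shows "\<exists>\<delta>>0. \<forall>a b. a \<le> x \<and> x \<le> b \<and> b - a < \<delta> \<longrightarrow> \<bar>LBINT t:{a..b}. f t\<bar> < \<epsilon>"
proof -
  define G where "G = (\<lambda>y. integral {x - 1..y} f)"
  have fi: "f integrable_on {a..b}" and fe: "(LBINT t:{a..b}. f t) = integral {a..b} f" for a b
    using set_borel_integral_eq_integral[OF locally_integrableD[OF assms(1)]] by auto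
  have "continuous_on {x - 1..x + 1} G"
    unfolding G_def by (rule indefinite_integral_continuous_1[OF fi])
  moreover have "x \<in> {x-1..x+1}" "\<epsilon> / 2 > 0" using assms(2) by auto
  ultimately obtain d where d: "d > 0"
    "\<And>y. y \<in> {x-1..x+1} \<Longrightarrow> dist y x < d \<Longrightarrow> dist (G y) (G x) < \<epsilon> / 2"
    unfolding continuous_on_iff by blast
  show ?thesis
  proof (intro exI[of _ "min d 1"] conjI allI impI)
    fix a b assume ab: "a \<le> x \<and> x \<le> b \<and> b - a < min d 1"
    then have "\<bar>G a - G x\<bar> < \<epsilon> / 2" "\<bar>G b - G x\<bar> < \<epsilon> / 2"
      using d(2)[of a] d(2)[of b] by (auto simp: dist_real_def)
    moreover have "G b = G a + (LBINT t:{a..b}. f t)"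
      unfolding fe G_def using ab by (intro Henstock_Kurzweil_Integration.integral_combine[symmetric] fi) auto
    ultimately show "\<bar>LBINT t:{a..b}. f t\<bar> < \<epsilon>" by linarith
  qed (use d in auto)
qed

lemma ac_continuous_on:
  assumes "has_ac_derivative F f"
  shows "continuous_on A F"
proof -
  have "\<exists>d>0. \<forall>y. \<bar>y - x\<bar> < d \<longrightarrow> \<bar>F y - F x\<bar> < \<epsilon>" if \<epsilon>: "\<epsilon> > 0" for x \<epsilon>
  proof -
    obtain d where d: "d > 0" "\<And>a b. a \<le> x \<Longrightarrow> x \<le> b \<Longrightarrow> b - a < d \<Longrightarrow> \<bar>LBINT t:{a..b}. f t\<bar> < \<epsilon>"
      using locally_integrable_integral_small[OF ac_locally_integrable[OF assms] \<epsilon>, of x] by blast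
    have "\<bar>F y - F x\<bar> < \<epsilon>" if "\<bar>y - x\<bar> < d" for y
    proof (cases "y \<le> x")
      case True
      then show ?thesis using d(2)[of y x] ac_diff_eq[OF assms, of y x] that by auto
    next
      case False
      then show ?thesis using d(2)[of x y] ac_diff_eq[OF assms, of x y] that by auto
    qed
    then show ?thesis using d(1) by blast
  qed
  then have "continuous_on UNIV F" unfolding continuous_on_iff dist_real_def by blast
  then show ?thesis by (rule continuous_on_subset) simp
qed

text \<open>Both sides of the asserted identity are additive over adjacent intervals, and so is the error bound;
  the bisection argument of Bolzano therefore globalizes an estimate that is required on
  short intervals only.\<close>

lemma has_ac_derivative_local:
  assumes g: "locally_integrable g" and m: "locally_integrable m"
    and loc: "\<And>x \<epsilon>. \<epsilon> > 0 \<Longrightarrow> \<exists>\<delta>>0. \<forall>a b. a \<le> x \<and> x \<le> b \<and> b - a < \<delta> \<longrightarrow>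
       \<bar>H b - H a - (LBINT t:{a..b}. g t)\<bar> \<le> \<epsilon> * (LBINT t:{a..b}. m t)"
  shows "has_ac_derivative H g"
  unfolding has_ac_derivative_def
proof (intro conjI allI impI g)
  fix a b :: real assume "a \<le> b"
  have ineq: "\<bar>H b - H a - (LBINT t:{a..b}. g t)\<bar> \<le> \<epsilon> * (LBINT t:{a..b}. m t)" if "\<epsilon> > 0" for \<epsilon>
    using \<open>a \<le> b\<close>
  proof (rule Bolzano)
    fix a b c
    assume "\<bar>H b - H a - (LBINT t:{a..b}. g t)\<bar> \<le> \<epsilon> * (LBINT t:{a..b}. m t)"
      and "\<bar>H c - H b - (LBINT t:{b..c}. g t)\<bar> \<le> \<epsilon> * (LBINT t:{b..c}. m t)"
      and "a \<le> b" "b \<le> c"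
    then show "\<bar>H c - H a - (LBINT t:{a..c}. g t)\<bar> \<le> \<epsilon> * (LBINT t:{a..c}. m t)"
      using set_integral_split_Icc[OF g, of a b c] set_integral_split_Icc[OF m, of a b c]
      by (simp add: algebra_simps abs_le_iff)
  qed (use loc[OF that] in blast)
  have "\<bar>H b - H a - (LBINT t:{a..b}. g t)\<bar> \<le> 0"
  proof (rule tendsto_lowerbound[OF _ _ trivial_limit_at_right_real])
    show "((\<lambda>\<epsilon>. \<epsilon> * (LBINT t:{a..b}. m t)) \<longlongrightarrow> 0) (at_right 0)"
      by (auto intro!: tendsto_eq_intros)
    show "\<forall>\<^sub>F \<epsilon> in at_right 0. \<bar>H b - H a - (LBINT t:{a..b}. g t)\<bar> \<le> \<epsilon> * (LBINT t:{a..b}. m t)"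
      using eventually_at_right_less by eventually_elim (rule ineq)
  qed
  then show "H b - H a = (LBINT t:{a..b}. g t)" by simp
qed

text \<open>The increments of a product and of a quotient are combinations of the increments of both functions,
  with coefficients that depend continuously on the two end points. On a short interval these coefficients
  can be replaced by their values on the diagonal, at the cost of a small multiple of the integral
  of \<open>\<bar>f\<bar> + \<bar>g\<bar>\<close>. This single limit argument yields both rules.\<close>

lemma has_ac_derivative_combine:
  assumes F: "has_ac_derivative F f" and G: "has_ac_derivative G g"
    and K: "continuous_on UNIV (\<lambda>z. K (fst z) (snd z))" and L: "continuous_on UNIV (\<lambda>z. L (fst z) (snd z))"
    and H: "\<And>x y. H y - H x = K x y * (F y - F x) + L x y * (G y - G x)"
  shows "has_ac_derivative H (\<lambda>x. K x x * f x + L x x * g x)"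
proof (rule has_ac_derivative_local)
  note li = ac_locally_integrable[OF F] ac_locally_integrable[OF G]
  have Kd: "continuous_on UNIV (\<lambda>x. K x x)"
    using continuous_on_compose2[OF K, of UNIV "\<lambda>x. (x, x)"] by (simp add: continuous_on_Pair continuous_on_id)
  have Ld: "continuous_on UNIV (\<lambda>x. L x x)"
    using continuous_on_compose2[OF L, of UNIV "\<lambda>x. (x, x)"] by (simp add: continuous_on_Pair continuous_on_id)
  show g: "locally_integrable (\<lambda>x. K x x * f x + L x x * g x)"
    by (intro locally_integrable_add locally_integrable_continuous_mult Kd Ld li)
  show m: "locally_integrable (\<lambda>x. \<bar>f x\<bar> + \<bar>g x\<bar>)"
    by (intro locally_integrable_add locally_integrable_abs li)
  fix x \<epsilon> :: real assume \<epsilon>: "\<epsilon> > 0"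
  have ex: "\<exists>d>0. \<forall>y z. \<bar>y - x\<bar> < d \<and> \<bar>z - x\<bar> < d \<longrightarrow> \<bar>J y z - J x x\<bar> < \<epsilon> / 2"
    if "continuous_on UNIV (\<lambda>z. J (fst z) (snd z))" for J :: "real \<Rightarrow> real \<Rightarrow> real"
  proof -
    have "\<forall>e>0. \<exists>d>0. \<forall>z. dist z (x, x) < d \<longrightarrow> dist (J (fst z) (snd z)) (J x x) < e"
      using bspec[OF that[unfolded continuous_on_iff], of "(x, x)"] by simp
    moreover have "\<epsilon> / 2 > 0" using \<epsilon> by simp
    ultimately obtain d where d: "d > 0"
      "\<And>z. dist z (x, x) < d \<Longrightarrow> dist (J (fst z) (snd z)) (J x x) < \<epsilon> / 2"
      by blast
    have "\<bar>J y z - J x x\<bar> < \<epsilon> / 2" if "\<bar>y - x\<bar> < d / 2" "\<bar>z - x\<bar> < d / 2" for y z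
    proof -
      have "dist (y, z) (x, x) \<le> \<bar>y - x\<bar> + \<bar>z - x\<bar>"
        unfolding dist_Pair_Pair dist_real_def
        by (rule sqrt_sum_squares_le_sum_abs[THEN order_trans]) simp
      then have "dist (y, z) (x, x) < d" using that by linarith
      then show ?thesis using d(2)[of "(y, z)"] by (simp add: dist_real_def)
    qed
    then show ?thesis using d(1) by (intro exI[of _ "d/2"]) auto
  qed
  obtain d1 where d1: "d1 > 0" "\<And>y z. \<bar>y - x\<bar> < d1 \<Longrightarrow> \<bar>z - x\<bar> < d1 \<Longrightarrow> \<bar>K y z - K x x\<bar> < \<epsilon> / 2"
    using ex[OF K] by blast
  obtain d2 where d2: "d2 > 0" "\<And>y z. \<bar>y - x\<bar> < d2 \<Longrightarrow> \<bar>z - x\<bar> < d2 \<Longrightarrow> \<bar>L y z - L x x\<bar> < \<epsilon> / 2"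
    using ex[OF L] by blast
  show "\<exists>\<delta>>0. \<forall>a b. a \<le> x \<and> x \<le> b \<and> b - a < \<delta> \<longrightarrow>
     \<bar>H b - H a - (LBINT t:{a..b}. K t t * f t + L t t * g t)\<bar> \<le> \<epsilon> * (LBINT t:{a..b}. \<bar>f t\<bar> + \<bar>g t\<bar>)"
  proof (intro exI[of _ "min d1 d2"] conjI allI impI)
    fix a b assume ab: "a \<le> x \<and> x \<le> b \<and> b - a < min d1 d2"
    let ?D = "\<lambda>t. (K a b - K t t) * f t + (L a b - L t t) * g t"
    have D: "locally_integrable ?D"
      by (intro locally_integrable_add locally_integrable_continuous_mult continuous_intros Kd Ld li)
    have i1: "set_integrable lborel {a..b} (\<lambda>t. K a b * f t)" "set_integrable lborel {a..b} (\<lambda>t. L a b * g t)"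
      using li by (auto intro: locally_integrableD)
    have "H b - H a = K a b * (LBINT t:{a..b}. f t) + L a b * (LBINT t:{a..b}. g t)"
      using H[where x=a and y=b] ab by (simp add: ac_diff_eq[OF F] ac_diff_eq[OF G])
    also have "\<dots> = (LBINT t:{a..b}. K a b * f t + L a b * g t)"
      using i1 by simp
    finally have "H b - H a - (LBINT t:{a..b}. K t t * f t + L t t * g t)
        = (LBINT t:{a..b}. (K a b * f t + L a b * g t) - (K t t * f t + L t t * g t))"
      using locally_integrableD[OF g] i1 by (subst set_integral_diff) auto
    also have "\<dots> = (LBINT t:{a..b}. ?D t)"
      by (simp add: algebra_simps)
    finally have eq: "H b - H a - (LBINT t:{a..b}. K t t * f t + L t t * g t) = (LBINT t:{a..b}. ?D t)" .
    have "\<bar>LBINT t:{a..b}. ?D t\<bar> \<le> (LBINT t:{a..b}. \<bar>?D t\<bar>)"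
      using set_integral_norm_bound[OF locally_integrableD[OF D]] by simp
    also have "\<dots> \<le> (LBINT t:{a..b}. \<epsilon> * (\<bar>f t\<bar> + \<bar>g t\<bar>))"
    proof (rule set_integral_mono)
      show "set_integrable lborel {a..b} (\<lambda>t. \<bar>?D t\<bar>)"
        by (intro locally_integrableD locally_integrable_abs D)
      show "set_integrable lborel {a..b} (\<lambda>t. \<epsilon> * (\<bar>f t\<bar> + \<bar>g t\<bar>))"
        using locally_integrableD[OF m] \<epsilon> by simp
      fix t assume t: "t \<in> {a..b}"
      have "\<bar>K a b - K x x\<bar> < \<epsilon> / 2" "\<bar>K t t - K x x\<bar> < \<epsilon> / 2"
        "\<bar>L a b - L x x\<bar> < \<epsilon> / 2" "\<bar>L t t - L x x\<bar> < \<epsilon> / 2"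
        using ab t d1(2)[of a b] d1(2)[of t t] d2(2)[of a b] d2(2)[of t t] by auto
      then have "\<bar>K a b - K t t\<bar> \<le> \<epsilon>" "\<bar>L a b - L t t\<bar> \<le> \<epsilon>" by linarith+
      then have "\<bar>(K a b - K t t) * f t\<bar> \<le> \<epsilon> * \<bar>f t\<bar>" "\<bar>(L a b - L t t) * g t\<bar> \<le> \<epsilon> * \<bar>g t\<bar>"
        by (auto simp: abs_mult intro!: mult_right_mono)
      then show "\<bar>?D t\<bar> \<le> \<epsilon> * (\<bar>f t\<bar> + \<bar>g t\<bar>)"
        by (simp add: distrib_left)
    qed
    finally show "\<bar>H b - H a - (LBINT t:{a..b}. K t t * f t + L t t * g t)\<bar> \<le> \<epsilon> * (LBINT t:{a..b}. \<bar>f t\<bar> + \<bar>g t\<bar>)"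
      unfolding eq by simp
  qed (use d1 d2 in auto)
qed

lemma has_ac_derivative_mult:
  assumes F: "has_ac_derivative F f" and G: "has_ac_derivative G g"
  shows "has_ac_derivative (\<lambda>x. F x * G x) (\<lambda>x. f x * G x + F x * g x)"
proof -
  note [continuous_intros] = continuous_on_compose2[OF ac_continuous_on[OF F, of UNIV]]
    continuous_on_compose2[OF ac_continuous_on[OF G, of UNIV]]
  have "has_ac_derivative (\<lambda>x. F x * G x) (\<lambda>x. G x * f x + F x * g x)"
    by (rule has_ac_derivative_combine[OF F G, of "\<lambda>x y. G y" "\<lambda>x y. F x"])
       (auto intro!: continuous_intros simp: algebra_simps)
  then show ?thesis by (simp add: mult.commute)
qed

lemma has_ac_derivative_divide:
  assumes F: "has_ac_derivative F f" and G: "has_ac_derivative G g" and pos: "\<And>x. G x \<noteq> 0"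
  shows "has_ac_derivative (\<lambda>x. F x / G x) (\<lambda>x. f x / G x - F x * g x / (G x)\<^sup>2)"
proof -
  note [continuous_intros] = continuous_on_compose2[OF ac_continuous_on[OF F, of UNIV]]
    continuous_on_compose2[OF ac_continuous_on[OF G, of UNIV]]
  have "has_ac_derivative (\<lambda>x. F x / G x) (\<lambda>x. (1 / G x) * f x + (- F x / (G x * G x)) * g x)"
    by (rule has_ac_derivative_combine[OF F G, of "\<lambda>x y. 1 / G y" "\<lambda>x y. - F x / (G x * G y)"])
       (use pos in \<open>auto intro!: continuous_intros simp: field_simps\<close>)
  then show ?thesis by (simp add: power2_eq_square)
qed

lemma has_ac_derivative_add:
  assumes F: "has_ac_derivative F f" and G: "has_ac_derivative G g"
  shows "has_ac_derivative (\<lambda>x. F x + G x) (\<lambda>x. f x + g x)"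
  using has_ac_derivative_combine[OF F G, of "\<lambda>_ _. 1" "\<lambda>_ _. 1"] by simp

lemma has_ac_derivative_diff:
  assumes F: "has_ac_derivative F f" and G: "has_ac_derivative G g"
  shows "has_ac_derivative (\<lambda>x. F x - G x) (\<lambda>x. f x - g x)"
  using has_ac_derivative_combine[OF F G, of "\<lambda>_ _. 1" "\<lambda>_ _. -1"] by simp

lemma has_ac_derivative_cmult:
  assumes F: "has_ac_derivative F f"
  shows "has_ac_derivative (\<lambda>x. c * F x) (\<lambda>x. c * f x)"
  using has_ac_derivative_combine[OF F F, of "\<lambda>_ _. c" "\<lambda>_ _. 0"] by (simp add: algebra_simps)

lemma has_ac_derivative_C1:
  assumes "\<And>x. (F has_real_derivative f x) (at x)" "continuous_on UNIV f"
  shows "has_ac_derivative F f"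
  unfolding has_ac_derivative_def
proof (intro conjI allI impI)
  fix a b :: real assume "a \<le> b"
  then have "(LBINT x:{a..b}. f x) = F b - F a"
    unfolding set_lebesgue_integral_def using assms
    by (intro integral_FTC_atLeastAtMost)
       (auto intro: continuous_on_subset has_vector_derivative_at_within
         simp: has_real_derivative_iff_has_vector_derivative)
  then show "F b - F a = (LBINT x:{a..b}. f x)" by simp
qed (rule locally_integrable_continuous[OF assms(2)])

lemma has_ac_derivative_imp_has_real_derivative:
  assumes "has_ac_derivative F f" "continuous_on UNIV f"
  shows "(F has_real_derivative f x) (at x)"
proof -
  have "((\<lambda>u. integral {x-1..u} f) has_real_derivative f x) (at x within {x-1..x+1})"
    by (rule integral_has_real_derivative) (auto intro: continuous_on_subset[OF assms(2)])
  then have "((\<lambda>u. integral {x-1..u} f) has_real_derivative f x) (at x)"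
    by (subst (asm) at_within_Icc_at) auto
  then have "((\<lambda>u. F (x-1) + integral {x-1..u} f) has_real_derivative f x) (at x)"
    by (auto intro!: derivative_eq_intros)
  then show ?thesis
  proof (rule has_field_derivative_transform_within_open[of _ _ _ "{x-1<..}"])
    fix y assume "y \<in> {x-1<..}"
    then show "F (x-1) + integral {x-1..y} f = F y"
      using ac_diff_eq[OF assms(1), of "x-1" y]
        set_borel_integral_eq_integral(2)[OF locally_integrableD[OF ac_locally_integrable[OF assms(1)]]]
      by simp
  qed auto
qed

lemma has_ac_derivative_primitive:
  assumes "locally_integrable f"
  shows "\<exists>F. has_ac_derivative F f"
proof -
  define F where "F = (\<lambda>x. if x \<ge> 0 then LBINT t:{0..x}. f t else - (LBINT t:{x..0}. f t))"
  have "F b - F a = (LBINT x:{a..b}. f x)" if "a \<le> b" for a b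
    using set_integral_split_Icc[OF assms, of 0 a b] set_integral_split_Icc[OF assms, of a 0 b]
      set_integral_split_Icc[OF assms, of a b 0] that
    unfolding F_def by auto
  then show ?thesis unfolding has_ac_derivative_def using assms by blast
qed

lemma ac_decreasing:
  assumes "has_ac_derivative F f" "AE x in lborel. f x \<le> 0" "a \<le> b"
  shows "F b \<le> F a"
proof -
  have "(LBINT x:{a..b}. f x) \<le> (LBINT x:{a..b}. 0)"
    using assms(2) ac_locally_integrable[OF assms(1)]
    by (intro set_integral_mono_AE locally_integrableD)
       (auto intro: locally_integrable_continuous continuous_intros)
  then show ?thesis using ac_diff_eq[OF assms(1,3)] by simp
qed

section \<open>Weak derivatives in one dimension\<close>

lemma integral_eq_set_integral:
  fixes f :: "real \<Rightarrow> real"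
  assumes "\<And>x. x \<notin> A \<Longrightarrow> f x = 0"
  shows "(LINT x|lborel. f x) = (LINT x:A|lborel. f x)"
  unfolding set_lebesgue_integral_def
  by (rule Bochner_Integration.integral_cong) (use assms in \<open>auto simp: indicator_def\<close>)

lemma integrable_vanishing_outside:
  fixes f :: "real \<Rightarrow> real"
  assumes "locally_integrable f" "\<And>x. x \<notin> {a..b} \<Longrightarrow> f x = 0"
  shows "integrable lborel f"
proof -
  have "(\<lambda>x. indicator {a..b} x *\<^sub>R f x) = f" using assms(2) by (force simp: indicator_def)
  then show ?thesis using locally_integrableD[OF assms(1), of a b] by (simp add: set_integrable_def)
qed

lemma deriv_vanishing_outside:
  fixes f :: "real \<Rightarrow> real"
  assumes "\<And>x. x \<notin> {a..b} \<Longrightarrow> f x = 0" "x \<notin> {a..b}"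
  shows "deriv f x = 0"
proof -
  have "((\<lambda>_. 0) has_real_derivative 0) (at x)" by simp
  then have "(f has_real_derivative 0) (at x)"
    by (rule has_field_derivative_transform_within_open[of _ _ _ "- {a..b}"]) (use assms in auto)
  then show ?thesis by (rule DERIV_imp_deriv)
qed

lemma test_function_integrable:
  assumes "test_function \<phi>" "locally_integrable f"
  shows "integrable lborel (\<lambda>x. f x * \<phi> x)"
proof -
  obtain a b where "\<And>x. x \<notin> {a..b} \<Longrightarrow> \<phi> x = 0" and s: "smooth \<phi>"
    using assms(1) unfolding test_function_iff by blast
  then have "integrable lborel (\<lambda>x. \<phi> x * f x)"
    by (intro integrable_vanishing_outside[of _ a b] locally_integrable_continuous_mult
        smooth_continuous_on assms(2)) auto
  then show ?thesis by (simp add: mult.commute)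
qed

lemma test_function_deriv:
  assumes "test_function \<phi>"
  shows "test_function (deriv \<phi>)"
  using assms smooth_deriv deriv_vanishing_outside unfolding test_function_iff by blast

text \<open>The product with a test function is absolutely continuous and vanishes at both ends of a
  sufficiently large interval.\<close>

lemma ac_imp_has_weak_derivative:
  assumes F: "has_ac_derivative F f"
  shows "has_weak_derivative 1 F f"
  unfolding has_weak_derivative_def
proof (intro conjI allI impI)
  show "locally_integrable F"
    by (rule locally_integrable_continuous[OF ac_continuous_on[OF F]])
  show f: "locally_integrable f" by (rule ac_locally_integrable[OF F])
  fix \<phi> assume "test_function \<phi>"
  then obtain a b where ab: "\<And>x. x \<notin> {a..b} \<Longrightarrow> \<phi> x = 0" and s: "smooth \<phi>"
    unfolding test_function_iff by blast
  define a' b' where "a' = min a b - 1" and "b' = max a b + 1"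
  have out: "x \<notin> {a'..b'} \<Longrightarrow> \<phi> x = 0" "x \<notin> {a'..b'} \<Longrightarrow> deriv \<phi> x = 0" for x
    using ab[of x] deriv_vanishing_outside[of a b \<phi> x, OF ab] by (force simp: a'_def b'_def)+
  have \<phi>: "has_ac_derivative \<phi> (deriv \<phi>)"
    by (intro has_ac_derivative_C1 smooth_has_deriv smooth_continuous_on smooth_deriv s)
  have "(LBINT x:{a'..b'}. f x * \<phi> x + F x * deriv \<phi> x) = F b' * \<phi> b' - F a' * \<phi> a'"
    using ac_diff_eq[OF has_ac_derivative_mult[OF F \<phi>], of a' b'] by (simp add: a'_def b'_def)
  also have "a' \<notin> {a..b}" "b' \<notin> {a..b}" by (auto simp: a'_def b'_def)
  then have "F b' * \<phi> b' - F a' * \<phi> a' = 0" using ab by simp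
  finally have "(LINT x|lborel. f x * \<phi> x + F x * deriv \<phi> x) = 0"
    using out by (subst integral_eq_set_integral[where A="{a'..b'}"]) auto
  then show "(LINT x|lborel. F x * (deriv ^^ 1) \<phi> x) = (-1) ^ 1 * (LINT x|lborel. f x * \<phi> x)"
    using test_function_integrable[OF \<open>test_function \<phi>\<close> f]
      test_function_integrable[OF test_function_deriv[OF \<open>test_function \<phi>\<close>] \<open>locally_integrable F\<close>]
    by simp
qed

text \<open>Open intervals form an intersection-stable generator of the Borel sets, so the integral vanishes over
  all Borel subsets of a bounded interval, and an integrable function with this property is zero.\<close>

lemma AE_zero_of_interval_integrals:
  fixes g :: "real \<Rightarrow> real"
  assumes g: "locally_integrable g" and zero: "\<And>a b. (LBINT x:{a<..<b}. g x) = 0"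
  shows "AE x in lborel. g x = 0"
proof -
  have gen: "sets borel = sigma_sets UNIV (range (\<lambda>(a, b). {a<..<b::real}))"
  proof -
    have eq: "(\<lambda>(a, b). box a b) = (\<lambda>(a, b). {a<..<b::real})" by (auto simp: fun_eq_iff)
    show ?thesis by (subst borel_eq_box, subst eq) simp
  qed
  have stable: "Int_stable (range (\<lambda>(a, b). {a<..<b::real}))"
  proof (rule Int_stableI)
    fix A B :: "real set"
    assume "A \<in> range (\<lambda>(a, b). {a<..<b})" "B \<in> range (\<lambda>(a, b). {a<..<b})"
    then obtain a b a' b' where "A = {a<..<b}" "B = {a'<..<b'}" by auto
    then show "A \<inter> B \<in> range (\<lambda>(a, b). {a<..<b})"
      by (intro range_eqI[of _ _ "(max a a', min b b')"]) simp
  qed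
  have subset_Pow: "range (\<lambda>(a, b). {a<..<b::real}) \<subseteq> Pow UNIV" by simp
  have "AE x in lborel. indicator {-real n<..<real n} x * g x = 0" for n
  proof (rule sigma_finite_measure.density_zero[OF sigma_finite_lborel])
    let ?h = "\<lambda>x. indicator {-real n<..<real n} x * g x"
    have "set_integrable lborel {-real n<..<real n} g"
      by (rule set_integrable_subset[OF locally_integrableD[OF g, of "- real n" "real n"]]) auto
    then show h: "integrable lborel ?h" by (simp add: set_integrable_def)
    then have hs: "set_integrable lborel A ?h" if "A \<in> sets borel" for A
      unfolding set_integrable_def using that by (intro integrable_mult_indicator) auto
    fix A :: "real set" assume "A \<in> sets lborel"
    then have "A \<in> sigma_sets UNIV (range (\<lambda>(a, b). {a<..<b::real}))"
      by (simp add: gen)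
    then show "(LBINT x:A. ?h x) = 0"
    proof (induction rule: sigma_sets_induct_disjoint[OF stable subset_Pow, consumes 1, case_names basic empty compl union])
      case (basic A)
      then obtain a b where A: "A = {a<..<b}" by auto
      have "(LBINT x:A. ?h x) = (LBINT x:{max a (-real n)<..<min b (real n)}. g x)"
        unfolding set_lebesgue_integral_def A
        by (rule Bochner_Integration.integral_cong) (auto simp: indicator_def)
      then show ?case using zero by simp
    next
      case empty
      then show ?case by (simp add: set_lebesgue_integral_def)
    next
      case (compl A)
      then have A: "A \<in> sets borel" by (simp add: gen)
      have "(LBINT x:A \<union> (UNIV - A). ?h x) = (LBINT x:A. ?h x) + (LBINT x:UNIV - A. ?h x)"
        using A by (intro set_integral_Un hs) auto
      moreover have "(LBINT x:A \<union> (UNIV - A). ?h x) = (LBINT x:{-real n<..<real n}. g x)"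
        unfolding set_lebesgue_integral_def by simp
      ultimately show ?case using compl zero by simp
    next
      case (union A)
      have "A i \<in> sets borel" for i using union by (auto simp: gen)
      then have "(LBINT x:(\<Union>i. A i). ?h x) = (\<Sum>i. (LBINT x:A i. ?h x))"
        using union by (intro lebesgue_integral_countable_add hs) (auto simp: disjoint_family_on_def)
      then show ?case using union by simp
    qed
  qed
  then have "AE x in lborel. \<forall>n. indicator {-real n<..<real n} x * g x = 0"
    unfolding AE_all_countable by blast
  then show ?thesis
  proof eventually_elim
    fix x assume *: "\<forall>n. indicator {-real n<..<real n} x * g x = 0"
    obtain n where "real n > \<bar>x\<bar>" using reals_Archimedean2 by blast
    then show "g x = 0" using *[rule_format, of n] by (auto simp: indicator_def split: if_splits)
  qed
qed

text \<open>The test functions \<open>bump a b n\<close> turn the hypothesis into vanishing integrals over intervals.\<close>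

lemma fundamental_lemma:
  assumes g: "locally_integrable g"
    and zero: "\<And>\<phi>. test_function \<phi> \<Longrightarrow> (LINT x|lborel. g x * \<phi> x) = 0"
  shows "AE x in lborel. g x = 0"
proof (rule AE_zero_of_interval_integrals[OF g])
  fix a b :: real
  have [measurable]: "g \<in> borel_measurable borel" by (rule locally_integrable_measurable[OF g])
  have [measurable]: "bump a b n \<in> borel_measurable borel" for n
    using test_function_bump[of a b n]
    by (auto simp: test_function_iff intro: borel_measurable_continuous_onI smooth_continuous_on)
  have "(\<lambda>n. LINT x|lborel. g x * bump a b n x) \<longlonglongrightarrow> (LINT x|lborel. g x * indicator {a<..<b} x)"
  proof (rule integral_dominated_convergence)
    show "integrable lborel (\<lambda>x. indicator {a..b} x * \<bar>g x\<bar>)"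
      using locally_integrableD[OF locally_integrable_abs[OF g], of a b] by (simp add: set_integrable_def)
    show "AE x in lborel. (\<lambda>n. g x * bump a b n x) \<longlonglongrightarrow> g x * indicator {a<..<b} x"
      by (intro AE_I2 tendsto_intros bump_tendsto)
    show "AE x in lborel. norm (g x * bump a b n x) \<le> indicator {a..b} x * \<bar>g x\<bar>" for n
    proof (rule AE_I2)
      fix x
      show "norm (g x * bump a b n x) \<le> indicator {a..b} x * \<bar>g x\<bar>"
        using bump_bounds[of a b n x] bump_outside[of x a b n]
        by (cases "x \<in> {a<..<b}") (auto simp: abs_mult mult_left_le)
    qed
  qed measurable
  then have "(LINT x|lborel. g x * indicator {a<..<b} x) = 0"
    by (simp add: zero[OF test_function_bump] LIMSEQ_const_iff)
  then show "(LBINT x:{a<..<b}. g x) = 0"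
    by (simp add: set_lebesgue_integral_def mult.commute)
qed

lemma has_weak_derivative_unique:
  assumes "has_weak_derivative k v g" "has_weak_derivative k v g'"
  shows "AE x in lborel. g x = g' x"
proof -
  have li: "locally_integrable g" "locally_integrable g'"
    using assms by (auto simp: has_weak_derivative_def)
  have "AE x in lborel. g x - g' x = 0"
  proof (rule fundamental_lemma)
    show "locally_integrable (\<lambda>x. g x - g' x)" by (intro locally_integrable_diff li)
    fix \<phi> assume \<phi>: "test_function \<phi>"
    have "(LINT x|lborel. v x * (deriv ^^ k) \<phi> x) = (-1) ^ k * (LINT x|lborel. g x * \<phi> x)"
      "(LINT x|lborel. v x * (deriv ^^ k) \<phi> x) = (-1) ^ k * (LINT x|lborel. g' x * \<phi> x)"
      using assms \<phi> by (simp_all add: has_weak_derivative_def)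
    then show "(LINT x|lborel. (g x - g' x) * \<phi> x) = 0"
      using test_function_integrable[OF \<phi> li(1)] test_function_integrable[OF \<phi> li(2)]
      by (simp add: left_diff_distrib)
  qed
  then show ?thesis by simp
qed

text \<open>The lemma of du Bois-Reymond. A test function is the derivative of a test function exactly if its
  integral vanishes, which can be enforced by subtracting a multiple of one fixed bump \<open>\<eta>\<close>. The
  hypothesis then says that \<open>W\<close> minus its mean against \<open>\<eta>\<close> annihilates all test functions.\<close>

lemma weak_derivative_zero_imp_const:
  assumes W: "locally_integrable W"
    and zero: "\<And>\<phi>. test_function \<phi> \<Longrightarrow> (LINT x|lborel. W x * deriv \<phi> x) = 0"
  shows "\<exists>c. AE x in lborel. W x = c"
proof -
  define \<eta> where "\<eta> = bump 0 1 1"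
  have \<eta>: "test_function \<eta>" unfolding \<eta>_def by (rule test_function_bump)
  have one: "locally_integrable (\<lambda>_. 1 :: real)" by (intro locally_integrable_continuous continuous_intros)
  have int: "integrable lborel \<phi>" if "test_function \<phi>" for \<phi>
    using test_function_integrable[OF that one] by simp
  define I where "I = (LINT x|lborel. \<eta> x)"
  have "I \<noteq> 0"
  proof
    assume "I = 0"
    then have "AE x in lborel. \<eta> x = 0"
      unfolding I_def using integral_nonneg_eq_0_iff_AE[OF int[OF \<eta>]] bump_bounds by (simp add: \<eta>_def)
    then have "AE x in lborel. x \<notin> {0<..<1::real}"
      by eventually_elim (auto simp: \<eta>_def bump_def flat_def)
    then have "emeasure lborel {0<..<1::real} = 0"
      by (subst (asm) AE_iff_measurable[of "{0<..<1}"]) auto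
    then show False by simp
  qed
  define c where "c = (LINT x|lborel. W x * \<eta> x) / I"
  have "AE x in lborel. W x - c = 0"
  proof (rule fundamental_lemma)
    show Wc: "locally_integrable (\<lambda>x. W x - c)"
      by (intro locally_integrable_diff W locally_integrable_continuous continuous_intros)
    fix \<phi> assume \<phi>: "test_function \<phi>"
    define s where "s = (LINT x|lborel. \<phi> x) / I"
    define \<theta> where "\<theta> = (\<lambda>x. \<phi> x + (- s) * \<eta> x)"
    have \<theta>s: "smooth \<theta>"
      unfolding \<theta>_def using \<phi> \<eta> by (intro smooth_add smooth_mult smooth_const) (auto simp: test_function_iff)
    obtain a1 b1 where ab1: "\<And>x. x \<notin> {a1..b1} \<Longrightarrow> \<phi> x = 0"
      using \<phi> unfolding test_function_iff by blast
    define a b where "a = min a1 0 - 1" and "b = max (max b1 1) a1 + 1"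
    have "a \<le> b" unfolding a_def b_def by simp
    have out: "\<theta> x = 0" if "x \<notin> {a<..<b}" for x
      using that ab1[of x] bump_outside[of x 0 1 1] by (force simp: \<theta>_def \<eta>_def a_def b_def)
    have \<theta>c: "continuous_on UNIV \<theta>" by (rule smooth_continuous_on[OF \<theta>s])
    have "(LINT x|lborel. \<theta> x) = (LINT x|lborel. \<phi> x) - s * I"
      unfolding \<theta>_def I_def using int[OF \<phi>] int[OF \<eta>] by simp
    also have "\<dots> = 0" using \<open>I \<noteq> 0\<close> by (simp add: s_def)
    finally have \<theta>0: "(LINT x|lborel. \<theta> x) = 0" .
    obtain F where F: "has_ac_derivative F \<theta>"
      using has_ac_derivative_primitive[OF locally_integrable_continuous[OF \<theta>c]] by blast
    define \<Phi> where "\<Phi> = (\<lambda>x. F x - F a)"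
    have \<Phi>': "(\<Phi> has_real_derivative \<theta> x) (at x)" for x
      unfolding \<Phi>_def using has_ac_derivative_imp_has_real_derivative[OF F \<theta>c]
      by (auto intro!: derivative_eq_intros)
    have \<Phi>0: "\<Phi> x = 0" if "x \<notin> {a..b}" for x
    proof (cases "x < a")
      case True
      have "F a - F x = (LBINT t:{x..a}. \<theta> t)" using True by (intro ac_diff_eq[OF F]) simp
      also have "\<dots> = (LBINT t:{x..a}. 0)"
        by (rule set_lebesgue_integral_cong) (use out in auto)
      finally show ?thesis by (simp add: \<Phi>_def)
    next
      case False
      then have "x > b" using that by auto
      then have "F x - F a = (LBINT t:{a..x}. \<theta> t)" using \<open>a \<le> b\<close> by (intro ac_diff_eq[OF F]) simp
      also have "\<dots> = (LINT t|lborel. \<theta> t)"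
        by (rule integral_eq_set_integral[symmetric]) (use out \<open>x > b\<close> in auto)
      finally show ?thesis using \<theta>0 by (simp add: \<Phi>_def)
    qed
    have "test_function \<Phi>"
      unfolding test_function_iff using smooth_antiderivative[OF \<Phi>' \<theta>s] \<Phi>0 by blast
    moreover have "deriv \<Phi> = \<theta>" using \<Phi>' by (intro ext DERIV_imp_deriv)
    ultimately have "(LINT x|lborel. W x * \<theta> x) = 0" using zero by metis
    moreover have i: "integrable lborel (\<lambda>x. W x * \<phi> x)" "integrable lborel (\<lambda>x. W x * \<eta> x)"
      by (rule test_function_integrable[OF _ W], fact)+
    then have "(LINT x|lborel. W x * \<theta> x) = (LINT x|lborel. W x * \<phi> x) - s * (LINT x|lborel. W x * \<eta> x)"
      unfolding \<theta>_def by (simp add: distrib_left right_diff_distrib mult.left_commute[of _ s])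
    ultimately have "(LINT x|lborel. W x * \<phi> x) = c * (LINT x|lborel. \<phi> x)"
      by (simp add: s_def c_def)
    then show "(LINT x|lborel. (W x - c) * \<phi> x) = 0"
      using i int[OF \<phi>] by (simp add: left_diff_distrib)
  qed
  then show ?thesis by auto
qed

text \<open>The difference of \<open>v\<close> and a primitive of \<open>g\<close> has weak derivative zero, hence is constant.\<close>

lemma weak_derivative_imp_ac:
  assumes "has_weak_derivative 1 v g"
  shows "\<exists>V. has_ac_derivative V g \<and> (AE x in lborel. v x = V x)"
proof -
  have v: "locally_integrable v" and g: "locally_integrable g"
    and t: "\<And>\<phi>. test_function \<phi> \<Longrightarrow> (LINT x|lborel. v x * deriv \<phi> x) = - (LINT x|lborel. g x * \<phi> x)"
    using assms by (auto simp: has_weak_derivative_def)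
  obtain G where G: "has_ac_derivative G g" using has_ac_derivative_primitive[OF g] by blast
  have Gli: "locally_integrable G"
    and tG: "\<And>\<phi>. test_function \<phi> \<Longrightarrow> (LINT x|lborel. G x * deriv \<phi> x) = - (LINT x|lborel. g x * \<phi> x)"
    using ac_imp_has_weak_derivative[OF G] by (auto simp: has_weak_derivative_def)
  have "\<exists>c. AE x in lborel. v x - G x = c"
  proof (rule weak_derivative_zero_imp_const)
    show "locally_integrable (\<lambda>x. v x - G x)" by (intro locally_integrable_diff v Gli)
    fix \<phi> assume \<phi>: "test_function \<phi>"
    note test_function_integrable[OF test_function_deriv[OF \<phi>]]
    from this[OF v] this[OF Gli] show "(LINT x|lborel. (v x - G x) * deriv \<phi> x) = 0"
      using t[OF \<phi>] tG[OF \<phi>] by (simp add: left_diff_distrib)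
  qed
  then obtain c where c: "AE x in lborel. v x - G x = c" by blast
  have "has_ac_derivative (\<lambda>x. G x + c) g" using G by (simp add: has_ac_derivative_def)
  moreover have "AE x in lborel. v x = G x + c" using c by eventually_elim simp
  ultimately show ?thesis by blast
qed

lemma locally_integrable_cong_AE:
  assumes "locally_integrable f" "AE x in lborel. f x = g x" "g \<in> borel_measurable borel"
  shows "locally_integrable g"
  unfolding locally_integrable_def
proof (intro allI)
  fix a b :: real
  show "set_integrable lborel {a..b} g"
    using locally_integrableD[OF assms(1), of a b] assms locally_integrable_measurable[OF assms(1)]
    by (subst set_integrable_cong_AE[of g lborel f]) auto
qed

lemma has_ac_derivative_cong_AE:
  assumes "has_ac_derivative F f" "AE x in lborel. f x = g x" "g \<in> borel_measurable borel"
  shows "has_ac_derivative F g"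
  unfolding has_ac_derivative_def
proof (intro conjI allI impI)
  note f = ac_locally_integrable[OF assms(1)]
  show "locally_integrable g" by (rule locally_integrable_cong_AE[OF f assms(2,3)])
  fix a b :: real assume "a \<le> b"
  have "(LBINT x:{a..b}. f x) = (LBINT x:{a..b}. g x)"
    using assms locally_integrable_measurable[OF f]
    unfolding set_lebesgue_integral_def by (intro integral_cong_AE) auto
  then show "F b - F a = (LBINT x:{a..b}. g x)" using ac_diff_eq[OF assms(1) \<open>a \<le> b\<close>] by simp
qed

lemma has_weak_derivative_cong_AE:
  assumes "has_weak_derivative k v g" "AE x in lborel. v x = v' x" "v' \<in> borel_measurable borel"
  shows "has_weak_derivative k v' g"
proof -
  have v: "locally_integrable v" using assms(1) by (simp add: has_weak_derivative_def)
  have v': "locally_integrable v'" by (rule locally_integrable_cong_AE[OF v assms(2,3)])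
  have [measurable]: "v \<in> borel_measurable borel" "v' \<in> borel_measurable borel"
    using v assms(3) locally_integrable_measurable by auto
  have "(LINT x|lborel. v' x * (deriv ^^ k) \<phi> x) = (LINT x|lborel. v x * (deriv ^^ k) \<phi> x)"
    if "test_function \<phi>" for \<phi>
  proof (rule integral_cong_AE)
    have "smooth ((deriv ^^ k) \<phi>)"
    proof (induction k)
      case 0
      then show ?case using that by (simp add: test_function_iff)
    qed (simp add: smooth_deriv)
    then have [measurable]: "(deriv ^^ k) \<phi> \<in> borel_measurable borel"
      by (intro borel_measurable_continuous_onI smooth_continuous_on)
    show "(\<lambda>x. v x * (deriv ^^ k) \<phi> x) \<in> borel_measurable lborel" by measurable
    show "(\<lambda>x. v' x * (deriv ^^ k) \<phi> x) \<in> borel_measurable lborel" by measurable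
    show "AE x in lborel. v' x * (deriv ^^ k) \<phi> x = v x * (deriv ^^ k) \<phi> x"
      using assms(2) by eventually_elim simp
  qed
  then show ?thesis using assms(1) v' by (simp add: has_weak_derivative_def)
qed

lemma weak_second_derivative:
  assumes "has_weak_derivative 1 v g" "has_weak_derivative 2 v h"
  shows "has_weak_derivative 1 g h"
  unfolding has_weak_derivative_def
proof (intro conjI allI impI)
  show "locally_integrable g" "locally_integrable h" using assms by (auto simp: has_weak_derivative_def)
  fix \<phi> assume \<phi>: "test_function \<phi>"
  have "(LINT x|lborel. v x * deriv (deriv \<phi>) x) = - (LINT x|lborel. g x * deriv \<phi> x)"
    using assms(1) test_function_deriv[OF \<phi>] by (auto simp: has_weak_derivative_def)
  moreover have "(LINT x|lborel. v x * deriv (deriv \<phi>) x) = (LINT x|lborel. h x * \<phi> x)"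
    using assms(2) \<phi> by (auto simp: has_weak_derivative_def numeral_2_eq_2)
  ultimately show "(LINT x|lborel. g x * (deriv ^^ 1) \<phi> x) = (-1) ^ 1 * (LINT x|lborel. h x * \<phi> x)"
    by simp
qed

lemma has_weak_derivative_weak_deriv:
  "has_weak_derivative k v g \<Longrightarrow> has_weak_derivative k v (weak_deriv k v)"
  unfolding weak_deriv_def by (rule someI[of "has_weak_derivative k v"])

lemma weighted_L2_cong_AE:
  assumes "v \<in> weighted_L2 \<rho>" "AE x in lborel. v x = v' x"
    and [measurable]: "v' \<in> borel_measurable borel" "\<rho> \<in> borel_measurable borel"
  shows "v' \<in> weighted_L2 \<rho>"
proof -
  have [measurable]: "v \<in> borel_measurable borel" using assms(1) by (simp add: weighted_L2_def)
  have "integrable lborel (\<lambda>x. (v x)\<^sup>2 * \<rho> x)" using assms(1) by (simp add: weighted_L2_def)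
  then have "integrable lborel (\<lambda>x. (v' x)\<^sup>2 * \<rho> x)"
    by (rule integrable_cong_AE_imp) (use assms(2) in \<open>auto elim: AE_mp\<close>)
  then show ?thesis by (simp add: weighted_L2_def)
qed

text \<open>Together with the second derivative, the arbitrarily chosen representatives in \<^const>\<open>weak_deriv\<close>
  are exchanged here for a continuously differentiable function and its classical derivative.\<close>

lemma weighted_H_2_C1_representative:
  assumes v: "v \<in> weighted_H 2 \<rho>" and \<rho>: "\<rho> \<in> borel_measurable borel"
  shows "\<exists>V V'. has_ac_derivative V V' \<and> has_ac_derivative V' (weak_deriv 2 v) \<and>
    (AE x in lborel. v x = V x) \<and> (AE x in lborel. weak_deriv 1 v x = V' x) \<and>
    V \<in> weighted_L2 \<rho> \<and> V' \<in> weighted_L2 \<rho> \<and> weak_deriv 2 v \<in> weighted_L2 \<rho>"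
proof -
  have v2: "v \<in> weighted_L2 \<rho>" and ex: "\<forall>i\<in>{1..2}. \<exists>g\<in>weighted_L2 \<rho>. has_weak_derivative i v g"
    using v by (simp_all add: weighted_H_def)
  obtain g1 g2 where g: "g1 \<in> weighted_L2 \<rho>" "has_weak_derivative 1 v g1"
      "g2 \<in> weighted_L2 \<rho>" "has_weak_derivative 2 v g2"
    using ex[rule_format, of 1] ex[rule_format, of 2] by auto
  note d1 = has_weak_derivative_weak_deriv[OF g(2)] and d2 = has_weak_derivative_weak_deriv[OF g(4)]
  have meas: "weak_deriv 1 v \<in> borel_measurable borel" "weak_deriv 2 v \<in> borel_measurable borel"
    using d1 d2 by (auto simp: has_weak_derivative_def intro: locally_integrable_measurable)
  obtain V where V: "has_ac_derivative V (weak_deriv 1 v)" "AE x in lborel. v x = V x"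
    using weak_derivative_imp_ac[OF d1] by blast
  obtain V' where V': "has_ac_derivative V' (weak_deriv 2 v)" "AE x in lborel. weak_deriv 1 v x = V' x"
    using weak_derivative_imp_ac[OF weak_second_derivative[OF d1 d2]] by blast
  have mV: "V \<in> borel_measurable borel" "V' \<in> borel_measurable borel"
    using V V' by (auto intro!: borel_measurable_continuous_onI elim!: ac_continuous_on)
  have "has_ac_derivative V V'" by (rule has_ac_derivative_cong_AE[OF V(1) V'(2) mV(2)])
  moreover have "V \<in> weighted_L2 \<rho>"
    by (rule weighted_L2_cong_AE[OF v2 V(2) mV(1) \<rho>])
  moreover have "weak_deriv 1 v \<in> weighted_L2 \<rho>"
    by (rule weighted_L2_cong_AE[OF g(1) has_weak_derivative_unique[OF g(2) d1] meas(1) \<rho>])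
  then have "V' \<in> weighted_L2 \<rho>"
    by (rule weighted_L2_cong_AE[OF _ V'(2) mV(2) \<rho>])
  moreover have "weak_deriv 2 v \<in> weighted_L2 \<rho>"
    by (rule weighted_L2_cong_AE[OF g(3) has_weak_derivative_unique[OF g(4) d2] meas(2) \<rho>])
  ultimately show ?thesis using V V' by blast
qed

text \<open>Nonempty open sets have positive measure.\<close>

lemma AE_eq_continuous_imp_eq:
  fixes f g :: "real \<Rightarrow> real"
  assumes "AE x in lborel. f x = g x" "continuous_on UNIV f" "continuous_on UNIV g"
  shows "f = g"
proof (rule ext, rule ccontr)
  fix x assume "f x \<noteq> g x"
  have "open {y. f y \<noteq> g y}" using open_Collect_neq[OF assms(2,3)] .
  then obtain e where e: "e > 0" "ball x e \<subseteq> {y. f y \<noteq> g y}"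
    using \<open>f x \<noteq> g x\<close> by (auto elim: openE)
  then have sub: "{x<..<x+e} \<subseteq> {y. f y \<noteq> g y}" by (force simp: subset_eq dist_real_def)
  from assms(1) have "AE y in lborel. y \<notin> {x<..<x+e}"
    by eventually_elim (use sub in blast)
  then have "emeasure lborel {x<..<x+e} = 0"
    by (subst (asm) AE_iff_measurable[of "{x<..<x+e}"]) auto
  then show False using e(1) by simp
qed

section \<open>Positive solutions of second-order inequalities\<close>

text \<open>The differential operator factors as \<open>(\<partial> - \<alpha>)(\<partial> - \<beta>)\<close>, and \<open>exp(-\<alpha> x)\<close> is the integrating factor of
  the first-order inequality for \<open>(\<partial> - \<beta>) u\<close>.\<close>

lemma positive_supersolution_factor:
  fixes \<alpha> \<beta> :: real
  assumes u: "has_ac_derivative u u'" and u': "has_ac_derivative u' u''"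
    and ineq: "AE x in lborel. u'' x - (\<alpha> + \<beta>) * u' x + \<alpha> * \<beta> * u x \<le> 0" and "a \<le> b"
  shows "exp (- \<alpha> * b) * (u' b - \<beta> * u b) \<le> exp (- \<alpha> * a) * (u' a - \<beta> * u a)"
proof (rule ac_decreasing[OF _ _ \<open>a \<le> b\<close>])
  have "has_ac_derivative (\<lambda>x. exp (- \<alpha> * x)) (\<lambda>x. - \<alpha> * exp (- \<alpha> * x))"
    by (rule has_ac_derivative_C1) (auto intro!: derivative_eq_intros continuous_intros)
  then show "has_ac_derivative (\<lambda>x. exp (- \<alpha> * x) * (u' x - \<beta> * u x))
      (\<lambda>x. (- \<alpha> * exp (- \<alpha> * x)) * (u' x - \<beta> * u x) + exp (- \<alpha> * x) * (u'' x - \<beta> * u' x))"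
    by (intro has_ac_derivative_mult has_ac_derivative_diff has_ac_derivative_cmult u u')
  from ineq show "AE x in lborel.
     (- \<alpha> * exp (- \<alpha> * x)) * (u' x - \<beta> * u x) + exp (- \<alpha> * x) * (u'' x - \<beta> * u' x) \<le> 0"
  proof eventually_elim
    fix x assume "u'' x - (\<alpha> + \<beta>) * u' x + \<alpha> * \<beta> * u x \<le> 0"
    then have "exp (- \<alpha> * x) * (u'' x - (\<alpha> + \<beta>) * u' x + \<alpha> * \<beta> * u x) \<le> 0"
      by (simp add: mult_le_0_iff)
    then show "(- \<alpha> * exp (- \<alpha> * x)) * (u' x - \<beta> * u x) + exp (- \<alpha> * x) * (u'' x - \<beta> * u' x) \<le> 0"
      by (simp add: algebra_simps)
  qed
qed

text \<open>If \<open>u' < \<beta> u\<close> at some point, then the monotone quantity of \<open>positive_supersolution_factor\<close> keeps the slope of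
  \<open>exp(-\<beta> x) u\<close> below a negative constant to the right of that point, which forces \<open>u\<close> to become negative.
  If \<open>u' > \<alpha> u\<close>, the same happens to the left, with the roles of \<open>\<alpha>\<close> and \<open>\<beta>\<close> exchanged.\<close>

lemma positive_supersolution_derivative_bounds:
  fixes \<alpha> \<beta> :: real
  assumes u: "has_ac_derivative u u'" and u': "has_ac_derivative u' u''" and pos: "\<And>x. u x > 0"
    and ineq: "AE x in lborel. u'' x - (\<alpha> + \<beta>) * u' x + \<alpha> * \<beta> * u x \<le> 0" and "\<beta> \<le> \<alpha>"
  shows "\<beta> * u x \<le> u' x" "u' x \<le> \<alpha> * u x"
proof -
  have du: "(u has_real_derivative u' t) (at t)" for t
    using u u' by (intro has_ac_derivative_imp_has_real_derivative ac_continuous_on)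
  have shift: "exp ((a - b) * t) * (exp (- a * t) * z) = exp (- b * t) * z" for a b t z :: real
  proof -
    have "exp ((a - b) * t) * exp (- a * t) = exp (- b * t)"
      unfolding exp_add[symmetric] by (simp add: algebra_simps)
    then show ?thesis by (simp add: mult.assoc[symmetric])
  qed
  have dg: "((\<lambda>t. exp (- \<gamma> * t) * u t) has_real_derivative exp (- \<gamma> * t) * (u' t - \<gamma> * u t)) (at t)" for \<gamma> t
    by (auto intro!: derivative_eq_intros du simp: algebra_simps)
  show "\<beta> * u x \<le> u' x"
  proof (rule ccontr)
    assume "\<not> \<beta> * u x \<le> u' x"
    define \<eta> where "\<eta> = exp (- \<beta> * x) * (\<beta> * u x - u' x)"
    have "\<eta> > 0" using \<open>\<not> _\<close> by (simp add: \<eta>_def)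
    have slope: "exp (- \<beta> * t) * (u' t - \<beta> * u t) \<le> - \<eta>" if "x \<le> t" for t
    proof -
      have "exp (- \<alpha> * t) * (u' t - \<beta> * u t) \<le> exp (- \<alpha> * x) * (u' x - \<beta> * u x)"
        by (rule positive_supersolution_factor[OF u u' ineq that])
      then have "exp ((\<alpha> - \<beta>) * t) * (exp (- \<alpha> * t) * (u' t - \<beta> * u t))
          \<le> exp ((\<alpha> - \<beta>) * t) * (exp (- \<alpha> * x) * (u' x - \<beta> * u x))"
        by (rule mult_left_mono) simp
      also have "\<dots> \<le> exp ((\<alpha> - \<beta>) * x) * (exp (- \<alpha> * x) * (u' x - \<beta> * u x))"
      proof (rule mult_right_mono_neg)
        show "exp ((\<alpha> - \<beta>) * x) \<le> exp ((\<alpha> - \<beta>) * t)"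
          using that \<open>\<beta> \<le> \<alpha>\<close> by (simp add: mult_left_mono)
        show "exp (- \<alpha> * x) * (u' x - \<beta> * u x) \<le> 0"
          using \<open>\<not> _\<close> by (simp add: mult_le_0_iff)
      qed
      finally show ?thesis unfolding shift \<eta>_def by (simp add: right_diff_distrib)
    qed
    define g where "g = (\<lambda>t. exp (- \<beta> * t) * u t)"
    have "g t \<le> g x - \<eta> * (t - x)" if "x \<le> t" for t
    proof -
      have "g t + \<eta> * t \<le> g x + \<eta> * x"
      proof (rule DERIV_nonpos_imp_nonincreasing[OF that])
        fix s assume "x \<le> s" "s \<le> t"
        have "((\<lambda>t. g t + \<eta> * t) has_real_derivative exp (- \<beta> * s) * (u' s - \<beta> * u s) + \<eta>) (at s)"
          unfolding g_def by (rule DERIV_add[OF dg]) (auto intro!: derivative_eq_intros)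
        then show "\<exists>y. ((\<lambda>t. g t + \<eta> * t) has_real_derivative y) (at s) \<and> y \<le> 0"
          using slope[OF \<open>x \<le> s\<close>] by force
      qed
      then show ?thesis by (simp add: algebra_simps)
    qed
    from this[of "x + g x / \<eta>"] have "g (x + g x / \<eta>) \<le> 0"
      using \<open>\<eta> > 0\<close> pos[of x] by (auto simp: g_def)
    then show False using pos by (simp add: g_def mult_le_0_iff not_le[symmetric])
  qed
  show "u' x \<le> \<alpha> * u x"
  proof (rule ccontr)
    assume "\<not> u' x \<le> \<alpha> * u x"
    define \<eta> where "\<eta> = exp (- \<alpha> * x) * (u' x - \<alpha> * u x)"
    have "\<eta> > 0" using \<open>\<not> _\<close> by (simp add: \<eta>_def)
    have slope: "exp (- \<alpha> * t) * (u' t - \<alpha> * u t) \<ge> \<eta>" if "t \<le> x" for t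
    proof -
      have ineq': "AE x in lborel. u'' x - (\<beta> + \<alpha>) * u' x + \<beta> * \<alpha> * u x \<le> 0"
        using ineq by (simp add: add.commute mult.commute)
      have "exp (- \<beta> * x) * (u' x - \<alpha> * u x) \<le> exp (- \<beta> * t) * (u' t - \<alpha> * u t)"
        by (rule positive_supersolution_factor[OF u u' ineq' that])
      then have le: "exp ((\<beta> - \<alpha>) * t) * (exp (- \<beta> * x) * (u' x - \<alpha> * u x))
          \<le> exp ((\<beta> - \<alpha>) * t) * (exp (- \<beta> * t) * (u' t - \<alpha> * u t))"
        by (rule mult_left_mono) simp
      have "exp ((\<beta> - \<alpha>) * x) * (exp (- \<beta> * x) * (u' x - \<alpha> * u x))
          \<le> exp ((\<beta> - \<alpha>) * t) * (exp (- \<beta> * x) * (u' x - \<alpha> * u x))"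
      proof (rule mult_right_mono)
        show "exp ((\<beta> - \<alpha>) * x) \<le> exp ((\<beta> - \<alpha>) * t)"
          using that \<open>\<beta> \<le> \<alpha>\<close> by (simp add: mult_left_mono_neg)
        show "0 \<le> exp (- \<beta> * x) * (u' x - \<alpha> * u x)"
          using \<open>\<not> _\<close> by simp
      qed
      from order_trans[OF this le]
      show ?thesis unfolding shift \<eta>_def .
    qed
    define g where "g = (\<lambda>t. exp (- \<alpha> * t) * u t)"
    have "g t \<le> g x - \<eta> * (x - t)" if "t \<le> x" for t
    proof -
      have "g t - \<eta> * t \<le> g x - \<eta> * x"
      proof (rule DERIV_nonneg_imp_nondecreasing[OF that])
        fix s assume "t \<le> s" "s \<le> x"
        have "((\<lambda>t. g t - \<eta> * t) has_real_derivative exp (- \<alpha> * s) * (u' s - \<alpha> * u s) - \<eta>) (at s)"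
          unfolding g_def by (rule DERIV_diff[OF dg]) (auto intro!: derivative_eq_intros)
        then show "\<exists>y. ((\<lambda>t. g t - \<eta> * t) has_real_derivative y) (at s) \<and> 0 \<le> y"
          using slope[OF \<open>s \<le> x\<close>] by force
      qed
      then show ?thesis by (simp add: algebra_simps)
    qed
    from this[of "x - g x / \<eta>"] have "g (x - g x / \<eta>) \<le> 0"
      using \<open>\<eta> > 0\<close> pos[of x] by (auto simp: g_def)
    then show False using pos by (simp add: g_def mult_le_0_iff not_le[symmetric])
  qed
qed

text \<open>This is what tames the boundary terms at infinity. The bound \<open>C\<close> comes from the roots of the
  characteristic polynomial \<open>d s\<^sup>2 + c s - K\<close>, which are real because \<open>d\<close> and \<open>K\<close> are positive.\<close>

lemma positive_supersolution_log_derivative_bounded: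
  fixes c d K :: real
  assumes u: "has_ac_derivative u u'" and u': "has_ac_derivative u' u''" and pos: "\<And>x. u x > 0"
    and "d > 0" "K > 0" and ineq: "AE x in lborel. c * u' x + d * u'' x \<le> K * u x"
  shows "\<exists>C\<ge>0. \<forall>x. \<bar>u' x\<bar> \<le> C * u x"
proof -
  \<comment> \<open>The root of the discriminant of \<open>d s\<^sup>2 + c s - K\<close>.\<close>
  define s where "s = sqrt (c\<^sup>2 + 4 * d * K)"
  have s2: "s\<^sup>2 = c\<^sup>2 + 4 * d * K" and "s \<ge> 0"
    using \<open>d > 0\<close> \<open>K > 0\<close> by (simp_all add: s_def)
  define \<alpha> \<beta> where "\<alpha> = (- c + s) / (2 * d)" and "\<beta> = (- c - s) / (2 * d)"
  have sum: "\<alpha> + \<beta> = - c / d"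
    using \<open>d > 0\<close> by (simp add: \<alpha>_def \<beta>_def add_divide_distrib[symmetric])
  have prod: "\<alpha> * \<beta> = - K / d"
  proof -
    have "\<alpha> * \<beta> = (c\<^sup>2 - s\<^sup>2) / (4 * d\<^sup>2)"
      by (simp add: \<alpha>_def \<beta>_def power2_eq_square algebra_simps)
    also have "\<dots> = - K / d"
      unfolding s2 using \<open>d > 0\<close> by (simp add: power2_eq_square)
    finally show ?thesis .
  qed
  have "\<beta> \<le> \<alpha>" using \<open>s \<ge> 0\<close> \<open>d > 0\<close> by (simp add: \<alpha>_def \<beta>_def divide_right_mono)
  have "AE x in lborel. u'' x - (\<alpha> + \<beta>) * u' x + \<alpha> * \<beta> * u x \<le> 0"
    using ineq
  proof eventually_elim
    fix x assume "c * u' x + d * u'' x \<le> K * u x"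
    then have "(c * u' x + d * u'' x - K * u x) / d \<le> 0" using \<open>d > 0\<close> by (simp add: divide_le_0_iff)
    then show "u'' x - (\<alpha> + \<beta>) * u' x + \<alpha> * \<beta> * u x \<le> 0"
      unfolding sum prod using \<open>d > 0\<close> by (simp add: add_divide_distrib diff_divide_distrib)
  qed
  note bounds = positive_supersolution_derivative_bounds[OF u u' pos this \<open>\<beta> \<le> \<alpha>\<close>]
  have "\<bar>u' x\<bar> \<le> (\<bar>\<alpha>\<bar> + \<bar>\<beta>\<bar>) * u x" for x
  proof -
    have "\<alpha> * u x \<le> (\<bar>\<alpha>\<bar> + \<bar>\<beta>\<bar>) * u x" "- \<beta> * u x \<le> (\<bar>\<alpha>\<bar> + \<bar>\<beta>\<bar>) * u x"
      using pos[of x] by (intro mult_right_mono; linarith)+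
    then show ?thesis using bounds[of x] by (simp add: abs_le_iff)
  qed
  then show ?thesis by (intro exI[of _ "\<bar>\<alpha>\<bar> + \<bar>\<beta>\<bar>"]) auto
qed

section \<open>The local part of the energy identity\<close>

lemma integrable_small_on_long_intervals:
  fixes F :: "real \<Rightarrow> real"
  assumes F: "integrable lborel F" and "\<epsilon> > 0"
    and S: "\<And>L. L \<ge> 0 \<Longrightarrow> \<exists>a. {a..a + L} \<subseteq> S"
  shows "\<exists>x\<in>S. \<bar>F x\<bar> < \<epsilon>"
proof (rule ccontr)
  assume "\<not> ?thesis"
  then have big: "\<epsilon> \<le> \<bar>F x\<bar>" if "x \<in> S" for x using that by force
  define I where "I = (LINT x|lborel. \<bar>F x\<bar>)"
  have "I \<ge> 0" by (simp add: I_def)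
  define L where "L = (I + 1) / \<epsilon>"
  have "L \<ge> 0" using \<open>\<epsilon> > 0\<close> \<open>I \<ge> 0\<close> by (simp add: L_def)
  obtain a where a: "{a..a + L} \<subseteq> S" using S[OF \<open>L \<ge> 0\<close>] by blast
  have "(LINT x|lborel. \<epsilon> * indicator {a..a+L} x) \<le> I"
    unfolding I_def
  proof (rule integral_mono)
    show "integrable lborel (\<lambda>x. \<epsilon> * indicator {a..a + L} x)"
      by (intro integrable_mult_right integrable_real_indicator) (auto simp: emeasure_lborel_Icc_eq)
    show "integrable lborel (\<lambda>x. \<bar>F x\<bar>)" using F by simp
  qed (use big a in \<open>auto simp: indicator_def subset_eq\<close>)
  then have "\<epsilon> * L \<le> I" using \<open>L \<ge> 0\<close> by simp
  then show False using \<open>\<epsilon> > 0\<close> by (simp add: L_def)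
qed

text \<open>An integrable flux \<open>F\<close> must be small at points arbitrarily far out on either side. Exhausting the line by
  intervals between such points removes the boundary terms.\<close>

lemma integral_nonpos_of_flux:
  fixes F G :: "real \<Rightarrow> real"
  assumes G: "integrable lborel G" and F: "integrable lborel F"
    and le: "\<And>a b. a \<le> b \<Longrightarrow> (LBINT x:{a..b}. G x) \<le> F b - F a"
  shows "(LINT x|lborel. G x) \<le> 0"
proof -
  have "\<exists>x\<in>{real n..}. \<bar>F x\<bar> < 1 / real (Suc n)" for n
    by (rule integrable_small_on_long_intervals[OF F]) (auto intro!: exI[of _ "real n"])
  then obtain b where b: "\<And>n. b n \<ge> real n" "\<And>n. \<bar>F (b n)\<bar> < 1 / real (Suc n)"
    by (metis atLeast_iff)
  have "\<exists>x\<in>{..- real n}. \<bar>F x\<bar> < 1 / real (Suc n)" for n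
    by (rule integrable_small_on_long_intervals[OF F]) (auto, metis diff_add_cancel order_refl)
  then obtain a where a: "\<And>n. a n \<le> - real n" "\<And>n. \<bar>F (a n)\<bar> < 1 / real (Suc n)"
    by (metis atMost_iff)
  have ab: "a n \<le> b n" for n using a(1)[of n] b(1)[of n] by linarith
  have [measurable]: "G \<in> borel_measurable borel" using G by (auto dest: borel_measurable_integrable)
  have "(\<lambda>n. LINT x|lborel. indicator {a n..b n} x * G x) \<longlonglongrightarrow> (LINT x|lborel. G x)"
  proof (rule integral_dominated_convergence)
    show "integrable lborel (\<lambda>x. \<bar>G x\<bar>)" using G by simp
    show "AE x in lborel. (\<lambda>n. indicator {a n..b n} x * G x) \<longlonglongrightarrow> G x"
    proof (rule AE_I2)
      fix x :: real
      obtain N where N: "real N \<ge> \<bar>x\<bar>" using real_arch_simple by blast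
      show "(\<lambda>n. indicator {a n..b n} x * G x) \<longlonglongrightarrow> G x"
      proof (rule tendsto_eventually)
        show "\<forall>\<^sub>F n in sequentially. indicator {a n..b n} x * G x = G x"
          using eventually_ge_at_top[of N]
        proof eventually_elim
          case (elim n)
          then have "real N \<le> real n" by simp
          then have "x \<in> {a n..b n}" using N a(1)[of n] b(1)[of n] by (simp add: abs_le_iff)
          then show ?case by simp
        qed
      qed
    qed
    show "AE x in lborel. norm (indicator {a n..b n} x * G x) \<le> \<bar>G x\<bar>" for n
      by (auto simp: indicator_def)
  qed measurable
  moreover have "(\<lambda>n. 2 / real (Suc n)) \<longlonglongrightarrow> 0"
    using LIMSEQ_Suc[OF lim_const_over_n[of "2::real"]] by simp
  moreover have "(LINT x|lborel. indicator {a n..b n} x * G x) \<le> 2 / real (Suc n)" for n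
    using le[OF ab[of n]] a(2)[of n] b(2)[of n] by (simp add: set_lebesgue_integral_def)
  ultimately show ?thesis by (intro LIMSEQ_le) auto
qed

lemma weighted_L2_mult_integrable:
  assumes a: "a \<in> weighted_L2 \<rho>" and b: "b \<in> weighted_L2 \<rho>" and \<rho>: "\<And>x. \<rho> x \<ge> 0"
    and [measurable]: "\<rho> \<in> borel_measurable borel"
  shows "integrable lborel (\<lambda>x. a x * b x * \<rho> x)"
proof (rule Bochner_Integration.integrable_bound)
  have [measurable]: "a \<in> borel_measurable borel" "b \<in> borel_measurable borel"
    using a b by (auto simp: weighted_L2_def)
  show "integrable lborel (\<lambda>x. (a x)\<^sup>2 * \<rho> x + (b x)\<^sup>2 * \<rho> x)"
    using a b by (auto simp: weighted_L2_def)
  show "(\<lambda>x. a x * b x * \<rho> x) \<in> borel_measurable lborel" by measurable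
  show "AE x in lborel. norm (a x * b x * \<rho> x) \<le> norm ((a x)\<^sup>2 * \<rho> x + (b x)\<^sup>2 * \<rho> x)"
  proof (rule AE_I2)
    fix x
    have "2 * \<bar>a x * b x\<bar> \<le> (a x)\<^sup>2 + (b x)\<^sup>2"
      using sum_squares_bound[of "\<bar>a x\<bar>" "\<bar>b x\<bar>"] by (simp add: abs_mult)
    then have "\<bar>a x * b x\<bar> \<le> (a x)\<^sup>2 + (b x)\<^sup>2"
      using abs_ge_zero[of "a x * b x"] by linarith
    then have "\<bar>a x * b x\<bar> * \<rho> x \<le> ((a x)\<^sup>2 + (b x)\<^sup>2) * \<rho> x" by (rule mult_right_mono) (rule \<rho>)
    then show "norm (a x * b x * \<rho> x) \<le> norm ((a x)\<^sup>2 * \<rho> x + (b x)\<^sup>2 * \<rho> x)"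
      using \<rho>[of x] by (simp add: abs_mult distrib_right)
  qed
qed

text \<open>The identity \<open>G + 2 d u \<psi> h'\<^sup>2 = F'\<close>, integrated over an interval. It combines
  \<open>2 h A(u h) = A(u h\<^sup>2) + h\<^sup>2 A u - 2 d u h'\<^sup>2\<close> with Lagrange's identity
  \<open>\<psi> A z - z A\<^sup>* \<psi> = (c z \<psi> + d (z' \<psi> - z \<psi>'))'\<close> for \<open>z = u h\<^sup>2\<close>; the flux \<open>F\<close> is the bracket written out in
  terms of \<open>h\<close>. The zeroth and first order terms cancel because of the two null equations.\<close>

lemma local_energy_flux:
  fixes c d :: real and f :: "real \<Rightarrow> real"
  assumes "d \<ge> 0"
    and u: "has_ac_derivative u u'" "has_ac_derivative u' u''" "\<And>x. u x > 0"
    and \<psi>: "has_ac_derivative \<psi> \<psi>'" "has_ac_derivative \<psi>' \<psi>''" "\<And>x. \<psi> x > 0"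
    and h: "has_ac_derivative h h'" "has_ac_derivative h' h''"
    and Lu: "AE x in lborel. - f x * u x + c * u' x + d * u'' x + pu x = 0"
    and L\<psi>: "AE x in lborel. - f x * \<psi> x - c * \<psi>' x + d * \<psi>'' x + p\<psi> x = 0"
  defines "F \<equiv> \<lambda>x. c * (u x * \<psi> x * (h x * h x))
      + d * (\<psi> x * u' x * (h x * h x) + 2 * (u x * \<psi> x * (h x * h' x)) - u x * \<psi>' x * (h x * h x))"
    and "G \<equiv> \<lambda>x. 2 * h x * \<psi> x * (- f x * (u x * h x) + c * (u' x * h x + u x * h' x)
          + d * (u'' x * h x + 2 * u' x * h' x + u x * h'' x))
        + (h x)\<^sup>2 * (\<psi> x * pu x + u x * p\<psi> x)"
  assumes "a \<le> b" and G: "set_integrable lborel {a..b} G"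
  shows "(LBINT x:{a..b}. G x) \<le> F b - F a"
proof -
  define F' where "F' = (\<lambda>x. c * ((u' x * \<psi> x + u x * \<psi>' x) * (h x * h x) + u x * \<psi> x * (h' x * h x + h x * h' x))
      + d * (((\<psi>' x * u' x + \<psi> x * u'' x) * (h x * h x) + \<psi> x * u' x * (h' x * h x + h x * h' x)
          + 2 * ((u' x * \<psi> x + u x * \<psi>' x) * (h x * h' x) + u x * \<psi> x * (h' x * h' x + h x * h'' x)))
          - ((u' x * \<psi>' x + u x * \<psi>'' x) * (h x * h x) + u x * \<psi>' x * (h' x * h x + h x * h' x))))"
  have F': "has_ac_derivative F F'"
    unfolding F_def F'_def
    by (intro has_ac_derivative_mult has_ac_derivative_diff has_ac_derivative_add has_ac_derivative_cmult u \<psi> h)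
  have "AE x in lborel. G x \<le> F' x"
    using Lu L\<psi>
  proof eventually_elim
    fix x assume 1: "- f x * u x + c * u' x + d * u'' x + pu x = 0"
      and 2: "- f x * \<psi> x - c * \<psi>' x + d * \<psi>'' x + p\<psi> x = 0"
    have pu: "pu x = f x * u x - c * u' x - d * u'' x" using 1 by simp
    have p\<psi>: "p\<psi> x = f x * \<psi> x + c * \<psi>' x - d * \<psi>'' x" using 2 by simp
    have "F' x - G x = 2 * d * (u x * \<psi> x * (h' x)\<^sup>2)"
      unfolding F'_def G_def pu p\<psi> by (simp add: algebra_simps power2_eq_square)
    also have "\<dots> \<ge> 0" using \<open>d \<ge> 0\<close> u(3)[of x] \<psi>(3)[of x] by simp
    finally show "G x \<le> F' x" by simp
  qed
  then have "(LBINT x:{a..b}. G x) \<le> (LBINT x:{a..b}. F' x)"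
    by (intro set_integral_mono_AE G locally_integrableD ac_locally_integrable[OF F']) auto
  then show ?thesis using ac_diff_eq[OF F' \<open>a \<le> b\<close>] by simp
qed

text \<open>In terms of \<open>v\<close> the flux is
  \<open>\<rho> (c v\<^sup>2 + 2 d v v') - d \<rho> v\<^sup>2 (u'/u + \<psi>'/\<psi>)\<close>. It is integrable because \<open>v\<close> and \<open>v'\<close> are square integrable
  with respect to \<open>\<rho>\<close> and the logarithmic derivatives are bounded, so
  \<open>integral_nonpos_of_flux\<close> applies to \<open>local_energy_flux\<close> with \<open>h = v / u\<close>.\<close>

lemma local_energy_inequality:
  fixes c d B :: real and f :: "real \<Rightarrow> real"
  assumes "d \<ge> 0" and f: "\<And>x. \<bar>f x\<bar> \<le> B" "continuous_on UNIV f"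
    and u: "has_ac_derivative u u'" "has_ac_derivative u' u''" "\<And>x. u x > 0"
    and \<psi>: "has_ac_derivative \<psi> \<psi>'" "has_ac_derivative \<psi>' \<psi>''" "\<And>x. \<psi> x > 0"
    and v: "has_ac_derivative v v'" "has_ac_derivative v' v''"
    and Lu: "AE x in lborel. - f x * u x + c * u' x + d * u'' x + pu x = 0" "\<And>x. pu x \<ge> 0"
    and L\<psi>: "AE x in lborel. - f x * \<psi> x - c * \<psi>' x + d * \<psi>'' x + p\<psi> x = 0" "\<And>x. p\<psi> x \<ge> 0"
    and L2: "v \<in> weighted_L2 (rho u \<psi>)" "v' \<in> weighted_L2 (rho u \<psi>)" "v'' \<in> weighted_L2 (rho u \<psi>)"
    and int: "integrable lborel (\<lambda>x. (v x / u x)\<^sup>2 * (\<psi> x * pu x))"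
       "integrable lborel (\<lambda>x. (v x / u x)\<^sup>2 * (u x * p\<psi> x))"
  shows "integrable lborel (\<lambda>x. (- f x * v x + c * v' x + d * v'' x) * v x * rho u \<psi> x)" (is ?th1)
    and "2 * (LINT x|lborel. (- f x * v x + c * v' x + d * v'' x) * v x * rho u \<psi> x)
      \<le> - (LINT x|lborel. (v x / u x)\<^sup>2 * (\<psi> x * pu x)) - (LINT x|lborel. (v x / u x)\<^sup>2 * (u x * p\<psi> x))"
proof -
  define \<rho> where "\<rho> = rho u \<psi>"
  have B: "B \<ge> 0" using f(1)[of 0] by linarith
  have cont: "continuous_on UNIV u" "continuous_on UNIV u'" "continuous_on UNIV \<psi>" "continuous_on UNIV \<psi>'"
     "continuous_on UNIV v" "continuous_on UNIV v'"
    by (rule ac_continuous_on, fact)+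
  note [measurable] = cont[THEN borel_measurable_continuous_onI] f(2)[THEN borel_measurable_continuous_onI]
  have u0: "u x \<noteq> 0" for x using u(3)[of x] by simp
  have \<rho>pos: "\<rho> x > 0" for x using u(3)[of x] \<psi>(3)[of x] by (simp add: \<rho>_def rho_def)
  have [measurable]: "\<rho> \<in> borel_measurable borel" unfolding \<rho>_def rho_def by measurable
  have [measurable]: "v'' \<in> borel_measurable borel" using L2 by (simp add: weighted_L2_def)
  note L2mult = weighted_L2_mult_integrable[of _ \<rho>, OF _ _ less_imp_le[OF \<rho>pos] \<open>\<rho> \<in> borel_measurable borel\<close>]
  note L2' = L2[folded \<rho>_def]
  have vv: "integrable lborel (\<lambda>x. v x * v x * \<rho> x)" and v'v: "integrable lborel (\<lambda>x. v' x * v x * \<rho> x)"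
    and v''v: "integrable lborel (\<lambda>x. v'' x * v x * \<rho> x)"
    using L2mult L2' by auto
  have fvv: "integrable lborel (\<lambda>x. f x * (v x * v x * \<rho> x))"
  proof (rule Bochner_Integration.integrable_bound)
    show "integrable lborel (\<lambda>x. B * (v x * v x * \<rho> x))" using vv by simp
    show "AE x in lborel. norm (f x * (v x * v x * \<rho> x)) \<le> norm (B * (v x * v x * \<rho> x))"
      using f(1) B by (auto simp: abs_mult intro!: mult_right_mono)
  qed measurable
  have "integrable lborel (\<lambda>x. - (f x * (v x * v x * \<rho> x)) + c * (v' x * v x * \<rho> x) + d * (v'' x * v x * \<rho> x))"
    using fvv v'v v''v by auto
  then have Av: "integrable lborel (\<lambda>x. (- f x * v x + c * v' x + d * v'' x) * v x * \<rho> x)"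
    by (simp add: algebra_simps)
  then show ?th1 by (simp add: \<rho>_def)
  define h h' h'' where "h = (\<lambda>x. v x / u x)" and "h' = (\<lambda>x. v' x / u x - v x * u' x / (u x)\<^sup>2)"
    and "h'' = (\<lambda>x. (v'' x / u x - v' x * u' x / (u x)\<^sup>2)
       - ((v' x * u' x + v x * u'' x) / (u x * u x)
          - v x * u' x * (u' x * u x + u x * u' x) / (u x * u x)\<^sup>2))"
  have h: "has_ac_derivative h h'"
    unfolding h_def h'_def by (intro has_ac_derivative_divide v u u0)
  have "has_ac_derivative (\<lambda>x. v' x / u x - v x * u' x / (u x * u x)) h''"
    unfolding h''_def using u0
    by (intro has_ac_derivative_divide has_ac_derivative_diff has_ac_derivative_mult v u) auto
  then have h': "has_ac_derivative h' h''" by (simp add: h'_def power2_eq_square)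
  have veq: "v x = u x * h x" and v'eq: "v' x = u' x * h x + u x * h' x" for x
    using u0[of x] by (simp_all add: h_def h'_def field_simps power2_eq_square)
  have v''eq: "v'' x = u'' x * h x + 2 * u' x * h' x + u x * h'' x" for x
    using u0[of x] unfolding h_def h'_def h''_def
    by (simp add: divide_simps power2_eq_square) (simp add: algebra_simps)
  have \<psi>eq: "\<psi> x = u x * \<rho> x" for x using u0[of x] by (simp add: \<rho>_def rho_def)
  define F where "F = (\<lambda>x. c * (u x * \<psi> x * (h x * h x))
      + d * (\<psi> x * u' x * (h x * h x) + 2 * (u x * \<psi> x * (h x * h' x)) - u x * \<psi>' x * (h x * h x)))"
  define G where "G = (\<lambda>x. 2 * h x * \<psi> x * (- f x * (u x * h x) + c * (u' x * h x + u x * h' x)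
          + d * (u'' x * h x + 2 * u' x * h' x + u x * h'' x))
        + (h x)\<^sup>2 * (\<psi> x * pu x + u x * p\<psi> x))"
  have Geq: "G = (\<lambda>x. 2 * ((- f x * v x + c * v' x + d * v'' x) * v x * \<rho> x)
      + ((v x / u x)\<^sup>2 * (\<psi> x * pu x) + (v x / u x)\<^sup>2 * (u x * p\<psi> x)))"
  proof
    fix x
    have "G x = 2 * ((- f x * v x + c * v' x + d * v'' x) * (u x * h x) * \<rho> x)
      + ((h x)\<^sup>2 * (\<psi> x * pu x) + (h x)\<^sup>2 * (u x * p\<psi> x))"
      unfolding G_def v'eq v''eq unfolding veq \<psi>eq by (simp add: algebra_simps)
    then show "G x = 2 * ((- f x * v x + c * v' x + d * v'' x) * v x * \<rho> x)
      + ((v x / u x)\<^sup>2 * (\<psi> x * pu x) + (v x / u x)\<^sup>2 * (u x * p\<psi> x))"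
      by (simp add: h_def u0)
  qed
  have Gint: "integrable lborel G"
    unfolding Geq using Av int by auto
  have K: "B + 1 > 0" using B by simp
  \<comment> \<open>For \<open>d = 0\<close> the derivatives of \<open>u\<close> and \<open>\<psi>\<close> drop out of the flux, so that any \<open>C\<close> will do.\<close>
  have "\<exists>C\<ge>0. \<forall>x. d * \<bar>u' x\<bar> \<le> C * u x"
  proof (cases "d = 0")
    case False
    then have "d > 0" using \<open>d \<ge> 0\<close> by simp
    have "AE x in lborel. c * u' x + d * u'' x \<le> (B + 1) * u x"
      using Lu(1)
    proof eventually_elim
      fix x assume "- f x * u x + c * u' x + d * u'' x + pu x = 0"
      moreover have "f x * u x \<le> (B + 1) * u x"
        using f(1)[of x] u(3)[of x] by (intro mult_right_mono) auto
      ultimately show "c * u' x + d * u'' x \<le> (B + 1) * u x" using Lu(2)[of x] by simp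
    qed
    from positive_supersolution_log_derivative_bounded[OF u \<open>d > 0\<close> K this]
    obtain C where "C \<ge> 0" "\<And>x. \<bar>u' x\<bar> \<le> C * u x" by blast
    then show ?thesis using \<open>d > 0\<close> by (intro exI[of _ "d * C"]) (auto simp: mult.assoc intro!: mult_left_mono)
  qed (auto intro!: exI[of _ 0])
  then obtain C1 where C1: "C1 \<ge> 0" "\<And>x. d * \<bar>u' x\<bar> \<le> C1 * u x" by blast
  have "\<exists>C\<ge>0. \<forall>x. d * \<bar>\<psi>' x\<bar> \<le> C * \<psi> x"
  proof (cases "d = 0")
    case False
    then have "d > 0" using \<open>d \<ge> 0\<close> by simp
    have "AE x in lborel. (- c) * \<psi>' x + d * \<psi>'' x \<le> (B + 1) * \<psi> x"
      using L\<psi>(1)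
    proof eventually_elim
      fix x assume "- f x * \<psi> x - c * \<psi>' x + d * \<psi>'' x + p\<psi> x = 0"
      moreover have "f x * \<psi> x \<le> (B + 1) * \<psi> x"
        using f(1)[of x] \<psi>(3)[of x] by (intro mult_right_mono) auto
      ultimately show "(- c) * \<psi>' x + d * \<psi>'' x \<le> (B + 1) * \<psi> x" using L\<psi>(2)[of x] by simp
    qed
    from positive_supersolution_log_derivative_bounded[OF \<psi> \<open>d > 0\<close> K this]
    obtain C where "C \<ge> 0" "\<And>x. \<bar>\<psi>' x\<bar> \<le> C * \<psi> x" by blast
    then show ?thesis using \<open>d > 0\<close> by (intro exI[of _ "d * C"]) (auto simp: mult.assoc intro!: mult_left_mono)
  qed (auto intro!: exI[of _ 0])
  then obtain C2 where C2: "C2 \<ge> 0" "\<And>x. d * \<bar>\<psi>' x\<bar> \<le> C2 * \<psi> x" by blast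
  have Feq: "F x = c * (v x * v x * \<rho> x) + 2 * d * (v' x * v x * \<rho> x)
      - (d * u' x * \<psi> x * (h x * h x) + d * \<psi>' x * u x * (h x * h x))" for x
    unfolding F_def v'eq veq \<psi>eq by (simp add: algebra_simps)
  have "continuous_on UNIV h" by (rule ac_continuous_on[OF h])
  note [measurable] = this[THEN borel_measurable_continuous_onI]
  have rest: "integrable lborel (\<lambda>x. d * u' x * \<psi> x * (h x * h x) + d * \<psi>' x * u x * (h x * h x))"
  proof (rule Bochner_Integration.integrable_bound)
    show "integrable lborel (\<lambda>x. (C1 + C2) * (v x * v x * \<rho> x))" using vv by simp
    show "AE x in lborel. norm (d * u' x * \<psi> x * (h x * h x) + d * \<psi>' x * u x * (h x * h x))
        \<le> norm ((C1 + C2) * (v x * v x * \<rho> x))"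
    proof (rule AE_I2)
      fix x
      have "\<bar>d * u' x * \<psi> x * (h x * h x)\<bar> = d * \<bar>u' x\<bar> * (\<psi> x * (h x * h x))"
        using \<open>d \<ge> 0\<close> \<psi>(3)[of x] by (simp add: abs_mult)
      also have "\<dots> \<le> C1 * u x * (\<psi> x * (h x * h x))"
        using \<psi>(3)[of x] by (intro mult_right_mono C1) simp
      finally have 1: "\<bar>d * u' x * \<psi> x * (h x * h x)\<bar> \<le> C1 * (u x * \<psi> x * (h x * h x))" by (simp add: mult.assoc)
      have "\<bar>d * \<psi>' x * u x * (h x * h x)\<bar> = d * \<bar>\<psi>' x\<bar> * (u x * (h x * h x))"
        using \<open>d \<ge> 0\<close> u(3)[of x] by (simp add: abs_mult)
      also have "\<dots> \<le> C2 * \<psi> x * (u x * (h x * h x))"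
        using u(3)[of x] by (intro mult_right_mono C2) simp
      finally have 2: "\<bar>d * \<psi>' x * u x * (h x * h x)\<bar> \<le> C2 * (u x * \<psi> x * (h x * h x))" by (simp add: mult_ac)
      have 3: "v x * v x * \<rho> x = u x * \<psi> x * (h x * h x)" unfolding veq \<psi>eq by (simp add: mult_ac)
      have "0 \<le> (C1 + C2) * (u x * \<psi> x * (h x * h x))"
        using C1(1) C2(1) u(3)[of x] \<psi>(3)[of x] by simp
      then show "norm (d * u' x * \<psi> x * (h x * h x) + d * \<psi>' x * u x * (h x * h x))
        \<le> norm ((C1 + C2) * (v x * v x * \<rho> x))"
        unfolding 3 using 1 2 by (simp add: distrib_right)
    qed
  qed measurable
  have Fint: "integrable lborel F"
    unfolding Feq using vv v'v rest by auto
  have "(LINT x|lborel. G x) \<le> 0"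
  proof (rule integral_nonpos_of_flux[OF Gint Fint])
    fix a b :: real assume "a \<le> b"
    have "set_integrable lborel {a..b} G" using locally_integrableD[OF locally_integrable_integrable[OF Gint]] .
    then show "(LBINT x:{a..b}. G x) \<le> F b - F a"
      unfolding G_def F_def by (intro local_energy_flux[OF \<open>d \<ge> 0\<close> u \<psi> h h' Lu(1) L\<psi>(1) \<open>a \<le> b\<close>])
  qed
  then show "2 * (LINT x|lborel. (- f x * v x + c * v' x + d * v'' x) * v x * rho u \<psi> x)
      \<le> - (LINT x|lborel. (v x / u x)\<^sup>2 * (\<psi> x * pu x)) - (LINT x|lborel. (v x / u x)\<^sup>2 * (u x * p\<psi> x))"
    unfolding Geq using Av int by (simp add: \<rho>_def)
qed

section \<open>Averaging with respect to a kernel\<close>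

text \<open>The quadratic polynomial \<open>t \<mapsto> \<integral> (a - t b)\<^sup>2 \<rho>\<close> is nonnegative; its value at the minimum gives the claim.\<close>

lemma weighted_L2_Cauchy_Schwarz:
  assumes a: "a \<in> weighted_L2 \<rho>" and b: "b \<in> weighted_L2 \<rho>" and \<rho>: "\<And>x. \<rho> x \<ge> 0"
    and \<rho>m: "\<rho> \<in> borel_measurable borel"
  shows "(LINT x|lborel. a x * b x * \<rho> x)\<^sup>2
    \<le> (LINT x|lborel. (a x)\<^sup>2 * \<rho> x) * (LINT x|lborel. (b x)\<^sup>2 * \<rho> x)"
proof -
  define A B C where "A = (LINT x|lborel. (a x)\<^sup>2 * \<rho> x)" and "B = (LINT x|lborel. a x * b x * \<rho> x)"
    and "C = (LINT x|lborel. (b x)\<^sup>2 * \<rho> x)"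
  have ab: "integrable lborel (\<lambda>x. a x * b x * \<rho> x)"
    by (rule weighted_L2_mult_integrable[OF a b \<rho> \<rho>m])
  have aa: "integrable lborel (\<lambda>x. (a x)\<^sup>2 * \<rho> x)" and bb: "integrable lborel (\<lambda>x. (b x)\<^sup>2 * \<rho> x)"
    using a b by (auto simp: weighted_L2_def)
  have quad: "0 \<le> A - 2 * t * B + t\<^sup>2 * C" for t
  proof -
    have "0 \<le> (LINT x|lborel. (a x - t * b x)\<^sup>2 * \<rho> x)"
      using \<rho> by (intro integral_nonneg_AE AE_I2) simp
    also have "(\<lambda>x. (a x - t * b x)\<^sup>2 * \<rho> x)
        = (\<lambda>x. (a x)\<^sup>2 * \<rho> x - 2 * t * (a x * b x * \<rho> x) + t\<^sup>2 * ((b x)\<^sup>2 * \<rho> x))"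
      by (auto simp: power2_eq_square algebra_simps)
    also have "(LINT x|lborel. (a x)\<^sup>2 * \<rho> x - 2 * t * (a x * b x * \<rho> x) + t\<^sup>2 * ((b x)\<^sup>2 * \<rho> x))
        = A - 2 * t * B + t\<^sup>2 * C"
      unfolding A_def B_def C_def using aa ab bb by simp
    finally show ?thesis .
  qed
  have "C \<ge> 0" unfolding C_def using \<rho> by (intro integral_nonneg_AE AE_I2) simp
  have "B\<^sup>2 \<le> A * C"
  proof (cases "C = 0")
    case True
    have "B = 0"
    proof (rule ccontr)
      assume "B \<noteq> 0"
      then show False using quad[of "(A + 1) / (2 * B)"] True by simp
    qed
    then show ?thesis using True by simp
  next
    case False
    then have "C > 0" using \<open>C \<ge> 0\<close> by simp
    have "0 \<le> A - 2 * (B / C) * B + (B / C)\<^sup>2 * C" by (rule quad)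
    also have "\<dots> = A - B\<^sup>2 / C"
      using \<open>C > 0\<close> by (simp add: power2_eq_square)
    finally show ?thesis using \<open>C > 0\<close> by (simp add: field_simps)
  qed
  then show ?thesis by (simp add: A_def B_def C_def)
qed

text \<open>Up to normalization \<open>k\<close> is the joint density of two random variables \<open>X\<close> and \<open>Y\<close> with marginal densities
  \<open>m\<close> and \<open>n\<close>. In this reading \<open>cond h x\<close> is \<open>E[h(Y) | X = x]\<close> and \<open>cond_var h x\<close> is \<open>Var(h(Y) | X = x)\<close>.\<close>

locale kernel_with_marginals =
  fixes k :: "real \<Rightarrow> real \<Rightarrow> real" and m n :: "real \<Rightarrow> real"
  assumes k_measurable [measurable]: "case_prod k \<in> borel_measurable (borel \<Otimes>\<^sub>M borel)"
    and k_nonneg: "\<And>x y. k x y \<ge> 0"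
    and k_integrable_snd: "\<And>x. integrable lborel (\<lambda>y. k x y)" and k_first_marginal: "\<And>x. (LINT y|lborel. k x y) = m x"
    and k_integrable_fst: "\<And>y. integrable lborel (\<lambda>x. k x y)" and k_second_marginal: "\<And>y. (LINT x|lborel. k x y) = n y"
    and m_pos: "\<And>x. m x > 0" and n_integrable: "integrable lborel n"
begin

definition cond :: "(real \<Rightarrow> real) \<Rightarrow> real \<Rightarrow> real" where
  "cond h x = (LINT y|lborel. k x y * h y) / m x"

definition cond_var :: "(real \<Rightarrow> real) \<Rightarrow> real \<Rightarrow> real" where
  "cond_var h x = cond (\<lambda>y. (h y)\<^sup>2) x - (cond h x)\<^sup>2"

lemma m_measurable [measurable]: "m \<in> borel_measurable borel"
proof -
  have "(\<lambda>x. LINT y|lborel. k x y) \<in> borel_measurable borel" by measurable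
  then show ?thesis by (simp add: k_first_marginal)
qed

lemma n_measurable [measurable]: "n \<in> borel_measurable borel"
  using n_integrable by (auto dest: borel_measurable_integrable)

lemma n_nonneg: "n y \<ge> 0"
  unfolding k_second_marginal[symmetric] by (intro integral_nonneg_AE AE_I2 k_nonneg)

lemma cond_measurable [measurable]:
  assumes [measurable]: "h \<in> borel_measurable borel"
  shows "cond h \<in> borel_measurable borel"
  unfolding cond_def by measurable

lemma m_times_cond: "m x * cond h x = (LINT y|lborel. k x y * h y)"
  using m_pos[of x] by (simp add: cond_def)

context
  fixes h :: "real \<Rightarrow> real"
  assumes h_measurable [measurable]: "h \<in> borel_measurable borel"
    and h_integrable: "integrable lborel (\<lambda>y. n y * h y)"
begin

lemma kernel_times_integrable: "integrable (lborel \<Otimes>\<^sub>M lborel) (\<lambda>(x, y). k x y * h y)"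
proof -
  have "integrable (lborel \<Otimes>\<^sub>M lborel) (\<lambda>(y, x). k x y * h y)"
  proof (rule lborel_pair.Fubini_integrable)
    show "(\<lambda>(y, x). k x y * h y) \<in> borel_measurable (lborel \<Otimes>\<^sub>M lborel)" by measurable
    have "(LINT x|lborel. norm (case (y, x) of (y, x) \<Rightarrow> k x y * h y)) = \<bar>n y * h y\<bar>" for y
    proof -
      have "(LINT x|lborel. norm (case (y, x) of (y, x) \<Rightarrow> k x y * h y)) = (LINT x|lborel. k x y * \<bar>h y\<bar>)"
        by (rule Bochner_Integration.integral_cong) (auto simp: abs_mult k_nonneg)
      also have "\<dots> = n y * \<bar>h y\<bar>" by (simp add: k_second_marginal)
      finally show ?thesis by (simp add: abs_mult n_nonneg)
    qed
    then show "integrable lborel (\<lambda>y. LINT x|lborel. norm (case (y, x) of (y, x) \<Rightarrow> k x y * h y))"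
      using h_integrable by simp
    show "AE y in lborel. integrable lborel (\<lambda>x. case (y, x) of (y, x) \<Rightarrow> k x y * h y)"
      using k_integrable_fst by simp
  qed
  from lborel_pair.integrable_product_swap[OF this] show ?thesis
    by (simp add: split_def)
qed

lemma AE_kernel_times_integrable: "AE x in lborel. integrable lborel (\<lambda>y. k x y * h y)"
  using lborel_pair.AE_integrable_fst'[OF kernel_times_integrable] by simp

lemma cond_integrable: "integrable lborel (\<lambda>x. m x * cond h x)"
  using lborel_pair.integrable_fst'[OF kernel_times_integrable] by (simp add: m_times_cond)

text \<open>The law of total expectation.\<close>

lemma integral_cond: "(LINT x|lborel. m x * cond h x) = (LINT y|lborel. n y * h y)"
proof -
  have "(LINT x|lborel. m x * cond h x) = (LINT x|lborel. LINT y|lborel. k x y * h y)"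
    by (simp add: m_times_cond)
  also have "\<dots> = (LINT y|lborel. LINT x|lborel. k x y * h y)"
    by (rule lborel_pair.Fubini_integral[symmetric]) (rule kernel_times_integrable)
  also have "\<dots> = (LINT y|lborel. n y * h y)"
    by (simp add: k_second_marginal)
  finally show ?thesis .
qed

end

lemma square_integrable_imp_integrable:
  assumes [measurable]: "h \<in> borel_measurable borel" and h2: "integrable lborel (\<lambda>y. n y * (h y)\<^sup>2)"
  shows "integrable lborel (\<lambda>y. n y * h y)"
proof -
  have "h \<in> weighted_L2 n" "(\<lambda>_. 1) \<in> weighted_L2 n"
    using h2 n_integrable by (auto simp: weighted_L2_def mult.commute)
  from weighted_L2_mult_integrable[OF this n_nonneg n_measurable] show ?thesis
    by (simp add: mult.commute)
qed

context
  fixes h :: "real \<Rightarrow> real"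
  assumes h_measurable [measurable]: "h \<in> borel_measurable borel"
    and h2: "integrable lborel (\<lambda>y. n y * (h y)\<^sup>2)"
begin

lemma AE_cond_var:
  "AE x in lborel. integrable lborel (\<lambda>y. k x y * (h y)\<^sup>2) \<and>
     m x * cond_var h x = (LINT y|lborel. k x y * (h y - cond h x)\<^sup>2)"
proof -
  have "AE x in lborel. integrable lborel (\<lambda>y. k x y * h y)"
    by (rule AE_kernel_times_integrable) (use square_integrable_imp_integrable h2 in auto)
  moreover have "AE x in lborel. integrable lborel (\<lambda>y. k x y * (h y)\<^sup>2)"
    by (rule AE_kernel_times_integrable) (use h2 in auto)
  ultimately show ?thesis
  proof eventually_elim
    case (elim x)
    have "(LINT y|lborel. k x y * (h y - cond h x)\<^sup>2)
        = (LINT y|lborel. k x y * (h y)\<^sup>2 - 2 * cond h x * (k x y * h y) + (cond h x)\<^sup>2 * k x y)"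
      by (rule Bochner_Integration.integral_cong) (auto simp: power2_eq_square algebra_simps)
    also have "\<dots> = (LINT y|lborel. k x y * (h y)\<^sup>2) - 2 * cond h x * (LINT y|lborel. k x y * h y) + (cond h x)\<^sup>2 * m x"
      using elim k_integrable_snd[of x] by (simp add: k_first_marginal)
    also have "\<dots> = m x * cond (\<lambda>y. (h y)\<^sup>2) x - 2 * cond h x * (m x * cond h x) + (cond h x)\<^sup>2 * m x"
      by (simp add: m_times_cond)
    also have "\<dots> = m x * cond_var h x"
      by (simp add: cond_var_def power2_eq_square algebra_simps)
    finally show ?case using elim by simp
  qed
qed

lemma AE_cond_var_nonneg: "AE x in lborel. 0 \<le> m x * cond_var h x"
  using AE_cond_var by eventually_elim (simp add: k_nonneg integral_nonneg_AE)

text \<open>Averaging is a contraction on square integrable functions, by Jensen's inequality in the form that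
  conditional variances are nonnegative.\<close>

lemma cond_square_integrable: "integrable lborel (\<lambda>x. m x * (cond h x)\<^sup>2)"
proof (rule Bochner_Integration.integrable_bound)
  show "integrable lborel (\<lambda>x. m x * cond (\<lambda>y. (h y)\<^sup>2) x)"
    by (rule cond_integrable) (use h2 in auto)
  show "AE x in lborel. norm (m x * (cond h x)\<^sup>2) \<le> norm (m x * cond (\<lambda>y. (h y)\<^sup>2) x)"
    using AE_cond_var_nonneg
  proof eventually_elim
    case (elim x)
    then have "m x * (cond h x)\<^sup>2 \<le> m x * cond (\<lambda>y. (h y)\<^sup>2) x"
      by (simp add: cond_var_def right_diff_distrib)
    then show ?case using less_imp_le[OF m_pos[of x]] by simp
  qed
qed measurable

text \<open>The law of total variance, with second moments in place of variances.\<close>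

lemma cond_var_integrable: "integrable lborel (\<lambda>x. m x * cond_var h x)"
  and integral_cond_var: "(LINT x|lborel. m x * cond_var h x)
    = (LINT y|lborel. n y * (h y)\<^sup>2) - (LINT x|lborel. m x * (cond h x)\<^sup>2)"
proof -
  have i: "integrable lborel (\<lambda>x. m x * cond (\<lambda>y. (h y)\<^sup>2) x)"
    by (rule cond_integrable) (use h2 in auto)
  then show "integrable lborel (\<lambda>x. m x * cond_var h x)"
    using cond_square_integrable by (simp add: cond_var_def right_diff_distrib)
  show "(LINT x|lborel. m x * cond_var h x)
    = (LINT y|lborel. n y * (h y)\<^sup>2) - (LINT x|lborel. m x * (cond h x)\<^sup>2)"
    using i cond_square_integrable integral_cond[of "\<lambda>y. (h y)\<^sup>2"] h2
    by (simp add: cond_var_def right_diff_distrib)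
qed

text \<open>The right-hand side is \<open>\<integral>\<integral> k(x, y) (h(x) - h(y))\<^sup>2\<close>, with the mixed term integrated in \<open>y\<close> first. For fixed
  \<open>x\<close>, the mean square distance of \<open>h(Y)\<close> from the number \<open>h(x)\<close> is at least its distance from the conditional
  mean; the two differ by \<open>(h(x) - cond h x)\<^sup>2\<close>.\<close>

lemma
  assumes h1: "integrable lborel (\<lambda>x. m x * (h x)\<^sup>2)"
  shows cross_integrable: "integrable lborel (\<lambda>x. m x * (h x * cond h x))"
    and Dirichlet_form_ge_cond_var: "(LINT x|lborel. m x * cond_var h x)
      \<le> (LINT x|lborel. m x * (h x)\<^sup>2) - 2 * (LINT x|lborel. m x * (h x * cond h x)) + (LINT y|lborel. n y * (h y)\<^sup>2)"
proof -
  have "h \<in> weighted_L2 m" "cond h \<in> weighted_L2 m"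
    using h1 cond_square_integrable by (auto simp: weighted_L2_def mult.commute)
  from weighted_L2_mult_integrable[OF this less_imp_le[OF m_pos] m_measurable]
  show c: "integrable lborel (\<lambda>x. m x * (h x * cond h x))" by (simp add: mult.commute)
  have "0 \<le> (LINT x|lborel. m x * (h x - cond h x)\<^sup>2)"
    using less_imp_le[OF m_pos] by (intro integral_nonneg_AE AE_I2) simp
  also have "\<dots> = (LINT x|lborel. m x * (h x)\<^sup>2 - 2 * (m x * (h x * cond h x)) + m x * (cond h x)\<^sup>2)"
    by (rule Bochner_Integration.integral_cong) (auto simp: power2_eq_square algebra_simps)
  also have "\<dots> = (LINT x|lborel. m x * (h x)\<^sup>2) - 2 * (LINT x|lborel. m x * (h x * cond h x))
      + (LINT x|lborel. m x * (cond h x)\<^sup>2)"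
    using h1 c cond_square_integrable by simp
  finally show "(LINT x|lborel. m x * cond_var h x)
      \<le> (LINT x|lborel. m x * (h x)\<^sup>2) - 2 * (LINT x|lborel. m x * (h x * cond h x)) + (LINT y|lborel. n y * (h y)\<^sup>2)"
    unfolding integral_cond_var by simp
qed

end

end

text \<open>A variance is the minimum of the second moments about all constants, and second moments about a fixed
  constant are monotone in the density; the constant is taken to be the mean with respect to \<open>n\<close>.\<close>

lemma variance_mono_density:
  fixes n \<pi> h :: "real \<Rightarrow> real"
  assumes le: "\<And>x. \<delta> * \<pi> x \<le> n x" and \<pi>: "\<And>x. \<pi> x \<ge> 0" "integrable lborel \<pi>" "(LINT x|lborel. \<pi> x) = 1"
    and n: "integrable lborel n" and "\<delta> \<ge> 0" "(LINT x|lborel. n x) > 0"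
    and [measurable]: "h \<in> borel_measurable borel"
    and nh2: "integrable lborel (\<lambda>x. n x * (h x)\<^sup>2)" and \<pi>h2: "integrable lborel (\<lambda>x. \<pi> x * (h x)\<^sup>2)"
  shows "\<delta> * ((LINT x|lborel. \<pi> x * (h x)\<^sup>2) - (LINT x|lborel. \<pi> x * h x)\<^sup>2)
    \<le> (LINT x|lborel. n x * (h x)\<^sup>2) - (LINT x|lborel. n x * h x)\<^sup>2 / (LINT x|lborel. n x)"
proof -
  have [measurable]: "n \<in> borel_measurable borel" "\<pi> \<in> borel_measurable borel"
    using n \<pi>(2) by (auto dest: borel_measurable_integrable)
  have n0: "n x \<ge> 0" for x using le[of x] \<pi>(1)[of x] \<open>\<delta> \<ge> 0\<close> by (meson mult_nonneg_nonneg order_trans)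
  have int1: "integrable lborel (\<lambda>x. s x * h x)"
    if s: "integrable lborel s" "\<And>x. s x \<ge> 0" "integrable lborel (\<lambda>x. s x * (h x)\<^sup>2)" for s
  proof -
    have [measurable]: "s \<in> borel_measurable borel" using s by (auto dest: borel_measurable_integrable)
    have "h \<in> weighted_L2 s" "(\<lambda>_. 1) \<in> weighted_L2 s"
      using s by (auto simp: weighted_L2_def mult.commute)
    from weighted_L2_mult_integrable[OF this s(2)] show ?thesis by (simp add: mult.commute)
  qed
  define Z c where "Z = (LINT x|lborel. n x)" and "c = (LINT x|lborel. n x * h x) / Z"
  have Z: "Z > 0" "(LINT x|lborel. n x * h x) = c * Z" using assms(7) by (auto simp: Z_def c_def)
  have expand: "(LINT x|lborel. s x * (h x - c)\<^sup>2)
      = (LINT x|lborel. s x * (h x)\<^sup>2) - 2 * c * (LINT x|lborel. s x * h x) + c\<^sup>2 * (LINT x|lborel. s x)"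
    and expand_int: "integrable lborel (\<lambda>x. s x * (h x - c)\<^sup>2)"
    if s: "integrable lborel s" "\<And>x. s x \<ge> 0" "integrable lborel (\<lambda>x. s x * (h x)\<^sup>2)" for s
  proof -
    have eq: "(\<lambda>x. s x * (h x - c)\<^sup>2) = (\<lambda>x. s x * (h x)\<^sup>2 - 2 * c * (s x * h x) + c\<^sup>2 * s x)"
      by (auto simp: power2_eq_square algebra_simps)
    show "(LINT x|lborel. s x * (h x - c)\<^sup>2)
      = (LINT x|lborel. s x * (h x)\<^sup>2) - 2 * c * (LINT x|lborel. s x * h x) + c\<^sup>2 * (LINT x|lborel. s x)"
      "integrable lborel (\<lambda>x. s x * (h x - c)\<^sup>2)"
      unfolding eq using s int1[OF s] by auto
  qed
  have "\<delta> * ((LINT x|lborel. \<pi> x * (h x)\<^sup>2) - (LINT x|lborel. \<pi> x * h x)\<^sup>2)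
    \<le> \<delta> * ((LINT x|lborel. \<pi> x * (h x)\<^sup>2) - (LINT x|lborel. \<pi> x * h x)\<^sup>2 + (c - (LINT x|lborel. \<pi> x * h x))\<^sup>2)"
    using \<open>\<delta> \<ge> 0\<close> by (intro mult_left_mono) auto
  also have "\<dots> = \<delta> * (LINT x|lborel. \<pi> x * (h x - c)\<^sup>2)"
    unfolding expand[OF \<pi>(2,1) \<pi>h2] \<pi>(3) by (simp add: power2_eq_square algebra_simps)
  also have "\<dots> = (LINT x|lborel. \<delta> * (\<pi> x * (h x - c)\<^sup>2))" by simp
  also have "\<dots> \<le> (LINT x|lborel. n x * (h x - c)\<^sup>2)"
  proof (rule integral_mono)
    show "integrable lborel (\<lambda>x. \<delta> * (\<pi> x * (h x - c)\<^sup>2))"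
      using expand_int[OF \<pi>(2,1) \<pi>h2] by simp
    show "\<delta> * (\<pi> x * (h x - c)\<^sup>2) \<le> n x * (h x - c)\<^sup>2" for x
      using mult_right_mono[OF le[of x], of "(h x - c)\<^sup>2"] by (simp add: mult.assoc)
  qed (rule expand_int[OF n n0 nh2])
  also have "\<dots> = (LINT x|lborel. n x * (h x)\<^sup>2) - (LINT x|lborel. n x * h x)\<^sup>2 / Z"
    unfolding expand[OF n n0 nh2] Z(2) using Z(1) by (simp add: Z_def[symmetric] power2_eq_square)
  finally show ?thesis by (simp add: Z_def)
qed

section \<open>Differentiating the averages\<close>

text \<open>The continuous lower bound \<open>l\<close> passes from \<open>D\<close> to its continuous representative \<open>E\<close>, so that \<open>E\<close> has no zeros
  and the quotient rule for absolutely continuous functions applies.\<close>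

lemma has_weak_derivative_divide:
  assumes N: "has_weak_derivative 1 N N'" and D: "has_weak_derivative 1 D D'"
    and [measurable]: "N \<in> borel_measurable borel" "D \<in> borel_measurable borel"
    and low: "\<And>x. l x \<le> D x" "\<And>x. l x > 0" "continuous_on UNIV l"
  shows "has_weak_derivative 1 (\<lambda>x. N x / D x) (\<lambda>x. N' x / D x - N x * D' x / (D x)\<^sup>2)"
proof -
  have [measurable]: "N' \<in> borel_measurable borel" "D' \<in> borel_measurable borel"
    using N D by (auto simp: has_weak_derivative_def intro: locally_integrable_measurable)
  obtain A where A: "has_ac_derivative A N'" "AE x in lborel. N x = A x"
    using weak_derivative_imp_ac[OF N] by blast
  obtain E where E: "has_ac_derivative E D'" "AE x in lborel. D x = E x"
    using weak_derivative_imp_ac[OF D] by blast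
  \<comment> \<open>The inequality \<open>l \<le> E\<close> holds almost everywhere; as an equation between continuous functions it holds everywhere.\<close>
  have "(\<lambda>x. max (E x) (l x)) = E"
  proof (rule AE_eq_continuous_imp_eq)
    show "AE x in lborel. max (E x) (l x) = E x"
      using E(2) by eventually_elim (use low(1) in \<open>metis max.absorb1\<close>)
  qed (intro continuous_intros ac_continuous_on[OF E(1)] low)+
  then have "E x \<ge> l x" for x by (metis max.cobounded2)
  then have E0: "E x \<noteq> 0" for x using low(2)[of x] by (metis not_le)
  have "has_ac_derivative (\<lambda>x. A x / E x) (\<lambda>x. N' x / D x - N x * D' x / (D x)\<^sup>2)"
  proof (rule has_ac_derivative_cong_AE[OF has_ac_derivative_divide[OF A(1) E(1) E0]])
    show "AE x in lborel. N' x / E x - A x * D' x / (E x)\<^sup>2 = N' x / D x - N x * D' x / (D x)\<^sup>2"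
      using A(2) E(2) by eventually_elim simp
  qed measurable
  from ac_imp_has_weak_derivative[OF this] show ?thesis
  proof (rule has_weak_derivative_cong_AE)
    show "AE x in lborel. A x / E x = N x / D x"
      using A(2) E(2) by eventually_elim simp
  qed measurable
qed

lemma deriv_zero_at_zeros_of_nonneg:
  assumes "\<And>x::real. w x \<ge> (0::real)" "(w has_real_derivative D) (at x)" "w x = 0"
  shows "D = 0"
  by (rule DERIV_local_min[OF assms(2), of 1]) (use assms in auto)

text \<open>Let \<open>\<omega>(y) = w(x - y) \<phi>(y) / (w * \<phi>)(x)\<close>, a probability density, and let \<open>b(y)\<close> be the logarithmic
  derivative of \<open>w\<close> at \<open>x - y\<close>. The formal derivative of \<open>x \<mapsto> (w * (\<phi> h))(x) / (w * \<phi>)(x)\<close> is the covariance of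
  \<open>b\<close> and \<open>h\<close> under \<open>\<omega>\<close>, that is \<open>\<integral> b (h - Q) \<omega>\<close>, and Cauchy--Schwarz bounds its square by \<open>M\<close>
  times the variance of \<open>h\<close>. Writing \<open>w'\<close> as \<open>b w\<close> requires that \<open>w'\<close> vanishes almost everywhere on the zero set of
  \<open>w\<close>; for a nonnegative \<open>w\<close> such zeros are minima.\<close>

lemma weighted_average_derivative_bound:
  fixes w w' \<phi> h :: "real \<Rightarrow> real"
  assumes [measurable]: "w \<in> borel_measurable borel" "w' \<in> borel_measurable borel"
      "\<phi> \<in> borel_measurable borel" "h \<in> borel_measurable borel"
    and w: "\<And>x. w x \<ge> 0" "AE z in lborel. w z = 0 \<longrightarrow> w' z = 0"
    and \<phi>: "\<And>x. \<phi> x \<ge> 0" "integrable lborel (\<lambda>y. w (x - y) * \<phi> y)"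
    and D: "conv w \<phi> x > 0"
    and M: "(\<integral>\<^sup>+y. ennreal ((w' (x - y) / w (x - y))\<^sup>2 * (w (x - y) * \<phi> y / conv w \<phi> x)) \<partial>lborel) \<le> ennreal M" "M \<ge> 0"
    and h: "integrable lborel (\<lambda>y. w (x - y) * \<phi> y * (h y)\<^sup>2)"
  defines "Q \<equiv> conv w (\<lambda>y. \<phi> y * h y) x / conv w \<phi> x"
  shows "(conv w' (\<lambda>y. \<phi> y * h y) x / conv w \<phi> x
       - conv w (\<lambda>y. \<phi> y * h y) x * conv w' \<phi> x / (conv w \<phi> x)\<^sup>2)\<^sup>2
    \<le> M * ((LINT y|lborel. w (x - y) * \<phi> y * (h y - Q)\<^sup>2) / conv w \<phi> x)"
proof -
  define D where "D = conv w \<phi> x"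
  have "D > 0" using assms(9) by (simp add: D_def)
  define \<omega> b where "\<omega> = (\<lambda>y. w (x - y) * \<phi> y / D)" and "b = (\<lambda>y. w' (x - y) / w (x - y))"
  have [measurable]: "\<omega> \<in> borel_measurable borel" "b \<in> borel_measurable borel"
    unfolding \<omega>_def b_def by measurable
  have \<omega>0: "\<omega> y \<ge> 0" for y using \<open>D > 0\<close> w(1) \<phi>(1) by (simp add: \<omega>_def)
  have nn: "(\<integral>\<^sup>+y. ennreal ((b y)\<^sup>2 * \<omega> y) \<partial>lborel) \<le> ennreal M"
    using M(1) by (simp add: b_def \<omega>_def D_def)
  have bint: "integrable lborel (\<lambda>y. (b y)\<^sup>2 * \<omega> y)"
  proof (rule integrableI_nonneg)
    show "(\<integral>\<^sup>+y. ennreal ((b y)\<^sup>2 * \<omega> y) \<partial>lborel) < \<infinity>"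
      using nn by (rule le_less_trans) simp
  qed (use \<omega>0 in auto)
  have bM: "(LINT y|lborel. (b y)\<^sup>2 * \<omega> y) \<le> M"
    using nn \<omega>0 bint M(2) by (subst (asm) nn_integral_eq_integral) auto
  have b: "b \<in> weighted_L2 \<omega>" using bint by (simp add: weighted_L2_def)
  have one: "(\<lambda>_. 1) \<in> weighted_L2 \<omega>" using \<phi>(2) by (simp add: weighted_L2_def \<omega>_def)
  have "integrable lborel (\<lambda>y. w (x - y) * \<phi> y * (h y)\<^sup>2 / D)" using h by simp
  then have hL: "h \<in> weighted_L2 \<omega>" by (simp add: weighted_L2_def \<omega>_def mult_ac)
  note mult = weighted_L2_mult_integrable[of _ \<omega>, OF _ _ \<omega>0 \<open>\<omega> \<in> borel_measurable borel\<close>]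
  have i1: "integrable lborel (\<lambda>y. b y * \<omega> y)" using mult[OF b one] by simp
  have i2: "integrable lborel (\<lambda>y. b y * h y * \<omega> y)" using mult[OF b hL] by simp
  have hi: "integrable lborel (\<lambda>y. h y * \<omega> y)" using mult[OF hL one] by simp
  have \<omega>i: "integrable lborel \<omega>" using \<phi>(2) by (simp add: \<omega>_def)
  have "AE y in lborel. w (x + (-1) * y) = 0 \<longrightarrow> w' (x + (-1) * y) = 0"
    by (rule AE_borel_affine[where P="\<lambda>z. w z = 0 \<longrightarrow> w' z = 0"]) (use w(2) in auto)
  then have ae: "AE y in lborel. w' (x - y) * \<phi> y = D * (b y * \<omega> y)"
  proof eventually_elim
    case (elim y)
    then show ?case using \<open>D > 0\<close> by (cases "w (x - y) = 0") (auto simp: b_def \<omega>_def)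
  qed
  have c1: "conv w' \<phi> x = D * (LINT y|lborel. b y * \<omega> y)"
  proof -
    have "conv w' \<phi> x = (LINT y|lborel. D * (b y * \<omega> y))"
      unfolding conv_def by (rule integral_cong_AE) (use ae in auto)
    then show ?thesis by simp
  qed
  have c2: "conv w' (\<lambda>y. \<phi> y * h y) x = D * (LINT y|lborel. b y * h y * \<omega> y)"
  proof -
    have "conv w' (\<lambda>y. \<phi> y * h y) x = (LINT y|lborel. D * (b y * h y * \<omega> y))"
      unfolding conv_def
    proof (rule integral_cong_AE)
      show "AE y in lborel. w' (x - y) * (\<phi> y * h y) = D * (b y * h y * \<omega> y)"
        using ae
      proof eventually_elim
        case (elim y)
        have "w' (x - y) * (\<phi> y * h y) = (w' (x - y) * \<phi> y) * h y" by simp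
        then show ?case unfolding elim by simp
      qed
    qed measurable
    then show ?thesis by simp
  qed
  have Nq: "conv w (\<lambda>y. \<phi> y * h y) x = Q * D" using \<open>D > 0\<close> by (simp add: Q_def D_def)
  have "conv w' (\<lambda>y. \<phi> y * h y) x / D - conv w (\<lambda>y. \<phi> y * h y) x * conv w' \<phi> x / D\<^sup>2
      = (LINT y|lborel. b y * h y * \<omega> y) - Q * (LINT y|lborel. b y * \<omega> y)"
    unfolding c1 c2 Nq using \<open>D > 0\<close> by (simp add: power2_eq_square)
  also have "\<dots> = (LINT y|lborel. b y * h y * \<omega> y - Q * (b y * \<omega> y))"
    using i1 i2 by simp
  also have "\<dots> = (LINT y|lborel. b y * (h y - Q) * \<omega> y)"
    by (rule Bochner_Integration.integral_cong) (auto simp: algebra_simps)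
  finally have eq: "conv w' (\<lambda>y. \<phi> y * h y) x / D - conv w (\<lambda>y. \<phi> y * h y) x * conv w' \<phi> x / D\<^sup>2
      = (LINT y|lborel. b y * (h y - Q) * \<omega> y)" .
  have "integrable lborel (\<lambda>y. (h y)\<^sup>2 * \<omega> y - 2 * Q * (h y * \<omega> y) + Q\<^sup>2 * \<omega> y)"
    using hL hi \<omega>i by (auto simp: weighted_L2_def)
  then have hQ: "(\<lambda>y. h y - Q) \<in> weighted_L2 \<omega>"
    by (simp add: weighted_L2_def power2_diff algebra_simps)
  have "(LINT y|lborel. b y * (h y - Q) * \<omega> y)\<^sup>2
      \<le> (LINT y|lborel. (b y)\<^sup>2 * \<omega> y) * (LINT y|lborel. (h y - Q)\<^sup>2 * \<omega> y)"
    by (rule weighted_L2_Cauchy_Schwarz[OF b hQ \<omega>0]) measurable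
  also have "\<dots> \<le> M * (LINT y|lborel. (h y - Q)\<^sup>2 * \<omega> y)"
    using \<omega>0 by (intro mult_right_mono bM integral_nonneg_AE AE_I2) simp
  also have "(LINT y|lborel. (h y - Q)\<^sup>2 * \<omega> y) = (LINT y|lborel. w (x - y) * \<phi> y * (h y - Q)\<^sup>2 / D)"
    by (rule Bochner_Integration.integral_cong) (auto simp: \<omega>_def)
  also have "\<dots> = (LINT y|lborel. w (x - y) * \<phi> y * (h y - Q)\<^sup>2) / D" by simp
  finally show ?thesis unfolding eq[symmetric] D_def[symmetric] .
qed

section \<open>The nonlocal part and the spectral gap\<close>

text \<open>The part of the setting that concerns the nonlocal operator: two positive functions that are
  comparable to their images under \<open>P\<close> and \<open>P\<^sup>*\<close>.\<close>

locale positive_null_functions =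
  fixes r q w w\<^sub>x u \<psi> :: "real \<Rightarrow> real" and \<delta>\<^sub>1 \<delta>\<^sub>2 \<delta>\<^sub>1' \<delta>\<^sub>2' :: real
  assumes r: "continuous_on UNIV r" "bounded (range r)" "\<And>x. r x > 0"
    and q: "continuous_on UNIV q" "bounded (range q)" "\<And>x. q x > 0"
    and w: "\<And>x. w x \<ge> 0" "integrable lborel w"
    and w\<^sub>x: "AE x in lborel. (w has_real_derivative w\<^sub>x x) (at x)" "integrable lborel w\<^sub>x"
    and u: "continuous_on UNIV u" "\<And>x. u x > 0"
    and \<psi>: "continuous_on UNIV \<psi>" "\<And>x. \<psi> x > 0"
    and u\<psi>: "integrable lborel (\<lambda>x. u x * \<psi> x)" "(LINT x|lborel. u x * \<psi> x) = 1"
    and \<delta>_pos: "\<delta>\<^sub>1 > 0" "\<delta>\<^sub>2 > 0" "\<delta>\<^sub>1' > 0" "\<delta>\<^sub>2' > 0"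
    and P_bounds: "\<And>x. \<delta>\<^sub>1 * u x \<le> op_P (kern r w q) u x" "\<And>x. op_P (kern r w q) u x \<le> \<delta>\<^sub>2 * u x"
    and P_adj_bounds: "\<And>x. \<delta>\<^sub>1' * \<psi> x \<le> op_P_adj (kern r w q) \<psi> x"
      "\<And>x. op_P_adj (kern r w q) \<psi> x \<le> \<delta>\<^sub>2' * \<psi> x"
begin

abbreviation p where "p \<equiv> kern r w q"

definition k where "k x y = \<psi> x * (p x y * u y)"
definition m where "m x = \<psi> x * op_P p u x"
definition n where "n y = u y * op_P_adj p \<psi> y"

lemma data_measurable [measurable]: "r \<in> borel_measurable borel" "q \<in> borel_measurable borel"
  "w \<in> borel_measurable borel" "w\<^sub>x \<in> borel_measurable borel" "u \<in> borel_measurable borel" "\<psi> \<in> borel_measurable borel"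
  using r q u \<psi> w w\<^sub>x borel_measurable_continuous_onI by (auto dest: borel_measurable_integrable)

lemma P_pos: "op_P p u x > 0" "op_P_adj p \<psi> x > 0"
  using P_bounds(1)[of x] P_adj_bounds(1)[of x] \<delta>_pos u(2)[of x] \<psi>(2)[of x]
  by (auto intro: less_le_trans[rotated])

text \<open>A Bochner integral that is not zero is not a default value, so the lower bounds on \<open>P u\<close> and \<open>P\<^sup>* \<psi>\<close>
  entail that the defining integrals converge at every point.\<close>

lemma P_integrable: "integrable lborel (\<lambda>y. p x y * u y)"
proof (rule ccontr)
  assume "\<not> ?thesis"
  then have "op_P p u x = 0" unfolding op_P_def by (rule not_integrable_integral_eq)
  then show False using P_pos(1)[of x] by simp
qed

lemma P_adj_integrable: "integrable lborel (\<lambda>x. p x y * \<psi> x)"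
proof (rule ccontr)
  assume "\<not> ?thesis"
  then have "op_P_adj p \<psi> y = 0" unfolding op_P_adj_def by (rule not_integrable_integral_eq)
  then show False using P_pos(2)[of y] by simp
qed

lemma m_le: "m x \<le> \<delta>\<^sub>2 * (u x * \<psi> x)" and m_ge: "\<delta>\<^sub>1 * (u x * \<psi> x) \<le> m x"
  and n_le: "n x \<le> \<delta>\<^sub>2' * (u x * \<psi> x)" and n_ge: "\<delta>\<^sub>1' * (u x * \<psi> x) \<le> n x"
  using mult_left_mono[OF P_bounds(1)[of x] less_imp_le[OF \<psi>(2)[of x]]]
    mult_left_mono[OF P_bounds(2)[of x] less_imp_le[OF \<psi>(2)[of x]]]
    mult_left_mono[OF P_adj_bounds(1)[of x] less_imp_le[OF u(2)[of x]]]
    mult_left_mono[OF P_adj_bounds(2)[of x] less_imp_le[OF u(2)[of x]]]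
  by (simp_all add: m_def n_def mult_ac)

lemma k_measurable: "case_prod k \<in> borel_measurable (borel \<Otimes>\<^sub>M borel)"
  unfolding k_def kern_def split_def by measurable

lemma k_marginals: "(LINT y|lborel. k x y) = m x" "(LINT x|lborel. k x y) = n y"
proof -
  show "(LINT y|lborel. k x y) = m x" by (simp add: k_def m_def op_P_def)
  have "(LINT x|lborel. k x y) = (LINT x|lborel. u y * (p x y * \<psi> x))"
    by (rule Bochner_Integration.integral_cong) (auto simp: k_def)
  then show "(LINT x|lborel. k x y) = n y" by (simp add: n_def op_P_adj_def)
qed

lemma dominated_by_u\<psi>:
  assumes [measurable]: "g \<in> borel_measurable borel"
    and "\<And>x. 0 \<le> g x" "\<And>x. g x \<le> C * (u x * \<psi> x)"
  shows "integrable lborel g"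
proof (rule Bochner_Integration.integrable_bound)
  show "integrable lborel (\<lambda>x. C * (u x * \<psi> x))" using u\<psi>(1) by simp
  show "AE x in lborel. norm (g x) \<le> norm (C * (u x * \<psi> x))"
    using assms(2,3) by (intro AE_I2) (metis abs_ge_self abs_of_nonneg order_trans real_norm_def)
qed measurable

sublocale kernel_with_marginals k m n
proof
  show "k x y \<ge> 0" for x y
    using r(3) q(3) w(1) u(2) \<psi>(2) by (simp add: k_def kern_def less_imp_le)
  show "m x > 0" for x using \<psi>(2) P_pos(1) by (simp add: m_def)
  show "integrable lborel (\<lambda>y. k x y)" for x
    unfolding k_def using P_integrable by simp
  have "(\<lambda>x. k x y) = (\<lambda>x. u y * (p x y * \<psi> x))" for y by (auto simp: k_def)
  then show "integrable lborel (\<lambda>x. k x y)" for y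
    using P_adj_integrable by simp
  have [measurable]: "(\<lambda>(y, x). k x y) \<in> borel_measurable (borel \<Otimes>\<^sub>M borel)"
    unfolding k_def kern_def split_def by measurable
  have "(\<lambda>y. LINT x|lborel. k x y) \<in> borel_measurable borel" by measurable
  then have "n \<in> borel_measurable borel" by (simp add: k_marginals)
  moreover have "n y \<ge> 0" for y
    using u(2) P_pos(2) by (simp add: n_def less_imp_le)
  ultimately show "integrable lborel n"
    using n_le by (rule dominated_by_u\<psi>)
qed (simp_all add: k_marginals k_measurable)

lemma m_integrable: "integrable lborel m"
  by (rule dominated_by_u\<psi>[OF m_measurable less_imp_le[OF m_pos] m_le])

definition Z where "Z = (LINT x|lborel. m x)"

lemma Z_pos: "Z > 0"
proof -
  have "\<delta>\<^sub>1 = (LINT x|lborel. \<delta>\<^sub>1 * (u x * \<psi> x))" using u\<psi> by simp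
  also have "\<dots> \<le> Z"
    unfolding Z_def using u\<psi> by (intro integral_mono m_ge m_integrable) simp
  finally show ?thesis using \<delta>_pos by simp
qed

lemma integral_n: "(LINT y|lborel. n y) = Z"
  using integral_cond[of "\<lambda>_. 1"] n_integrable m_pos
  by (simp add: Z_def cond_def k_first_marginal less_imp_neq[THEN not_sym])

lemma mu_eq: "mu p u \<psi> x = m x / Z"
  by (simp add: mu_def Z_mu_def m_def Z_def mult.commute)

text \<open>With \<open>h = v / u\<close> the factors of \<open>k\<close> that depend on \<open>x\<close> alone cancel, and the conditional expectation becomes a
  quotient of two convolutions with \<open>w\<close>. This is the form that can be differentiated.\<close>

lemma cond_eq: "cond (\<lambda>y. v y / u y) x = conv w (\<lambda>y. q y * v y) x / conv w (\<lambda>y. q y * u y) x"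
proof -
  have "(LINT y|lborel. k x y * (v y / u y)) = (LINT y|lborel. \<psi> x * (p x y * v y))"
    using less_imp_neq[OF u(2)] by (intro Bochner_Integration.integral_cong) (auto simp: k_def)
  also have "\<dots> = \<psi> x * (r x * conv w (\<lambda>y. q y * v y) x)"
    by (simp add: op_P_def[symmetric] op_P_kern)
  finally show ?thesis
    using less_imp_neq[OF \<psi>(2)[of x]] less_imp_neq[OF r(3)[of x]]
    by (simp add: cond_def m_def op_P_kern)
qed

lemma weighted_L2_rho_times_bounded:
  assumes v: "v \<in> weighted_L2 (rho u \<psi>)"
  shows "(\<lambda>y. q y * v y) \<in> weighted_L2 (rho u \<psi>)"
proof -
  obtain B where B: "\<And>x. \<bar>q x\<bar> \<le> B" using q(2) unfolding bounded_iff by auto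
  have [measurable]: "v \<in> borel_measurable borel" using v by (simp add: weighted_L2_def)
  have "integrable lborel (\<lambda>x. (q x * v x)\<^sup>2 * rho u \<psi> x)"
  proof (rule Bochner_Integration.integrable_bound)
    show "integrable lborel (\<lambda>x. B\<^sup>2 * ((v x)\<^sup>2 * rho u \<psi> x))"
      using v by (simp add: weighted_L2_def)
    show "(\<lambda>x. (q x * v x)\<^sup>2 * rho u \<psi> x) \<in> borel_measurable lborel"
      unfolding rho_def by measurable
    show "AE x in lborel. norm ((q x * v x)\<^sup>2 * rho u \<psi> x) \<le> norm (B\<^sup>2 * ((v x)\<^sup>2 * rho u \<psi> x))"
    proof (rule AE_I2)
      fix x
      have "(q x)\<^sup>2 \<le> B\<^sup>2" using B[of x] by (rule abs_le_square_iff[THEN iffD1, OF order_trans]) simp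
      then have "(q x)\<^sup>2 * ((v x)\<^sup>2 * \<bar>rho u \<psi> x\<bar>) \<le> B\<^sup>2 * ((v x)\<^sup>2 * \<bar>rho u \<psi> x\<bar>)"
        by (rule mult_right_mono) simp
      then show "norm ((q x * v x)\<^sup>2 * rho u \<psi> x) \<le> norm (B\<^sup>2 * ((v x)\<^sup>2 * rho u \<psi> x))"
        by (simp add: abs_mult power_mult_distrib mult.assoc)
    qed
  qed
  then show ?thesis by (simp add: weighted_L2_def)
qed

lemma u_in_weighted_L2: "u \<in> weighted_L2 (rho u \<psi>)"
proof -
  have "(\<lambda>x. (u x)\<^sup>2 * rho u \<psi> x) = (\<lambda>x. u x * \<psi> x)"
    using less_imp_neq[OF u(2)] by (auto simp: rho_def power2_eq_square)
  then show ?thesis using u\<psi> by (simp add: weighted_L2_def)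
qed

lemma quotient_square_integrable:
  assumes v: "v \<in> weighted_L2 (rho u \<psi>)"
  shows "integrable lborel (\<lambda>x. m x * (v x / u x)\<^sup>2)" "integrable lborel (\<lambda>x. n x * (v x / u x)\<^sup>2)"
    "integrable lborel (\<lambda>x. u x * \<psi> x * (v x / u x)\<^sup>2)"
proof -
  have [measurable]: "v \<in> borel_measurable borel" using v by (simp add: weighted_L2_def)
  have eq: "(\<lambda>x. (v x)\<^sup>2 * rho u \<psi> x) = (\<lambda>x. u x * \<psi> x * (v x / u x)\<^sup>2)"
    using less_imp_neq[OF u(2)] by (auto simp: rho_def power2_eq_square field_simps)
  show i: "integrable lborel (\<lambda>x. u x * \<psi> x * (v x / u x)\<^sup>2)"
    unfolding eq[symmetric] using v by (simp add: weighted_L2_def)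
  have "integrable lborel (\<lambda>x. s x * (v x / u x)\<^sup>2)"
    if [measurable]: "s \<in> borel_measurable borel" and s: "\<And>x. 0 \<le> s x" "\<And>x. s x \<le> C * (u x * \<psi> x)" for s C
  proof (rule Bochner_Integration.integrable_bound)
    show "integrable lborel (\<lambda>x. C * (u x * \<psi> x * (v x / u x)\<^sup>2))" using i by simp
    show "AE x in lborel. norm (s x * (v x / u x)\<^sup>2) \<le> norm (C * (u x * \<psi> x * (v x / u x)\<^sup>2))"
    proof (rule AE_I2)
      fix x
      have "s x * (v x / u x)\<^sup>2 \<le> C * (u x * \<psi> x) * (v x / u x)\<^sup>2"
        by (rule mult_right_mono[OF s(2)]) simp
      moreover have "0 \<le> s x * (v x / u x)\<^sup>2" using s(1) by simp
      ultimately show "norm (s x * (v x / u x)\<^sup>2) \<le> norm (C * (u x * \<psi> x * (v x / u x)\<^sup>2))"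
        unfolding real_norm_def mult.assoc by linarith
    qed
  qed measurable
  from this[OF m_measurable less_imp_le[OF m_pos] m_le] this[OF n_measurable n_nonneg n_le]
  show "integrable lborel (\<lambda>x. m x * (v x / u x)\<^sup>2)" "integrable lborel (\<lambda>x. n x * (v x / u x)\<^sup>2)" .
qed

lemma w\<^sub>x_zero: "AE z in lborel. w z = 0 \<longrightarrow> w\<^sub>x z = 0"
  using w\<^sub>x(1)
proof eventually_elim
  case (elim z)
  then show ?case using deriv_zero_at_zeros_of_nonneg[of w "w\<^sub>x z" z] w(1) by blast
qed

lemma conv_qu_pos: "conv w (\<lambda>y. q y * u y) x > 0"
  using P_pos(1)[of x] r(3)[of x] by (simp add: op_P_kern zero_less_mult_iff)

text \<open>Outside the positivity set of \<open>w\<close> the integrand vanishes, both because of the factor \<open>w\<close> and because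
  division by zero yields zero, so the restriction of the domain of integration can be dropped.\<close>

lemma M_const_bound:
  assumes M: "M_const w w\<^sub>x p u < \<infinity>"
  shows "(\<integral>\<^sup>+y. ennreal ((w\<^sub>x (x - y) / w (x - y))\<^sup>2
        * (w (x - y) * (q y * u y) / conv w (\<lambda>y. q y * u y) x)) \<partial>lborel)
    \<le> ennreal (enn2real (M_const w w\<^sub>x p u))"
proof -
  have "(\<integral>\<^sup>+y. ennreal ((w\<^sub>x (x - y) / w (x - y))\<^sup>2
        * (w (x - y) * (q y * u y) / conv w (\<lambda>y. q y * u y) x)) \<partial>lborel)
    = (\<integral>\<^sup>+y\<in>(\<lambda>s. x - s) ` pos_set w. ennreal ((w\<^sub>x (x - y) / w (x - y))\<^sup>2 * p0 p u x y) \<partial>lborel)"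
  proof (rule nn_integral_cong)
    fix y
    have "y \<in> (\<lambda>s. x - s) ` pos_set w \<longleftrightarrow> w (x - y) > 0"
      by (auto simp: pos_set_def image_iff intro!: bexI[of _ "x - y"])
    then show "ennreal ((w\<^sub>x (x - y) / w (x - y))\<^sup>2 * (w (x - y) * (q y * u y) / conv w (\<lambda>y. q y * u y) x))
      = ennreal ((w\<^sub>x (x - y) / w (x - y))\<^sup>2 * p0 p u x y) * indicator ((\<lambda>s. x - s) ` pos_set w) y"
      using w(1)[of "x - y"] r(3)[of x]
      by (cases "w (x - y) = 0") (auto simp: p0_kern indicator_def mult.assoc)
  qed
  also have "\<dots> \<le> M_const w w\<^sub>x p u"
    unfolding M_const_def by (rule SUP_upper) simp
  finally show ?thesis using M by simp
qed

text \<open>The quotient rule applied to \<open>cond_eq\<close>, with the denominator bounded below by a multiple of \<open>u\<close>. The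
  bound is \<open>weighted_average_derivative_bound\<close> with \<open>\<phi> = q u\<close>.\<close>

lemma cond_weak_derivative:
  assumes v: "v \<in> weighted_L2 (rho u \<psi>)" and M: "M_const w w\<^sub>x p u < \<infinity>"
    and conv_deriv: "\<And>v. v \<in> weighted_L2 (rho u \<psi>) \<Longrightarrow> has_weak_derivative 1 (conv w v) (conv w\<^sub>x v)"
  defines "h \<equiv> \<lambda>x. v x / u x"
  shows "\<exists>g. has_weak_derivative 1 (cond h) g \<and>
    (AE x in lborel. m x * (g x)\<^sup>2 \<le> enn2real (M_const w w\<^sub>x p u) * (m x * cond_var h x))"
proof -
  define M' where "M' = enn2real (M_const w w\<^sub>x p u)"
  have [measurable]: "v \<in> borel_measurable borel" using v by (simp add: weighted_L2_def)
  have [measurable]: "h \<in> borel_measurable borel" unfolding h_def by measurable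
  define N D where "N = conv w (\<lambda>y. q y * v y)" and "D = conv w (\<lambda>y. q y * u y)"
  define g where "g = (\<lambda>x. conv w\<^sub>x (\<lambda>y. q y * v y) x / D x - N x * conv w\<^sub>x (\<lambda>y. q y * u y) x / (D x)\<^sup>2)"
  have [measurable]: "N \<in> borel_measurable borel" "D \<in> borel_measurable borel"
    unfolding N_def D_def conv_def by measurable
  obtain R where R: "\<And>x. \<bar>r x\<bar> \<le> R" using r(2) unfolding bounded_iff by auto
  have "R > 0" using R[of 0] r(3)[of 0] by linarith
  have "has_weak_derivative 1 (\<lambda>x. N x / D x) g"
    unfolding g_def
  proof (rule has_weak_derivative_divide)
    show "has_weak_derivative 1 N (conv w\<^sub>x (\<lambda>y. q y * v y))"
      unfolding N_def by (intro conv_deriv weighted_L2_rho_times_bounded v)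
    show "has_weak_derivative 1 D (conv w\<^sub>x (\<lambda>y. q y * u y))"
      unfolding D_def by (intro conv_deriv weighted_L2_rho_times_bounded u_in_weighted_L2)
    show "\<delta>\<^sub>1 / R * u x > 0" for x using \<delta>_pos(1) \<open>R > 0\<close> u(2) by simp
    show "\<delta>\<^sub>1 / R * u x \<le> D x" for x
    proof -
      have "\<delta>\<^sub>1 * u x \<le> r x * D x" using P_bounds(1)[of x] by (simp add: op_P_kern D_def)
      also have "\<dots> \<le> R * D x"
        using R[of x] conv_qu_pos[of x] by (intro mult_right_mono) (auto simp: D_def)
      finally show ?thesis using \<open>R > 0\<close> by (simp add: field_simps)
    qed
    show "continuous_on UNIV (\<lambda>x. \<delta>\<^sub>1 / R * u x)" by (intro continuous_intros u)
  qed measurable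
  moreover have "cond h = (\<lambda>x. N x / D x)"
    unfolding h_def N_def D_def by (rule ext) (rule cond_eq)
  moreover have "AE x in lborel. m x * (g x)\<^sup>2 \<le> M' * (m x * cond_var h x)"
  proof -
    have "integrable lborel (\<lambda>y. n y * (h y)\<^sup>2)"
      unfolding h_def by (rule quotient_square_integrable[OF v])
    from AE_cond_var[OF \<open>h \<in> borel_measurable borel\<close> this] show ?thesis
    proof eventually_elim
      case (elim x)
      define s where "s = \<psi> x * r x"
      have "s > 0" using \<psi>(2) r(3) by (simp add: s_def)
      have keq: "k x y = s * (w (x - y) * (q y * u y))" for y by (simp add: k_def kern_def s_def)
      have meq: "m x = s * D x" by (simp add: m_def op_P_kern D_def s_def)
      have veq: "(\<lambda>y. q y * v y) = (\<lambda>y. q y * u y * h y)"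
        using less_imp_neq[OF u(2)] by (auto simp: h_def)
      have Q: "conv w (\<lambda>y. q y * u y * h y) x / conv w (\<lambda>y. q y * u y) x = cond h x"
        using cond_eq[of v x] by (simp add: h_def[symmetric] veq[symmetric])
      have "(g x)\<^sup>2 \<le> M' * ((LINT y|lborel. w (x - y) * (q y * u y) * (h y - cond h x)\<^sup>2) / D x)"
        unfolding g_def N_def D_def veq Q[symmetric]
      proof (rule weighted_average_derivative_bound)
        show "AE z in lborel. w z = 0 \<longrightarrow> w\<^sub>x z = 0" by (rule w\<^sub>x_zero)
        show "0 \<le> q y * u y" for y using q(3) u(2) by (simp add: less_imp_le)
        have "integrable lborel (\<lambda>y. s * (w (x - y) * (q y * u y)))"
          using k_integrable_snd[of x] by (simp add: keq)
        then show "integrable lborel (\<lambda>y. w (x - y) * (q y * u y))" using \<open>s > 0\<close> by simp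
        have "integrable lborel (\<lambda>y. s * (w (x - y) * (q y * u y) * (h y)\<^sup>2))"
          using elim by (simp add: keq mult.assoc)
        then show "integrable lborel (\<lambda>y. w (x - y) * (q y * u y) * (h y)\<^sup>2)" using \<open>s > 0\<close> by simp
        show "conv w (\<lambda>y. q y * u y) x > 0" by (rule conv_qu_pos)
        show "(\<integral>\<^sup>+y. ennreal ((w\<^sub>x (x - y) / w (x - y))\<^sup>2
          * (w (x - y) * (q y * u y) / conv w (\<lambda>y. q y * u y) x)) \<partial>lborel) \<le> ennreal M'"
          unfolding M'_def by (rule M_const_bound[OF M])
      qed (auto simp: M'_def w(1))
      then have "m x * (g x)\<^sup>2 \<le> m x * (M' * ((LINT y|lborel. w (x - y) * (q y * u y) * (h y - cond h x)\<^sup>2) / D x))"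
        by (rule mult_left_mono) (rule less_imp_le[OF m_pos])
      also have "\<dots> = M' * (s * (LINT y|lborel. w (x - y) * (q y * u y) * (h y - cond h x)\<^sup>2))"
        unfolding meq using conv_qu_pos[of x] by (simp add: D_def)
      also have "s * (LINT y|lborel. w (x - y) * (q y * u y) * (h y - cond h x)\<^sup>2)
          = (LINT y|lborel. k x y * (h y - cond h x)\<^sup>2)"
        by (simp add: keq mult.assoc)
      also have "\<dots> = m x * cond_var h x" using elim by simp
      finally show ?case .
    qed
  qed
  ultimately show ?thesis unfolding M'_def by auto
qed

text \<open>The Poincare inequality is applied to the averaged function, not to \<open>h\<close> itself; its gradient is
  controlled by the conditional variance. All terms are stated after multiplication by \<open>Z\<close>.\<close>

lemma cond_Poincare:
  assumes v: "v \<in> weighted_L2 (rho u \<psi>)" and M: "M_const w w\<^sub>x p u < \<infinity>"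
    and conv_deriv: "\<And>v. v \<in> weighted_L2 (rho u \<psi>) \<Longrightarrow> has_weak_derivative 1 (conv w v) (conv w\<^sub>x v)"
    and "\<kappa>\<^sub>0 > 0" and Poincare: "\<And>h. h \<in> weighted_H 1 (mu p u \<psi>) \<Longrightarrow>
            weighted_Var (mu p u \<psi>) h \<le> \<kappa>\<^sub>0 * (LINT x|lborel. (weak_deriv 1 h x)\<^sup>2 * mu p u \<psi> x)"
  defines "h \<equiv> \<lambda>x. v x / u x"
  shows "(LINT x|lborel. m x * (cond h x)\<^sup>2) - (LINT x|lborel. m x * cond h x)\<^sup>2 / Z
    \<le> \<kappa>\<^sub>0 * enn2real (M_const w w\<^sub>x p u) * (LINT x|lborel. m x * cond_var h x)"
proof -
  define M' where "M' = enn2real (M_const w w\<^sub>x p u)"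
  have [measurable]: "v \<in> borel_measurable borel" using v by (simp add: weighted_L2_def)
  have hm [measurable]: "h \<in> borel_measurable borel" unfolding h_def by measurable
  have h2: "integrable lborel (\<lambda>y. n y * (h y)\<^sup>2)"
    unfolding h_def by (rule quotient_square_integrable[OF v])
  obtain g where g: "has_weak_derivative 1 (cond h) g"
    and bound: "AE x in lborel. m x * (g x)\<^sup>2 \<le> M' * (m x * cond_var h x)"
    using cond_weak_derivative[OF v M conv_deriv] unfolding h_def M'_def by blast
  have gm [measurable]: "g \<in> borel_measurable borel" "weak_deriv 1 (cond h) \<in> borel_measurable borel"
    using g has_weak_derivative_weak_deriv[OF g]
    by (auto simp: has_weak_derivative_def intro: locally_integrable_measurable)
  have gint: "integrable lborel (\<lambda>x. m x * (g x)\<^sup>2)"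
  proof (rule Bochner_Integration.integrable_bound)
    show "integrable lborel (\<lambda>x. M' * (m x * cond_var h x))"
      using cond_var_integrable[OF hm h2] by simp
    show "AE x in lborel. norm (m x * (g x)\<^sup>2) \<le> norm (M' * (m x * cond_var h x))"
      using bound
    proof eventually_elim
      case (elim x)
      have "0 \<le> m x * (g x)\<^sup>2" using less_imp_le[OF m_pos[of x]] by simp
      with elim show ?case unfolding real_norm_def by linarith
    qed
  qed measurable
  have L2: "s \<in> weighted_L2 (mu p u \<psi>)"
    if "s \<in> borel_measurable borel" "integrable lborel (\<lambda>x. m x * (s x)\<^sup>2)" for s
    using that by (simp add: weighted_L2_def mu_eq mult.commute)
  have "cond h \<in> weighted_H 1 (mu p u \<psi>)"
    unfolding weighted_H_def using g L2[OF gm(1) gint] L2[OF cond_measurable[OF hm] cond_square_integrable[OF hm h2]]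
    by auto
  from Poincare[OF this]
  have "(LINT x|lborel. m x * (cond h x)\<^sup>2) / Z - ((LINT x|lborel. m x * cond h x) / Z)\<^sup>2
      \<le> \<kappa>\<^sub>0 * ((LINT x|lborel. m x * (weak_deriv 1 (cond h) x)\<^sup>2) / Z)"
    by (simp add: weighted_Var_def mu_eq mult.commute[of _ "m _"])
  also have "(LINT x|lborel. m x * (weak_deriv 1 (cond h) x)\<^sup>2) = (LINT x|lborel. m x * (g x)\<^sup>2)"
  proof (rule integral_cong_AE)
    show "AE x in lborel. m x * (weak_deriv 1 (cond h) x)\<^sup>2 = m x * (g x)\<^sup>2"
      using has_weak_derivative_unique[OF has_weak_derivative_weak_deriv[OF g] g] by eventually_elim simp
  qed measurable
  also have "\<kappa>\<^sub>0 * ((LINT x|lborel. m x * (g x)\<^sup>2) / Z) \<le> \<kappa>\<^sub>0 * ((LINT x|lborel. M' * (m x * cond_var h x)) / Z)"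
    using \<open>\<kappa>\<^sub>0 > 0\<close> Z_pos gint bound cond_var_integrable[OF hm h2]
    by (intro mult_left_mono divide_right_mono integral_mono_AE) auto
  also have "\<dots> = \<kappa>\<^sub>0 * M' * (LINT x|lborel. m x * cond_var h x) / Z" by simp
  finally have "Z * ((LINT x|lborel. m x * (cond h x)\<^sup>2) / Z - ((LINT x|lborel. m x * cond h x) / Z)\<^sup>2)
      \<le> Z * (\<kappa>\<^sub>0 * M' * (LINT x|lborel. m x * cond_var h x) / Z)"
    using Z_pos by (intro mult_left_mono) auto
  moreover have "Z * ((LINT x|lborel. m x * (cond h x)\<^sup>2) / Z - ((LINT x|lborel. m x * cond h x) / Z)\<^sup>2)
     = (LINT x|lborel. m x * (cond h x)\<^sup>2) - (LINT x|lborel. m x * cond h x)\<^sup>2 / Z"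
    using Z_pos by (simp add: right_diff_distrib power2_eq_square)
  ultimately show ?thesis using Z_pos by (simp add: M'_def)
qed

text \<open>The spectral gap of the averaging: total variance is conditional variance plus the variance of the
  conditional mean, and \<open>cond_Poincare\<close> bounds the latter by the former. The variance that occurs is the one of \<open>Y\<close>,
  with density proportional to \<open>n\<close>, which is why the lower bound for \<open>P\<^sup>* \<psi>\<close> enters.\<close>

lemma variance_le_cond_var:
  assumes v: "v \<in> weighted_L2 (rho u \<psi>)" and M: "M_const w w\<^sub>x p u < \<infinity>"
    and conv_deriv: "\<And>v. v \<in> weighted_L2 (rho u \<psi>) \<Longrightarrow> has_weak_derivative 1 (conv w v) (conv w\<^sub>x v)"
    and "\<kappa>\<^sub>0 > 0" and Poincare: "\<And>h. h \<in> weighted_H 1 (mu p u \<psi>) \<Longrightarrow>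
            weighted_Var (mu p u \<psi>) h \<le> \<kappa>\<^sub>0 * (LINT x|lborel. (weak_deriv 1 h x)\<^sup>2 * mu p u \<psi> x)"
  defines "h \<equiv> \<lambda>x. v x / u x"
  shows "\<delta>\<^sub>1' * ((LINT x|lborel. u x * \<psi> x * (h x)\<^sup>2) - (LINT x|lborel. u x * \<psi> x * h x)\<^sup>2)
    \<le> (1 + \<kappa>\<^sub>0 * enn2real (M_const w w\<^sub>x p u)) * (LINT x|lborel. m x * cond_var h x)"
proof -
  have [measurable]: "v \<in> borel_measurable borel" using v by (simp add: weighted_L2_def)
  have hm [measurable]: "h \<in> borel_measurable borel" unfolding h_def by measurable
  have sq: "integrable lborel (\<lambda>x. n x * (h x)\<^sup>2)" "integrable lborel (\<lambda>x. u x * \<psi> x * (h x)\<^sup>2)"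
    unfolding h_def by (rule quotient_square_integrable[OF v])+
  have "\<delta>\<^sub>1' * ((LINT x|lborel. u x * \<psi> x * (h x)\<^sup>2) - (LINT x|lborel. u x * \<psi> x * h x)\<^sup>2)
    \<le> (LINT x|lborel. n x * (h x)\<^sup>2) - (LINT x|lborel. n x * h x)\<^sup>2 / (LINT x|lborel. n x)"
    using n_ge u\<psi> n_integrable \<delta>_pos Z_pos sq u(2) \<psi>(2) hm
    by (intro variance_mono_density) (auto simp: integral_n less_imp_le)
  also have "\<dots> = (LINT x|lborel. m x * cond_var h x)
      + ((LINT x|lborel. m x * (cond h x)\<^sup>2) - (LINT x|lborel. m x * cond h x)\<^sup>2 / Z)"
    using integral_cond[OF hm square_integrable_imp_integrable[OF hm sq(1)]]
    by (simp add: integral_cond_var[OF hm sq(1)] integral_n)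
  also have "\<dots> \<le> (LINT x|lborel. m x * cond_var h x)
      + \<kappa>\<^sub>0 * enn2real (M_const w w\<^sub>x p u) * (LINT x|lborel. m x * cond_var h x)"
    using cond_Poincare[OF v M conv_deriv \<open>\<kappa>\<^sub>0 > 0\<close> Poincare] by (simp add: h_def)
  finally show ?thesis by (simp add: distrib_right)
qed

end

theorem theorem4:
  fixes c d :: real
    and f r q w w\<^sub>x u \<psi> :: "real \<Rightarrow> real"
    and K\<^sub>\<rho> \<delta>\<^sub>1 \<delta>\<^sub>2 \<delta>\<^sub>1' \<delta>\<^sub>2' \<kappa>\<^sub>0 :: real
  defines "p \<equiv> kern r w q"
    and "\<rho> \<equiv> rho u \<psi>"
    and "\<mu> \<equiv> mu (kern r w q) u \<psi>"
    and "M \<equiv> M_const w w\<^sub>x (kern r w q) u"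
  assumes "d \<ge> 0"
    and "continuous_on UNIV f" "bounded (range f)"
    and "continuous_on UNIV r" "bounded (range r)" "(INF x. r x) > 0"
    and "continuous_on UNIV q" "bounded (range q)" "(INF x. q x) > 0"
    and "\<And>x. w x \<ge> 0" "integrable lborel w" "(LINT x|lborel. w x) = 1"
    and "AE x in lborel. (w has_real_derivative w\<^sub>x x) (at x)" "integrable lborel w\<^sub>x"
    \<comment> \<open>the null functions, identified with their continuous representatives\<close>
    and "u \<in> weighted_H 2 (\<lambda>_. 1)" "AE x in lborel. op_L f c d p u x = 0"
    and "\<And>v. v \<in> weighted_H 2 (\<lambda>_. 1) \<Longrightarrow> AE x in lborel. op_L f c d p v x = 0
            \<Longrightarrow> \<exists>a. AE x in lborel. v x = a * u x"
    and "continuous_on UNIV u" "\<And>x. u x > 0"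
    and "\<psi> \<in> weighted_H 2 (\<lambda>_. 1)" "AE x in lborel. op_L_adj f c d p \<psi> x = 0"
    and "\<And>v. v \<in> weighted_H 2 (\<lambda>_. 1) \<Longrightarrow> AE x in lborel. op_L_adj f c d p v x = 0
            \<Longrightarrow> \<exists>a. AE x in lborel. v x = a * \<psi> x"
    and "continuous_on UNIV \<psi>" "\<And>x. \<psi> x > 0"
    and "weighted_inner (\<lambda>_. 1) u \<psi> = 1"
    and "\<And>x. integrable lborel (\<lambda>y. w (x - y) * \<rho> y)" "\<And>x. conv w \<rho> x \<le> K\<^sub>\<rho> * \<rho> x"
    and "\<And>v. v \<in> weighted_L2 \<rho> \<Longrightarrow> has_weak_derivative 1 (conv w v) (conv w\<^sub>x v)"
    and "M < \<infinity>"
    and "\<delta>\<^sub>1 > 0" "\<delta>\<^sub>2 > 0" "\<delta>\<^sub>1' > 0" "\<delta>\<^sub>2' > 0"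
    and "\<And>x. \<delta>\<^sub>1 * u x \<le> op_P p u x" "\<And>x. op_P p u x \<le> \<delta>\<^sub>2 * u x"
    and "\<And>x. \<delta>\<^sub>1' * \<psi> x \<le> op_P_adj p \<psi> x" "\<And>x. op_P_adj p \<psi> x \<le> \<delta>\<^sub>2' * \<psi> x"
    and "\<kappa>\<^sub>0 > 0"
    and "\<And>h. h \<in> weighted_H 1 \<mu> \<Longrightarrow>
            weighted_Var \<mu> h \<le> \<kappa>\<^sub>0 * (LINT x|lborel. (weak_deriv 1 h x)\<^sup>2 * \<mu> x)"
  shows "\<forall>v \<in> weighted_H 2 \<rho>.
           weighted_inner \<rho> (op_L f c d p v) v
             \<le> - (\<delta>\<^sub>1' / 2 * (1 - \<kappa>\<^sub>0 * enn2real M / (1 + \<kappa>\<^sub>0 * enn2real M)))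
                 * ((weighted_norm \<rho> v)\<^sup>2 - (weighted_inner \<rho> v u)\<^sup>2)"
proof
  fix v assume v: "v \<in> weighted_H 2 \<rho>"
  have conv_deriv: "has_weak_derivative 1 (conv w z) (conv w\<^sub>x z)" if "z \<in> weighted_L2 \<rho>" for z
    using that by fact
  have Poincare: "weighted_Var \<mu> z \<le> \<kappa>\<^sub>0 * (LINT x|lborel. (weak_deriv 1 z x)\<^sup>2 * \<mu> x)"
    if "z \<in> weighted_H 1 \<mu>" for z
    using that by fact
  note f = \<open>continuous_on UNIV f\<close> \<open>bounded (range f)\<close>
  note u = \<open>continuous_on UNIV u\<close> \<open>\<And>x. u x > 0\<close> and \<psi> = \<open>continuous_on UNIV \<psi>\<close> \<open>\<And>x. \<psi> x > 0\<close>
  have pos: "s x > 0" if "bounded (range s)" "(INF x. s x) > 0" for s :: "real \<Rightarrow> real" and x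
  proof -
    have "(INF x. s x) \<le> s x" using that(1) by (intro cINF_lower bounded_imp_bdd_below) auto
    then show ?thesis using that(2) by linarith
  qed
  have one: "(\<lambda>_. 1 :: real) \<in> borel_measurable borel" by simp
  have L2: "u \<in> weighted_L2 (\<lambda>_. 1)" "\<psi> \<in> weighted_L2 (\<lambda>_. 1)"
    using \<open>u \<in> weighted_H 2 (\<lambda>_. 1)\<close> \<open>\<psi> \<in> weighted_H 2 (\<lambda>_. 1)\<close> by (auto simp: weighted_H_def)
  have u\<psi>: "integrable lborel (\<lambda>x. u x * \<psi> x)"
    using weighted_L2_mult_integrable[OF L2] by simp
  interpret S: positive_null_functions r q w w\<^sub>x u \<psi> \<delta>\<^sub>1 \<delta>\<^sub>2 \<delta>\<^sub>1' \<delta>\<^sub>2'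
  proof
    show "r x > 0" "q x > 0" for x
      by (rule pos, fact+)+
    show "(LINT x|lborel. u x * \<psi> x) = 1"
      using \<open>weighted_inner (\<lambda>_. 1) u \<psi> = 1\<close> by (simp add: weighted_inner_def)
  qed (fact assms[unfolded p_def] u\<psi>)+
  have \<rho>m [measurable]: "\<rho> \<in> borel_measurable borel" unfolding \<rho>_def rho_def by measurable
  have [measurable]: "f \<in> borel_measurable borel" using f(1) by (rule borel_measurable_continuous_onI)
  have u0: "u x \<noteq> 0" for x using u(2)[of x] by simp

  \<comment> \<open>Continuously differentiable representatives of all functions involved; the continuous functions \<open>u\<close> and \<open>\<psi>\<close>
    coincide with theirs.\<close>
  obtain U U' where U: "has_ac_derivative U U'" "has_ac_derivative U' (weak_deriv 2 u)"
      "AE x in lborel. u x = U x" "AE x in lborel. weak_deriv 1 u x = U' x"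
    using weighted_H_2_C1_representative[OF \<open>u \<in> weighted_H 2 (\<lambda>_. 1)\<close> one] by blast
  have "u = U" by (rule AE_eq_continuous_imp_eq[OF U(3) u(1) ac_continuous_on[OF U(1)]])
  then have acu: "has_ac_derivative u U'" using U(1) by simp
  obtain W W' where W: "has_ac_derivative W W'" "has_ac_derivative W' (weak_deriv 2 \<psi>)"
      "AE x in lborel. \<psi> x = W x" "AE x in lborel. weak_deriv 1 \<psi> x = W' x"
    using weighted_H_2_C1_representative[OF \<open>\<psi> \<in> weighted_H 2 (\<lambda>_. 1)\<close> one] by blast
  have "\<psi> = W" by (rule AE_eq_continuous_imp_eq[OF W(3) \<psi>(1) ac_continuous_on[OF W(1)]])
  then have ac\<psi>: "has_ac_derivative \<psi> W'" using W(1) by simp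
  obtain V V' where V: "has_ac_derivative V V'" "has_ac_derivative V' (weak_deriv 2 v)"
      "AE x in lborel. v x = V x" "AE x in lborel. weak_deriv 1 v x = V' x"
      and V2: "V \<in> weighted_L2 \<rho>" "V' \<in> weighted_L2 \<rho>" "weak_deriv 2 v \<in> weighted_L2 \<rho>"
    using weighted_H_2_C1_representative[OF v \<rho>m] by blast
  have vm [measurable]: "v \<in> borel_measurable borel" "V \<in> borel_measurable borel" "V' \<in> borel_measurable borel"
    "weak_deriv 2 v \<in> borel_measurable borel"
    using v V2 by (auto simp: weighted_H_def weighted_L2_def)
  have wd1 [measurable]: "weak_deriv 1 v \<in> borel_measurable borel"
  proof -
    obtain g where "has_weak_derivative 1 v g" using v unfolding weighted_H_def by force
    from has_weak_derivative_weak_deriv[OF this] show ?thesis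
      by (auto simp: has_weak_derivative_def intro: locally_integrable_measurable)
  qed
  define h where "h = (\<lambda>x. V x / u x)"
  have hm [measurable]: "h \<in> borel_measurable borel" unfolding h_def by measurable
  have sq: "integrable lborel (\<lambda>x. S.m x * (h x)\<^sup>2)" "integrable lborel (\<lambda>x. S.n x * (h x)\<^sup>2)"
    unfolding h_def by (rule S.quotient_square_integrable[OF V2(1)[unfolded \<rho>_def]])+

  have Lu: "AE x in lborel. - f x * u x + c * U' x + d * weak_deriv 2 u x + op_P p u x = 0"
    using \<open>AE x in lborel. op_L f c d p u x = 0\<close> U(4)
    by eventually_elim (simp add: op_L_def op_A_def)
  have L\<psi>: "AE x in lborel. - f x * \<psi> x - c * W' x + d * weak_deriv 2 \<psi> x + op_P_adj p \<psi> x = 0"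
    using \<open>AE x in lborel. op_L_adj f c d p \<psi> x = 0\<close> W(4)
    by eventually_elim (simp add: op_L_adj_def op_A_adj_def)
  obtain B where B: "\<And>x. \<bar>f x\<bar> \<le> B" using f(2) unfolding bounded_iff by auto
  define AV where "AV = (\<lambda>x. - f x * V x + c * V' x + d * weak_deriv 2 v x)"
  have [measurable]: "AV \<in> borel_measurable borel" unfolding AV_def by measurable
  \<comment> \<open>The densities produced by the local part are the marginals of the kernel.\<close>
  have mn: "(\<lambda>x. (V x / u x)\<^sup>2 * (\<psi> x * op_P p u x)) = (\<lambda>x. S.m x * (h x)\<^sup>2)"
    "(\<lambda>x. (V x / u x)\<^sup>2 * (u x * op_P_adj p \<psi> x)) = (\<lambda>x. S.n x * (h x)\<^sup>2)"
    by (auto simp: S.m_def S.n_def p_def h_def)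
  have local: "integrable lborel (\<lambda>x. AV x * V x * \<rho> x)"
    "2 * (LINT x|lborel. AV x * V x * \<rho> x)
      \<le> - (LINT x|lborel. S.m x * (h x)\<^sup>2) - (LINT x|lborel. S.n x * (h x)\<^sup>2)"
    using local_energy_inequality[OF \<open>d \<ge> 0\<close> B f(1) acu U(2) u(2) ac\<psi> W(2) \<psi>(2) V(1,2)
        Lu less_imp_le[OF S.P_pos(1), folded p_def] L\<psi> less_imp_le[OF S.P_pos(2), folded p_def]
        V2[unfolded \<rho>_def] sq(1,2)[folded mn]]
    unfolding AV_def \<rho>_def mn by blast+
  \<comment> \<open>The nonlocal part supplies the mixed term of the Dirichlet form.\<close>
  have PV: "op_P p V x * V x * \<rho> x = S.m x * (h x * S.cond h x)" for x
  proof -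
    have "op_P p V x = (LINT y|lborel. p x y * u y * h y)"
      unfolding op_P_def using u0 by (intro Bochner_Integration.integral_cong) (auto simp: h_def)
    then have "\<psi> x * op_P p V x = (LINT y|lborel. S.k x y * h y)"
      by (simp add: S.k_def p_def mult.assoc)
    also have "\<dots> = S.m x * S.cond h x" by (simp add: S.m_times_cond)
    finally have "\<psi> x * op_P p V x * h x = S.m x * S.cond h x * h x" by simp
    then show ?thesis by (simp add: h_def \<rho>_def rho_def mult_ac)
  qed
  have [measurable]: "op_P p s \<in> borel_measurable borel" if [measurable]: "s \<in> borel_measurable borel" for s
    unfolding op_P_def p_def kern_def by measurable
  have PvV: "op_P p v x = op_P p V x" for x
    unfolding op_P_def p_def kern_def
  proof (rule integral_cong_AE)
    show "AE y in lborel. r x * w (x - y) * q y * v y = r x * w (x - y) * q y * V y"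
      using V(3) by eventually_elim simp
  qed measurable
  have "weighted_inner \<rho> (op_L f c d p v) v = (LINT x|lborel. AV x * V x * \<rho> x + S.m x * (h x * S.cond h x))"
    unfolding weighted_inner_def
  proof (rule integral_cong_AE)
    show "(\<lambda>x. op_L f c d p v x * v x * \<rho> x) \<in> borel_measurable lborel"
      unfolding op_L_def op_A_def by measurable
    show "AE x in lborel. op_L f c d p v x * v x * \<rho> x = AV x * V x * \<rho> x + S.m x * (h x * S.cond h x)"
      using V(3,4)
      by eventually_elim (simp add: op_L_def op_A_def AV_def PV[symmetric] PvV distrib_right)
  qed measurable
  also have "\<dots> = (LINT x|lborel. AV x * V x * \<rho> x) + (LINT x|lborel. S.m x * (h x * S.cond h x))"
    using local(1) S.cross_integrable[OF hm sq(2,1)] by simp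
  finally have inner: "2 * weighted_inner \<rho> (op_L f c d p v) v
      \<le> - (LINT x|lborel. S.m x * S.cond_var h x)"
    using local(2) S.Dirichlet_form_ge_cond_var[OF hm sq(2,1)] by simp

  have norm: "(weighted_norm \<rho> v)\<^sup>2 = (LINT x|lborel. u x * \<psi> x * (h x)\<^sup>2)"
  proof -
    have "weighted_inner \<rho> v v = (LINT x|lborel. u x * \<psi> x * (h x)\<^sup>2)"
      unfolding weighted_inner_def
    proof (rule integral_cong_AE)
      show "AE x in lborel. v x * v x * \<rho> x = u x * \<psi> x * (h x)\<^sup>2"
        using V(3) by eventually_elim (use u0 in \<open>simp add: h_def \<rho>_def rho_def power2_eq_square\<close>)
    qed measurable
    moreover have "\<dots> \<ge> 0" using u(2) \<psi>(2) by (intro integral_nonneg_AE AE_I2) (simp add: less_imp_le)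
    ultimately show ?thesis by (simp add: weighted_norm_def)
  qed
  have mean: "weighted_inner \<rho> v u = (LINT x|lborel. u x * \<psi> x * h x)"
    unfolding weighted_inner_def
  proof (rule integral_cong_AE)
    show "AE x in lborel. v x * u x * \<rho> x = u x * \<psi> x * h x"
      using V(3) by eventually_elim (use u0 in \<open>simp add: h_def \<rho>_def rho_def\<close>)
  qed measurable
  define s where "s = \<kappa>\<^sub>0 * enn2real M"
  define R where "R = (weighted_norm \<rho> v)\<^sup>2 - (weighted_inner \<rho> v u)\<^sup>2"
  have "s \<ge> 0" using \<open>\<kappa>\<^sub>0 > 0\<close> by (simp add: s_def)
  have "\<delta>\<^sub>1' * R \<le> (1 + s) * (LINT x|lborel. S.m x * S.cond_var h x)"
    using S.variance_le_cond_var[OF V2(1)[unfolded \<rho>_def] \<open>M < \<infinity>\<close>[unfolded M_def]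
        conv_deriv[unfolded \<rho>_def] \<open>\<kappa>\<^sub>0 > 0\<close> Poincare[unfolded \<mu>_def]]
    unfolding norm mean R_def s_def h_def M_def .
  then have "\<delta>\<^sub>1' * R / (1 + s) \<le> (LINT x|lborel. S.m x * S.cond_var h x)"
    using \<open>s \<ge> 0\<close> by (simp add: divide_le_eq mult.commute)
  moreover have "a \<le> - C / 2" if "2 * a \<le> - b" "C \<le> b" for a b C :: real
    using that by linarith
  ultimately have "weighted_inner \<rho> (op_L f c d p v) v \<le> - (\<delta>\<^sub>1' * R / (1 + s)) / 2"
    using inner by blast
  also have "\<dots> = - (\<delta>\<^sub>1' / 2 * (1 / (1 + s))) * R" by simp
  finally have "weighted_inner \<rho> (op_L f c d p v) v \<le> - (\<delta>\<^sub>1' / 2 * (1 / (1 + s))) * R" .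
  moreover have "1 - s / (1 + s) = 1 / (1 + s)" using \<open>s \<ge> 0\<close> by (simp add: field_simps)
  ultimately show "weighted_inner \<rho> (op_L f c d p v) v
      \<le> - (\<delta>\<^sub>1' / 2 * (1 - \<kappa>\<^sub>0 * enn2real M / (1 + \<kappa>\<^sub>0 * enn2real M)))
        * ((weighted_norm \<rho> v)\<^sup>2 - (weighted_inner \<rho> v u)\<^sup>2)"
    by (simp add: s_def[symmetric] R_def[symmetric])
qed

end
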